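(* Let $m=m(n)\ge1$ be integers with $m=o(n)$ as $n\to\infty$, and let $h:[0,\infty)\to\mathbb{R}$ be a measurable function (which may depend on $n$). Let $$g(|X_0^m|)=h(|X_0^m|)-E h(|X_0^m|)-(X_0-1)\operatorname{cov}\big(h(|X_0^m|),|X_0^m|\big),$$ $$\sigma_m^2=\sum_{j=-m+1}^{m-1}\operatorname{cov}\big(h(|X_0^m|),h(|X_j^m|)\big)-\operatorname{cov}^2\big(h(|X_0^m|),|X_0^m|\big),$$ and suppose that for some $r>2$ $$\frac{m^{r-1}}{n^{(r-2)/2}\sigma_m^r}\,E\big|g(|X_0^m|)\big|^r\to0\quad(n\to\infty).$$ Then for $V_{n,m}=\sum_{k=0}^{n-1}h(nS_{k,m})$ we have, as $n\to\infty$, $$\frac{V_{n,m}-nE h(|X_0^m|)}{\sigma_m\sqrt n}\xrightarrow{d}\mathcal N(0,1).$$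
   Context: Spacings: let $0\le U_1\le U_2\le\dots\le U_{n-1}\le 1$ be the order statistics of a sample of size $n-1$ from the uniform distribution on $[0,1]$. Put $U_0=0$, $U_n=1$, and $U_k=1+U_{k-n}$ for $k\ge n$. The overlapping spacings of order $m$ are $S_{k,m}=U_{k+m}-U_k$, $k=0,\dots,n-1$. Exponentials: $X_0,X_1,\dots,X_{n-1}$ are independent random variables with the standard exponential distribution (mean 1), with indices understood modulo $n$ ($X_{n+j}=X_j$); $|X_j^m|=X_j+\dots+X_{j+m-1}$. The notation $g(|X_0^m|)$ denotes the random variable defined in the claim (it also depends on $X_0$). It is understood that $\sigma_m>0$ and that all moments occurring are finite. $\xrightarrow{d}$ is convergence in distribution; $\mathcal N(0,1)$ is the standard normal law. *)

theory Defs
  imports "HOL-Probability.Probability" "HOL-Library.Landau_Symbols"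
begin

(* For a sample y 0, ..., y (n - 2), this is U_k: for k < n it is 0 or an order statistic, and the
   rule U_k = 1 + U_{k-n} for k >= n is unrolled through k div n and k mod n. In particular U_n = 1. *)
definition ordered_point :: "nat \<Rightarrow> (nat \<Rightarrow> real) \<Rightarrow> nat \<Rightarrow> real" where
  "ordered_point n y k = real (k div n) +
     (if k mod n = 0 then 0 else sort (map y [0..<n - 1]) ! (k mod n - 1))"

definition overlapping_spacing :: "nat \<Rightarrow> nat \<Rightarrow> (nat \<Rightarrow> real) \<Rightarrow> nat \<Rightarrow> real" where
  "overlapping_spacing n m y k = ordered_point n y (k + m) - ordered_point n y k"

(* Functions h on [0, oo) are represented by total functions on the reals: a measurable h extends by 0,
   and the values on negative arguments are irrelevant because spacings and sums of exponentials
   are almost surely nonnegative. *)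
definition spacing_sum ::
    "nat \<Rightarrow> nat \<Rightarrow> (real \<Rightarrow> real) \<Rightarrow> (nat \<Rightarrow> 'a \<Rightarrow> real) \<Rightarrow> 'a \<Rightarrow> real" where
  "spacing_sum n m h Y \<omega> =
     (\<Sum>k<n. h (real n * overlapping_spacing n m (\<lambda>i. Y i \<omega>) k))"

(* |X_j^m| = X_j + ... + X_{j+m-1}; the indices are integers, reduced modulo n *)
definition cyclic_sum :: "nat \<Rightarrow> nat \<Rightarrow> (nat \<Rightarrow> 'a \<Rightarrow> real) \<Rightarrow> int \<Rightarrow> 'a \<Rightarrow> real" where
  "cyclic_sum n m X j \<omega> = (\<Sum>i<m. X (nat ((j + int i) mod int n)) \<omega>)"

definition cov :: "'a measure \<Rightarrow> ('a \<Rightarrow> real) \<Rightarrow> ('a \<Rightarrow> real) \<Rightarrow> real" where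
  "cov M A B = prob_space.expectation M
     (\<lambda>\<omega>. (A \<omega> - prob_space.expectation M A) * (B \<omega> - prob_space.expectation M B))"

definition centered_g ::
    "'a measure \<Rightarrow> nat \<Rightarrow> nat \<Rightarrow> (real \<Rightarrow> real) \<Rightarrow> (nat \<Rightarrow> 'a \<Rightarrow> real) \<Rightarrow> 'a \<Rightarrow> real" where
  "centered_g M n m h X \<omega> =
     h (cyclic_sum n m X 0 \<omega>)
     - prob_space.expectation M (\<lambda>\<omega>. h (cyclic_sum n m X 0 \<omega>))
     - (X 0 \<omega> - 1) * cov M (\<lambda>\<omega>. h (cyclic_sum n m X 0 \<omega>)) (cyclic_sum n m X 0)"

definition sigma_sq ::
    "'a measure \<Rightarrow> nat \<Rightarrow> nat \<Rightarrow> (real \<Rightarrow> real) \<Rightarrow> (nat \<Rightarrow> 'a \<Rightarrow> real) \<Rightarrow> real" where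
  "sigma_sq M n m h X =
     (\<Sum>j = - int m + 1..int m - 1.
        cov M (\<lambda>\<omega>. h (cyclic_sum n m X 0 \<omega>)) (\<lambda>\<omega>. h (cyclic_sum n m X j \<omega>)))
     - (cov M (\<lambda>\<omega>. h (cyclic_sum n m X 0 \<omega>)) (cyclic_sum n m X 0))\<^sup>2"

end

theory Submission
  imports Defs "HOL-Combinatorics.Permutations"
begin

text \<open>Scale the sample by n. The n gaps cut out of [0, n] by n - 1 independent uniform points
  are distributed like n independent standard exponentials conditioned to have sum n. A central
  limit theorem is proved for the exponentials and carried over to the gaps through densities,
  without conditioning on a null event.

  The scaled gaps add up to exactly n. Hence subtracting from each h-term a fixed multiple of (its
  first gap minus 1) does not change the centred sum (\<open>spacing_sum_centered\<close>). With the
  multiple cov(h(|X_0^m|), |X_0^m|) the resulting terms g have, for exponentials, no long-run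
  covariance with the sum of the coordinates, and their long-run variance is sigma_m^2
  (\<open>long_run_variance\<close>).

  Fix 0 < \<alpha> < 1 and K close to \<alpha> n. Relative to independent exponentials, the first K
  + m gaps have a density that depends on their sum only (\<open>spacing_law_initial\<close>). With
  S the centred sum divided by sqrt n, this density is, up to normalisation, close in L1 to exp(-S^2
  / (2 (1 - \<alpha>))) (\<open>gamma_ratio_limit\<close>, \<open>gamma_ratio_expectation\<close>).
  That kernel is a characteristic function of the normal law, so the weighted expectation becomes a
  normal mixture of joint characteristic functions of (sum of g, S) under independence. The two are
  asymptotically independent and normal (\<open>joint_char\<close>), so the weight contributes only
  a constant factor, which cancels on normalising: the first K terms g of the spacings are
  asymptotically N(0, \<alpha>) after scaling (\<open>weighted_char\<close>,
  \<open>partial_sum_char\<close>).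

  The law of the gaps is invariant under rotation (\<open>distr_rotate_iterate_spacing_law\<close>).
  So the remaining n - K terms form a partial sum of the same kind with fraction 1 - \<alpha>, which
  is negligible as \<alpha> tends to 1; \<open>char_perturbation\<close> turns this into convergence
  of the characteristic function of the full sum (\<open>total_char\<close>), and Levy continuity
  concludes.

  \<open>joint_char\<close> rests on \<open>one_dependent_clt\<close>. Sums of the m-dependent terms
  over stretches of length m form a stationary one-dependent sequence, for which the moment
  hypothesis gives a Lindeberg condition. Bernstein blocking then separates long blocks by single
  omitted terms. The Lindeberg condition for long blocks comes from a first-passage argument
  (\<open>first_passage_tail\<close>) that uses truncation and variances only.\<close>

section \<open>Functions of some coordinates of an iid sequence, and independence\<close>

definition depends_on :: "'i set \<Rightarrow> (('i \<Rightarrow> 'a) \<Rightarrow> 'b) \<Rightarrow> bool" where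
  "depends_on A F \<longleftrightarrow> (\<forall>x y. (\<forall>i\<in>A. x i = y i) \<longrightarrow> F x = F y)"

lemma depends_onI: "(\<And>x y. (\<And>i. i \<in> A \<Longrightarrow> x i = y i) \<Longrightarrow> F x = F y) \<Longrightarrow> depends_on A F"
  unfolding depends_on_def by blast

lemma depends_onD: "depends_on A F \<Longrightarrow> (\<And>i. i \<in> A \<Longrightarrow> x i = y i) \<Longrightarrow> F x = F y"
  unfolding depends_on_def by blast

lemma depends_on_mono: "depends_on A F \<Longrightarrow> A \<subseteq> B \<Longrightarrow> depends_on B F"
  unfolding depends_on_def by blast

lemma depends_on_comp: "depends_on A F \<Longrightarrow> depends_on A (\<lambda>x. g (F x))"
  unfolding depends_on_def by metis

lemma depends_on_comp2:
  "depends_on A F \<Longrightarrow> depends_on A G \<Longrightarrow> depends_on A (\<lambda>x. g (F x) (G x))"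
  unfolding depends_on_def by metis

lemma depends_on_sum:
  "(\<And>j. j \<in> J \<Longrightarrow> depends_on A (F j)) \<Longrightarrow> depends_on A (\<lambda>x. \<Sum>j\<in>J. F j x)"
  unfolding depends_on_def by (auto intro!: sum.cong)

lemma set_integral_abs_le_square:
  fixes f :: "'a \<Rightarrow> real"
  assumes "prob_space M" "f \<in> borel_measurable M" "integrable M (\<lambda>x. (f x)\<^sup>2)"
  shows "(\<integral>x. \<bar>f x\<bar> \<partial>M) \<le> sqrt (\<integral>x. (f x)\<^sup>2 \<partial>M)"
proof -
  interpret prob_space M by fact
  have i: "integrable M f" using square_integrable_imp_integrable[OF assms(2,3)] .
  have "(\<integral>x. \<bar>f x\<bar> \<partial>M)\<^sup>2 \<le> (\<integral>x. \<bar>f x\<bar>\<^sup>2 \<partial>M)"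
  proof -
    have "0 \<le> variance (\<lambda>x. \<bar>f x\<bar>)" by (rule integral_nonneg_AE) auto
    also have "\<dots> = (\<integral>x. \<bar>f x\<bar>\<^sup>2 \<partial>M) - (\<integral>x. \<bar>f x\<bar> \<partial>M)\<^sup>2"
      using i assms(3) by (intro variance_eq) auto
    finally show ?thesis by simp
  qed
  thus ?thesis by (intro real_le_rsqrt) simp
qed

lemma norm_cis_diff_le: "norm (iexp a - iexp b) \<le> \<bar>a - b\<bar>"
proof -
  have "iexp a - iexp b = iexp b * (iexp (a - b) - 1)"
    by (simp add: algebra_simps flip: exp_add)
  hence "norm (iexp a - iexp b) = norm (iexp (a - b) - 1)"
    by (simp only: norm_mult norm_exp_i_times mult_1)
  also have "\<dots> \<le> \<bar>a - b\<bar>" using iexp_approx1[of "a - b" 0] by simp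
  finally show ?thesis .
qed

context sequence_space
begin

lemma integral_comb_seq:
  fixes F :: "(nat \<Rightarrow> 'a) \<Rightarrow> 'b::{banach, second_countable_topology}"
  assumes [measurable]: "F \<in> borel_measurable S"
  shows "integral\<^sup>L S F = integral\<^sup>L (S \<Otimes>\<^sub>M S) (\<lambda>(x, y). F (comb_seq k x y))"
    and "integrable S F \<longleftrightarrow> integrable (S \<Otimes>\<^sub>M S) (\<lambda>(x, y). F (comb_seq k x y))"
  by (subst PiM_comb_seq[of k, symmetric];
      simp add: integral_distr integrable_distr_eq split_beta')+

text \<open>Splicing two independent sequences at \<open>k\<close> preserves the law. After
  splicing, \<open>F\<close> sees only the first sequence and \<open>G\<close> only the second, so
  Fubini factors the integral. A general field covers both real moments and complex
  exponentials.\<close>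

lemma
  fixes F G :: "(nat \<Rightarrow> 'a) \<Rightarrow> 'b::{real_normed_field, banach, second_countable_topology}"
  assumes F: "integrable S F" "depends_on {..<k} F"
    and G: "integrable S G" "depends_on {k..} G"
  shows integral_mult_depends: "(\<integral>x. F x * G x \<partial>S) = (\<integral>x. F x \<partial>S) * (\<integral>x. G x \<partial>S)"
    and integrable_mult_depends: "integrable S (\<lambda>x. F x * G x)"
proof -
  interpret SS: pair_prob_space S S ..
  have [measurable]: "F \<in> borel_measurable S" "G \<in> borel_measurable S"
    using F G by auto
  \<comment> \<open>The first \<open>k\<close> entries do not influence \<open>G\<close>, so
    \<open>y\<close> itself may fill them.\<close>
  define G' where "G' y = G (comb_seq k y y)" for y
  have [measurable]: "G' \<in> borel_measurable S" unfolding G'_def by measurable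
  have F': "F (comb_seq k x y) = F x" for x y
    by (rule depends_onD[OF F(2)]) (simp add: comb_seq_def)
  have G'': "G (comb_seq k x y) = G' y" for x y
    unfolding G'_def by (rule depends_onD[OF G(2)]) (simp add: comb_seq_def)
  have iG: "integrable (S \<Otimes>\<^sub>M S) (\<lambda>(x, y). G' y)"
    using G(1) integral_comb_seq(2)[of G k] by (simp add: G'' split_beta')
  have iG': "integrable S G'"
  proof -
    have "AE x in S. integrable S G'" using SS.AE_integrable_fst'[OF iG] by simp
    thus ?thesis by (simp add: P.AE_const)
  qed
  have intFG: "integrable (S \<Otimes>\<^sub>M S) (\<lambda>(x, y). F x * G' y)"
    by (intro SS.Fubini_integrable) (auto simp: norm_mult F iG')
  have eqG: "(\<integral>x. G x \<partial>S) = (\<integral>y. G' y \<partial>S)"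
  proof -
    have "(\<integral>x. G x \<partial>S) = (\<integral>p. (\<lambda>(x,y). G' y) p \<partial>(S \<Otimes>\<^sub>M S))"
      using integral_comb_seq(1)[of G k] by (simp add: G'')
    also have "\<dots> = (\<integral>x. (\<integral>y. G' y \<partial>S) \<partial>S)"
      using SS.integral_fst'[OF iG] by (simp add: split_beta')
    finally show ?thesis by (simp add: P.prob_space)
  qed
  show "integrable S (\<lambda>x. F x * G x)"
    using integral_comb_seq(2)[of "\<lambda>x. F x * G x" k] intFG by (simp add: F' G'')
  have "(\<integral>x. F x * G x \<partial>S) = (\<integral>p. (\<lambda>(x,y). F x * G' y) p \<partial>(S \<Otimes>\<^sub>M S))"
    using integral_comb_seq(1)[of "\<lambda>x. F x * G x" k] by (simp add: F' G'')
  also have "\<dots> = (\<integral>x. (\<integral>y. F x * G' y \<partial>S) \<partial>S)"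
    using SS.integral_fst'[OF intFG] by (simp add: split_beta')
  also have "\<dots> = (\<integral>x. F x \<partial>S) * (\<integral>x. G x \<partial>S)"
    by (simp add: eqG)
  finally show "(\<integral>x. F x * G x \<partial>S) = (\<integral>x. F x \<partial>S) * (\<integral>x. G x \<partial>S)" .
qed

end

section \<open>A tail bound for second moments by first passage\<close>

context sequence_space
begin

lemma integrable_mult_square:
  fixes f g :: "(nat \<Rightarrow> 'a) \<Rightarrow> real"
  assumes "f \<in> borel_measurable S" "g \<in> borel_measurable S"
    and "integrable S (\<lambda>x. (f x)\<^sup>2)" "integrable S (\<lambda>x. (g x)\<^sup>2)"
  shows "integrable S (\<lambda>x. f x * g x)"
proof (rule Bochner_Integration.integrable_bound)
  show "integrable S (\<lambda>x. (f x)\<^sup>2 + (g x)\<^sup>2)" using assms by simp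
  have "\<bar>f x * g x\<bar> \<le> (f x)\<^sup>2 + (g x)\<^sup>2" for x
  proof -
    have "2 * (\<bar>f x\<bar> * \<bar>g x\<bar>) \<le> (f x)\<^sup>2 + (g x)\<^sup>2"
      using sum_squares_bound[of "\<bar>f x\<bar>" "\<bar>g x\<bar>"] by simp
    moreover have "0 \<le> \<bar>f x\<bar> * \<bar>g x\<bar>" by simp
    ultimately show ?thesis by (simp only: abs_mult)
  qed
  thus "AE x in S. norm (f x * g x) \<le> norm ((f x)\<^sup>2 + (g x)\<^sup>2)" by auto
qed (use assms in measurable)

lemma integrable_sum_square:
  fixes f :: "'i \<Rightarrow> (nat \<Rightarrow> 'a) \<Rightarrow> real"
  assumes "\<And>i. i \<in> I \<Longrightarrow> f i \<in> borel_measurable S"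
    and "\<And>i. i \<in> I \<Longrightarrow> integrable S (\<lambda>x. (f i x)\<^sup>2)"
  shows "integrable S (\<lambda>x. (\<Sum>i\<in>I. f i x)\<^sup>2)"
  unfolding power2_eq_square sum_product
  by (intro Bochner_Integration.integrable_sum integrable_mult_square assms)

lemma integrable_add_square:
  fixes f g :: "(nat \<Rightarrow> 'a) \<Rightarrow> real"
  assumes "f \<in> borel_measurable S" "g \<in> borel_measurable S"
    and "integrable S (\<lambda>x. (f x)\<^sup>2)" "integrable S (\<lambda>x. (g x)\<^sup>2)"
  shows "integrable S (\<lambda>x. (f x + g x)\<^sup>2)"
  using assms integrable_mult_square[OF assms] by (simp add: power2_sum mult.assoc)

text \<open>An argument of Ottaviani type. At the first \<open>j\<close> with
  \<open>|T j| > t\<close> the term \<open>\<zeta> j\<close> is skipped, and the sum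
  \<open>R j\<close> after it is independent of the passage event. A final sum beyond
  \<open>2 * t\<close> forces \<open>R j\<close> to be of comparable size, so the tail second moment
  is at most a constant times \<open>V\<close> times the passage probability, which is itself of
  order \<open>V / t^2\<close>. The gain over the trivial bound \<open>V\<close> is what yields a
  Lindeberg condition for long blocks.\<close>

lemma first_passage_tail:
  fixes \<zeta> :: "nat \<Rightarrow> (nat \<Rightarrow> 'a) \<Rightarrow> real"
  assumes meas [measurable]: "\<And>i. \<zeta> i \<in> borel_measurable S"
    and bound: "\<And>i x. \<bar>\<zeta> i x\<bar> \<le> \<epsilon>"
    and dep: "\<And>i. depends_on {(q + i) * m..<(q + i + 2) * m} (\<zeta> i)"
    and V: "\<And>a b. a \<le> b \<Longrightarrow> b \<le> p \<Longrightarrow> (\<integral>x. (\<Sum>i=a..<b. \<zeta> i x)\<^sup>2 \<partial>S) \<le> V"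
    and t: "t > 0" "8 * \<epsilon> \<le> t" "32 * V \<le> t\<^sup>2"
  shows "(\<integral>x. (\<Sum>i<p. \<zeta> i x)\<^sup>2 * (if \<bar>\<Sum>i<p. \<zeta> i x\<bar> > 2 * t then 1 else 0) \<partial>S) \<le> 72 * V\<^sup>2 / t\<^sup>2"
proof -
  have \<epsilon>0: "\<epsilon> \<ge> 0" using bound[of 0 undefined] by linarith
  define T where "T j x = (\<Sum>i<j. \<zeta> i x)" for j x
  define R where "R j x = (\<Sum>i=Suc j..<p. \<zeta> i x)" for j x
  define I :: "nat \<Rightarrow> (nat \<Rightarrow> 'a) \<Rightarrow> real"
    where "I j x = (if \<bar>T j x\<bar> > t \<and> (\<forall>i<j. \<bar>T i x\<bar> \<le> t) then 1 else 0)" for j x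
  have [measurable]: "T j \<in> borel_measurable S" "R j \<in> borel_measurable S" for j
    unfolding T_def R_def by measurable
  have [measurable]: "I j \<in> borel_measurable S" for j
    unfolding I_def by measurable
  have T_bound: "\<bar>T j x\<bar> \<le> j * \<epsilon>" for j x
    unfolding T_def using sum_abs[of "\<lambda>i. \<zeta> i x" "{..<j}"] sum_bounded_above[of "{..<j}" "\<lambda>i. \<bar>\<zeta> i x\<bar>" \<epsilon>] bound
    by (auto intro: order_trans)
  have R_bound: "\<bar>R j x\<bar> \<le> p * \<epsilon>" for j x
  proof -
    have "\<bar>R j x\<bar> \<le> (\<Sum>i=Suc j..<p. \<epsilon>)"
      unfolding R_def by (rule order_trans[OF sum_abs]) (intro sum_mono bound)
    also have "\<dots> = (p - Suc j) * \<epsilon>" by simp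
    also have "\<dots> \<le> p * \<epsilon>" using \<epsilon>0 by (intro mult_right_mono) auto
    finally show ?thesis .
  qed
  have split: "T p x = T j x + \<zeta> j x + R j x" if "j < p" for j x
  proof -
    have "T p x = (\<Sum>i<Suc j. \<zeta> i x) + R j x"
      unfolding T_def R_def lessThan_atLeast0
      using that by (intro sum.atLeastLessThan_concat[symmetric]) auto
    thus ?thesis by (simp add: T_def)
  qed
  have I_iff: "I j x = 1 \<longleftrightarrow> \<bar>T j x\<bar> > t \<and> (\<forall>i<j. \<bar>T i x\<bar> \<le> t)" "I j x = 0 \<or> I j x = 1" for j x
    by (auto simp: I_def)
  have I01: "0 \<le> I j x" "I j x \<le> 1" for j x by (auto simp: I_def)
  have one: "(\<exists>j\<le>p. \<forall>i. I i x = (if i = j then 1 else 0)) \<or> (\<forall>i\<le>p. I i x = 0 \<and> \<bar>T i x\<bar> \<le> t)" for x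
  proof (cases "\<exists>j\<le>p. \<bar>T j x\<bar> > t")
    case True
    define j where "j = (LEAST j. \<bar>T j x\<bar> > t)"
    have 1: "\<bar>T j x\<bar> > t" unfolding j_def by (rule LeastI_ex) (use True in blast)
    have 2: "\<bar>T i x\<bar> \<le> t" if "i < j" for i using not_less_Least[OF that[unfolded j_def]] by simp
    have "j \<le> p" using True unfolding j_def by (meson Least_le order_trans)
    moreover have "I i x = (if i = j then 1 else 0)" for i
      unfolding I_def using 1 2 by (metis linorder_neqE_nat not_less)
    ultimately show ?thesis by blast
  next
    case False
    thus ?thesis by (auto simp: I_def not_less)
  qed
  have key: "I j x = 1 \<Longrightarrow> j \<le> p \<Longrightarrow> \<bar>T j x\<bar> \<le> t + \<epsilon>" for j x
  proof -
    assume I: "I j x = 1" and "j \<le> p"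
    have "j \<noteq> 0"
    proof
      assume "j = 0"
      thus False using I t(1) by (simp add: I_iff T_def)
    qed
    then obtain j' where j': "j = Suc j'" by (cases j) auto
    have "T j x = T j' x + \<zeta> j' x" by (simp add: T_def j')
    moreover have "\<bar>T j' x\<bar> \<le> t" using I by (simp add: I_iff j')
    ultimately show "\<bar>T j x\<bar> \<le> t + \<epsilon>" using bound[of j' x] by linarith
  qed
  have int_bdd: "integrable S f" if "f \<in> borel_measurable S" "\<And>x. \<bar>f x\<bar> \<le> B" for f :: "(nat \<Rightarrow> 'a) \<Rightarrow> real" and B
    using that by (intro P.integrable_const_bound[of _ B]) auto
  have intR: "integrable S (\<lambda>x. (R j x)\<^sup>2)" for j
  proof (rule int_bdd[of _ "(p * \<epsilon>)\<^sup>2"])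
    show "\<bar>(R j x)\<^sup>2\<bar> \<le> (p * \<epsilon>)\<^sup>2" for x using power_mono[OF R_bound[of j x], of 2] by simp
  qed simp
  have intT: "integrable S (\<lambda>x. (T j x)\<^sup>2)" for j
  proof (rule int_bdd[of _ "(j * \<epsilon>)\<^sup>2"])
    show "\<bar>(T j x)\<^sup>2\<bar> \<le> (j * \<epsilon>)\<^sup>2" for x using power_mono[OF T_bound[of j x], of 2] by simp
  qed simp
  have intI: "integrable S (I j)" for j
    by (rule int_bdd[of _ 1]) (use I01 in auto)
  have depI: "depends_on {..<(q + Suc j) * m} (I j)" for j
  proof -
    have "depends_on {..<(q + Suc j) * m} (T i)" if "i \<le> j" for i
    proof -
      have "T i = (\<lambda>x. \<Sum>l<i. \<zeta> l x)" by (simp add: T_def fun_eq_iff)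
      moreover have "depends_on {..<(q + Suc j) * m} (\<lambda>x. \<Sum>l<i. \<zeta> l x)"
      proof (rule depends_on_sum)
        fix l assume "l \<in> {..<i}"
        hence "(q + l + 2) * m \<le> (q + Suc j) * m" using that by (intro mult_right_mono) auto
        thus "depends_on {..<(q + Suc j) * m} (\<zeta> l)"
          by (intro depends_on_mono[OF dep[of l]]) auto
      qed
      ultimately show ?thesis by simp
    qed
    note depT = this
    show ?thesis
    proof (rule depends_onI)
      fix x y :: "nat \<Rightarrow> 'a" assume xy: "\<And>l. l \<in> {..<(q + Suc j) * m} \<Longrightarrow> x l = y l"
      have eq: "T i x = T i y" if "i \<le> j" for i by (rule depends_onD[OF depT[OF that] xy])
      have "(\<forall>i<j. \<bar>T i x\<bar> \<le> t) \<longleftrightarrow> (\<forall>i<j. \<bar>T i y\<bar> \<le> t)" by (simp add: eq)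
      thus "I j x = I j y" unfolding I_def by (simp only: eq order_refl)
    qed
  qed
  have depR: "depends_on {(q + Suc j) * m..} (\<lambda>x. (R j x)\<^sup>2)" for j
  proof (rule depends_on_comp[where g = "\<lambda>z. z\<^sup>2"])
    have "R j = (\<lambda>x. \<Sum>l=Suc j..<p. \<zeta> l x)" by (simp add: R_def fun_eq_iff)
    moreover have "depends_on {(q + Suc j) * m..} (\<lambda>x. \<Sum>l=Suc j..<p. \<zeta> l x)"
    proof (rule depends_on_sum)
      fix l assume "l \<in> {Suc j..<p}"
      hence "(q + Suc j) * m \<le> (q + l) * m" by (intro mult_right_mono) auto
      thus "depends_on {(q + Suc j) * m..} (\<zeta> l)"
        by (intro depends_on_mono[OF dep[of l]]) auto
    qed
    ultimately show "depends_on {(q + Suc j) * m..} (R j)" by simp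
  qed
  have ER: "(\<integral>x. (R j x)\<^sup>2 \<partial>S) \<le> V" "0 \<le> (\<integral>x. (R j x)\<^sup>2 \<partial>S)" for j
  proof -
    show "(\<integral>x. (R j x)\<^sup>2 \<partial>S) \<le> V"
    proof (cases "Suc j \<le> p")
      case True
      thus ?thesis unfolding R_def by (intro V) auto
    next
      case False
      thus ?thesis unfolding R_def using V[of 0 0] by simp
    qed
  qed simp
  have V0: "V \<ge> 0" using ER by (meson order_trans)
  have EIR: "(\<integral>x. I j x * (R j x)\<^sup>2 \<partial>S) = (\<integral>x. I j x \<partial>S) * (\<integral>x. (R j x)\<^sup>2 \<partial>S)"
    and intIR: "integrable S (\<lambda>x. I j x * (R j x)\<^sup>2)" for j
    using integral_mult_depends[OF intI depI intR depR] integrable_mult_depends[OF intI depI intR depR]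
    by auto
  have EI0: "0 \<le> (\<integral>x. I j x \<partial>S)" for j using I01 by (intro integral_nonneg_AE) auto
  define Q where "Q = (\<Sum>j<p. \<integral>x. I j x \<partial>S)"
  \<comment> \<open>At passage \<open>|T j|\<close> is at most \<open>t + \<epsilon>\<close>, and
    \<open>\<epsilon>\<close> is at most \<open>t / 8\<close>. If \<open>|T p| > 2 * t\<close>, then
    \<open>T j + \<zeta> j\<close> accounts for at most 5/8 of \<open>|T p|\<close>, so
    \<open>|T p| <= 3 * |R j|\<close>; the constant 9 is the square of this 3.\<close>
  have tail: "(T p x)\<^sup>2 * (if \<bar>T p x\<bar> > 2 * t then 1 else 0) \<le> (\<Sum>j<p. 9 * (I j x * (R j x)\<^sup>2))" for x
  proof (cases "\<bar>T p x\<bar> > 2 * t")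
    case True
    then obtain j where j: "j \<le> p" "\<And>i. I i x = (if i = j then 1 else 0)"
      using one[of x] t(1) by force
    have Tj: "\<bar>T j x\<bar> \<le> t + \<epsilon>" using key[of j x] j by simp
    have "j \<noteq> p" using Tj True t(1,2) \<epsilon>0 by auto
    hence jp: "j < p" using j(1) by simp
    have "\<bar>T p x\<bar> \<le> 3 * \<bar>R j x\<bar>"
      using split[OF jp, of x] Tj bound[of j x] True t(1,2) \<epsilon>0 by linarith
    hence "(T p x)\<^sup>2 \<le> (3 * \<bar>R j x\<bar>)\<^sup>2" by (metis abs_ge_zero power2_abs power_mono)
    also have "\<dots> = (\<Sum>j<p. 9 * (I j x * (R j x)\<^sup>2))"
      using jp by (simp add: j(2) if_distrib if_distribR sum.delta cong: if_cong)
    finally show ?thesis using True by simp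
  qed (auto intro!: sum_nonneg simp: I01)
  \<comment> \<open>After passage either \<open>|R j| < t / 4\<close>, and then the final sum is
    still at least \<open>t / 2\<close> in absolute value, or the square of \<open>R j\<close>
    cancels the indicator. In expectation, \<open>32 * V <= t^2\<close> lets the subtracted term
    absorb at most half of the passage probability.\<close>
  have pass: "(\<Sum>j<p. I j x - 16 / t\<^sup>2 * (I j x * (R j x)\<^sup>2)) \<le> 4 / t\<^sup>2 * (T p x)\<^sup>2" for x
    using one[of x]
  proof
    assume "\<exists>j\<le>p. \<forall>i. I i x = (if i = j then 1 else 0)"
    then obtain j where j: "j \<le> p" "\<And>i. I i x = (if i = j then 1 else 0)" by blast
    show ?thesis
    proof (cases "j < p")
      case True
      have "(\<Sum>j<p. I j x - 16 / t\<^sup>2 * (I j x * (R j x)\<^sup>2)) = (\<Sum>i<p. if i = j then 1 - 16 / t\<^sup>2 * (R j x)\<^sup>2 else 0)"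
        by (intro sum.cong) (auto simp: j(2))
      also have "\<dots> = 1 - 16 / t\<^sup>2 * (R j x)\<^sup>2" using True by simp
      also have "\<dots> \<le> 4 / t\<^sup>2 * (T p x)\<^sup>2"
      proof (cases "4 * \<bar>R j x\<bar> < t")
        case R: True
        have "\<bar>T j x\<bar> > t" using j(2)[of j] by (auto simp: I_def split: if_splits)
        hence "\<bar>T p x\<bar> \<ge> t / 2" using split[OF True, of x] R bound[of j x] t(1,2) \<epsilon>0 by linarith
        hence "(t / 2)\<^sup>2 \<le> (T p x)\<^sup>2" using t(1) by (metis abs_ge_zero half_gt_zero_iff less_eq_real_def power2_abs power_mono)
        hence "1 \<le> 4 / t\<^sup>2 * (T p x)\<^sup>2" using t(1) by (simp add: field_simps power2_eq_square)
        moreover have "0 \<le> 16 / t\<^sup>2 * (R j x)\<^sup>2" by simp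
        ultimately show ?thesis by linarith
      next
        case False
        hence "t\<^sup>2 \<le> (4 * \<bar>R j x\<bar>)\<^sup>2" using t(1) by (intro power_mono) auto
        hence "1 \<le> 16 / t\<^sup>2 * (R j x)\<^sup>2" using t(1) by (simp add: field_simps power2_eq_square)
        moreover have "0 \<le> 4 / t\<^sup>2 * (T p x)\<^sup>2" by simp
        ultimately show ?thesis by linarith
      qed
      finally show ?thesis .
    qed (use j in auto)
  qed auto
  have "(\<integral>x. (\<Sum>j<p. I j x - 16 / t\<^sup>2 * (I j x * (R j x)\<^sup>2)) \<partial>S) \<le> (\<integral>x. 4 / t\<^sup>2 * (T p x)\<^sup>2 \<partial>S)"
    by (intro integral_mono pass Bochner_Integration.integrable_sum Bochner_Integration.integrable_diff
        integrable_mult_right intI intIR intT)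
  also have "\<dots> = 4 / t\<^sup>2 * (\<integral>x. (T p x)\<^sup>2 \<partial>S)" by simp
  also have "\<dots> \<le> 4 / t\<^sup>2 * V" using V[of 0 p] by (intro mult_left_mono) (auto simp: T_def lessThan_atLeast0)
  finally have le1: "(\<Sum>j<p. (\<integral>x. I j x \<partial>S) - 16 / t\<^sup>2 * ((\<integral>x. I j x \<partial>S) * (\<integral>x. (R j x)\<^sup>2 \<partial>S))) \<le> 4 / t\<^sup>2 * V"
    by (simp add: intI intIR EIR Bochner_Integration.integral_sum)
  have "Q / 2 = (\<Sum>j<p. (\<integral>x. I j x \<partial>S) / 2)" by (simp add: Q_def sum_divide_distrib)
  also have "\<dots> \<le> (\<Sum>j<p. (\<integral>x. I j x \<partial>S) - 16 / t\<^sup>2 * ((\<integral>x. I j x \<partial>S) * (\<integral>x. (R j x)\<^sup>2 \<partial>S)))"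
  proof (rule sum_mono)
    fix j
    have "16 / t\<^sup>2 * (\<integral>x. (R j x)\<^sup>2 \<partial>S) \<le> 16 / t\<^sup>2 * V" using ER by (intro mult_left_mono) auto
    also have "\<dots> \<le> 1 / 2" using t by (simp add: field_simps)
    finally have "(\<integral>x. I j x \<partial>S) * (16 / t\<^sup>2 * (\<integral>x. (R j x)\<^sup>2 \<partial>S)) \<le> (\<integral>x. I j x \<partial>S) * (1 / 2)"
      using EI0 by (intro mult_left_mono) auto
    thus "(\<integral>x. I j x \<partial>S) / 2 \<le> (\<integral>x. I j x \<partial>S) - 16 / t\<^sup>2 * ((\<integral>x. I j x \<partial>S) * (\<integral>x. (R j x)\<^sup>2 \<partial>S))"
      by (simp add: mult_ac)
  qed
  finally have Q: "Q \<le> 8 / t\<^sup>2 * V" using le1 by simp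
  have "(\<integral>x. (T p x)\<^sup>2 * (if \<bar>T p x\<bar> > 2 * t then 1 else 0) \<partial>S) \<le> (\<integral>x. (\<Sum>j<p. 9 * (I j x * (R j x)\<^sup>2)) \<partial>S)"
    by (rule integral_mono[OF _ _ tail], rule Bochner_Integration.integrable_bound[OF intT[of p]])
       (auto intro!: intIR)
  also have "\<dots> = (\<Sum>j<p. 9 * ((\<integral>x. I j x \<partial>S) * (\<integral>x. (R j x)\<^sup>2 \<partial>S)))"
    by (simp add: intIR EIR Bochner_Integration.integral_sum)
  also have "\<dots> \<le> (\<Sum>j<p. 9 * ((\<integral>x. I j x \<partial>S) * V))"
    by (intro sum_mono mult_left_mono ER EI0) auto
  also have "\<dots> = 9 * V * Q" by (simp add: Q_def sum_distrib_left mult_ac)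
  also have "\<dots> \<le> 9 * V * (8 / t\<^sup>2 * V)" using Q V0 by (intro mult_left_mono) auto
  also have "\<dots> = 72 * V\<^sup>2 / t\<^sup>2" by (simp add: power2_eq_square)
  finally show ?thesis by (simp add: T_def)
qed

end


section \<open>One-dependent sequences: variances and tails of blocks\<close>

text \<open>\<open>\<eta> i\<close> reads the i-th stretch of \<open>m\<close> coordinates and the
  next one, so terms whose indices differ by at least 2 are independent.\<close>

locale one_dependent = sequence_space M for M :: "'a measure" +
  fixes m :: nat and \<eta> :: "nat \<Rightarrow> (nat \<Rightarrow> 'a) \<Rightarrow> real"
  assumes \<eta>_measurable [measurable]: "\<And>i. \<eta> i \<in> borel_measurable S"
    and \<eta>_depends: "\<And>i. depends_on {i * m..<(i + 2) * m} (\<eta> i)"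
    and \<eta>_square: "\<And>i. integrable S (\<lambda>x. (\<eta> i x)\<^sup>2)"
    and \<eta>_mean: "\<And>i. (\<integral>x. \<eta> i x \<partial>S) = 0"
begin

lemma \<eta>_integrable: "integrable S (\<eta> i)"
  using P.square_integrable_imp_integrable[OF _ \<eta>_square] by simp

lemma \<eta>_sum_depends: "depends_on {a * m..<Suc b * m} (\<lambda>x. \<Sum>i=a..<b. \<eta> i x)"
proof (rule depends_on_sum)
  fix i assume "i \<in> {a..<b}"
  hence "a * m \<le> i * m" "(i + 2) * m \<le> Suc b * m" by (intro mult_le_mono1; simp)+
  thus "depends_on {a * m..<Suc b * m} (\<eta> i)"
    by (intro depends_on_mono[OF \<eta>_depends[of i]]) auto
qed

lemma \<eta>_sum_square: "integrable S (\<lambda>x. (\<Sum>i=a..<b. \<eta> i x)\<^sup>2)"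
  by (intro integrable_sum_square \<eta>_square) auto

text \<open>The new term is independent of all but its immediate predecessor. The case distinction
  covers the empty sum, which has no predecessor.\<close>

lemma variance_step:
  assumes "a \<le> b"
  shows "(\<integral>x. (\<Sum>i=a..<Suc b. \<eta> i x)\<^sup>2 \<partial>S) =
    (\<integral>x. (\<Sum>i=a..<b. \<eta> i x)\<^sup>2 \<partial>S)
    + 2 * (if a < b then \<integral>x. \<eta> (b - 1) x * \<eta> b x \<partial>S else 0) + (\<integral>x. (\<eta> b x)\<^sup>2 \<partial>S)"
proof -
  let ?T = "\<lambda>x. \<Sum>i=a..<b. \<eta> i x"
  have i1: "integrable S (\<lambda>x. ?T x * \<eta> b x)"
    by (intro integrable_mult_square \<eta>_sum_square \<eta>_square) measurable
  have cross: "(\<integral>x. ?T x * \<eta> b x \<partial>S) = (if a < b then \<integral>x. \<eta> (b - 1) x * \<eta> b x \<partial>S else 0)"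
  proof (cases "a < b")
    case True
    then obtain c where c: "b = Suc c" "a \<le> c" by (cases b) auto
    have 0: "(\<integral>x. (\<Sum>i=a..<c. \<eta> i x) * \<eta> b x \<partial>S) = (\<integral>x. (\<Sum>i=a..<c. \<eta> i x) \<partial>S) * (\<integral>x. \<eta> b x \<partial>S)"
    proof (rule integral_mult_depends)
      show "depends_on {..<b * m} (\<lambda>x. \<Sum>i=a..<c. \<eta> i x)"
        by (rule depends_on_mono[OF \<eta>_sum_depends]) (auto simp: c)
      show "depends_on {b * m..} (\<eta> b)" by (rule depends_on_mono[OF \<eta>_depends]) auto
    qed (auto intro: \<eta>_integrable)
    have "(\<integral>x. ?T x * \<eta> b x \<partial>S) = (\<integral>x. (\<Sum>i=a..<c. \<eta> i x) * \<eta> b x + \<eta> c x * \<eta> b x \<partial>S)"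
      using c by (simp add: algebra_simps)
    also have "\<dots> = (\<integral>x. (\<Sum>i=a..<c. \<eta> i x) * \<eta> b x \<partial>S) + (\<integral>x. \<eta> c x * \<eta> b x \<partial>S)"
      by (intro Bochner_Integration.integral_add integrable_mult_square \<eta>_sum_square \<eta>_square) measurable
    finally show ?thesis using 0 True c by (simp add: \<eta>_mean)
  qed simp
  have "(\<integral>x. (\<Sum>i=a..<Suc b. \<eta> i x)\<^sup>2 \<partial>S) = (\<integral>x. (?T x)\<^sup>2 + 2 * (?T x * \<eta> b x) + (\<eta> b x)\<^sup>2 \<partial>S)"
    using assms by (intro Bochner_Integration.integral_cong) (auto simp: power2_sum)
  also have "\<dots> = (\<integral>x. (?T x)\<^sup>2 \<partial>S) + 2 * (\<integral>x. ?T x * \<eta> b x \<partial>S) + (\<integral>x. (\<eta> b x)\<^sup>2 \<partial>S)"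
    using i1 \<eta>_sum_square \<eta>_square by simp
  finally show ?thesis by (simp add: cross)
qed

lemma abs_integral_mult_le:
  assumes "\<And>i. (\<integral>x. (\<eta> i x)\<^sup>2 \<partial>S) \<le> c"
  shows "\<bar>\<integral>x. \<eta> i x * \<eta> j x \<partial>S\<bar> \<le> c"
proof -
  have "\<bar>\<integral>x. \<eta> i x * \<eta> j x \<partial>S\<bar> \<le> (\<integral>x. \<bar>\<eta> i x * \<eta> j x\<bar> \<partial>S)" by simp
  also have "\<dots> \<le> (\<integral>x. ((\<eta> i x)\<^sup>2 + (\<eta> j x)\<^sup>2) / 2 \<partial>S)"
  proof (intro integral_mono)
    show "\<bar>\<eta> i x * \<eta> j x\<bar> \<le> ((\<eta> i x)\<^sup>2 + (\<eta> j x)\<^sup>2) / 2" for x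
      using sum_squares_bound[of "\<bar>\<eta> i x\<bar>" "\<bar>\<eta> j x\<bar>"] by (simp add: abs_mult)
  qed (auto intro!: integrable_mult_square \<eta>_square integrable_abs)
  also have "\<dots> = ((\<integral>x. (\<eta> i x)\<^sup>2 \<partial>S) + (\<integral>x. (\<eta> j x)\<^sup>2 \<partial>S)) / 2"
    by (simp add: \<eta>_square)
  also have "\<dots> \<le> c" using assms[of i] assms[of j] by simp
  finally show ?thesis .
qed

lemma variance_sum_le:
  assumes c: "\<And>i. (\<integral>x. (\<eta> i x)\<^sup>2 \<partial>S) \<le> c" and "a \<le> b"
  shows "(\<integral>x. (\<Sum>i=a..<b. \<eta> i x)\<^sup>2 \<partial>S) \<le> 3 * real (b - a) * c"
  using \<open>a \<le> b\<close>
proof (induction b rule: dec_induct)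
  case base
  show ?case by simp
next
  case (step b)
  have "0 \<le> c" by (rule order_trans[OF _ c[of 0]]) simp
  hence "2 * (if a < b then \<integral>x. \<eta> (b - 1) x * \<eta> b x \<partial>S else 0) \<le> 2 * c"
    using abs_integral_mult_le[OF c, of "b - 1" b] by auto
  moreover have "real (Suc b - a) = real (b - a) + 1" using step(1) by simp
  ultimately show ?case
    using variance_step[OF step(1)] step(3) c[of b] by (simp only: algebra_simps)
qed

text \<open>Each term brings its variance and twice the covariance with its successor; the last one
  has no successor inside the sum, hence the correction by
  \<open>2 * \<gamma>\<^sub>1\<close>.\<close>

lemma variance_sum_eq:
  assumes "\<And>i. (\<integral>x. (\<eta> i x)\<^sup>2 \<partial>S) = \<gamma>\<^sub>0" "\<And>i. (\<integral>x. \<eta> i x * \<eta> (Suc i) x \<partial>S) = \<gamma>\<^sub>1" "a < b"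
  shows "(\<integral>x. (\<Sum>i=a..<b. \<eta> i x)\<^sup>2 \<partial>S) = real (b - a) * (\<gamma>\<^sub>0 + 2 * \<gamma>\<^sub>1) - 2 * \<gamma>\<^sub>1"
proof -
  have "Suc a \<le> b" using assms by simp
  thus ?thesis
  proof (induction b rule: dec_induct)
    case base
    show ?case by (simp add: assms)
  next
    case (step k)
    have "real (Suc k - a) = real (k - a) + 1" using step(1) by simp
    moreover have "Suc (k - 1) = k" "a \<le> k" "a < k" using step(1) by auto
    ultimately show ?case
      using variance_step[of a k] step(3) assms(2)[of "k - 1"]
      by (simp only: assms(1) if_True algebra_simps)
  qed
qed

text \<open>Carries Lindeberg control from single terms to blocks of \<open>p\<close> terms. The
  truncated and recentred part is bounded, so \<open>first_passage_tail\<close> applies to it; the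
  discarded part is again one-dependent, with variance at most \<open>lam\<close> per term.\<close>

lemma block_tail:
  assumes tail: "\<And>i. (\<integral>x. (\<eta> i x)\<^sup>2 * (if \<bar>\<eta> i x\<bar> > \<epsilon> then 1 else 0) \<partial>S) \<le> lam"
    and V: "\<And>a b. a \<le> b \<Longrightarrow> b \<le> a + p \<Longrightarrow> (\<integral>x. (\<Sum>i=a..<b. \<eta> i x)\<^sup>2 \<partial>S) \<le> V"
    and t: "0 \<le> \<epsilon>" "t > 0" "16 * \<epsilon> \<le> t" "32 * (2 * V + 6 * p * lam) \<le> t\<^sup>2"
  shows "(\<integral>x. (\<Sum>i=q..<q+p. \<eta> i x)\<^sup>2 * (if \<bar>\<Sum>i=q..<q+p. \<eta> i x\<bar> > 4 * t then 1 else 0) \<partial>S)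
    \<le> 288 * (2 * V + 6 * p * lam)\<^sup>2 / t\<^sup>2 + 12 * p * lam"
proof -
  define \<mu> where "\<mu> i = (\<integral>x. \<eta> i x * (if \<bar>\<eta> i x\<bar> \<le> \<epsilon> then 1 else 0) \<partial>S)" for i
  define u where "u i x = \<eta> i x * (if \<bar>\<eta> i x\<bar> \<le> \<epsilon> then 1 else 0) - \<mu> i" for i x
  define w where "w i x = \<eta> i x * (if \<bar>\<eta> i x\<bar> > \<epsilon> then 1 else 0) + \<mu> i" for i x
  have [measurable]: "u i \<in> borel_measurable S" "w i \<in> borel_measurable S" for i
    unfolding u_def w_def by measurable
  have uw: "\<eta> i x = u i x + w i x" for i x by (simp add: u_def w_def)
  have int1: "integrable S (\<lambda>x. \<eta> i x * (if \<bar>\<eta> i x\<bar> \<le> \<epsilon> then 1 else 0))"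
    "integrable S (\<lambda>x. \<eta> i x * (if \<bar>\<eta> i x\<bar> > \<epsilon> then 1 else 0))"
    "integrable S (\<lambda>x. (\<eta> i x)\<^sup>2 * (if \<bar>\<eta> i x\<bar> > \<epsilon> then 1 else 0))" for i
  proof -
    show "integrable S (\<lambda>x. \<eta> i x * (if \<bar>\<eta> i x\<bar> \<le> \<epsilon> then 1 else 0))"
      by (rule Bochner_Integration.integrable_bound[OF \<eta>_integrable[of i]]) auto
    show "integrable S (\<lambda>x. \<eta> i x * (if \<bar>\<eta> i x\<bar> > \<epsilon> then 1 else 0))"
      by (rule Bochner_Integration.integrable_bound[OF \<eta>_integrable[of i]]) auto
    show "integrable S (\<lambda>x. (\<eta> i x)\<^sup>2 * (if \<bar>\<eta> i x\<bar> > \<epsilon> then 1 else 0))"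
      by (rule Bochner_Integration.integrable_bound[OF \<eta>_square[of i]]) auto
  qed
  have \<mu>_le: "\<bar>\<mu> i\<bar> \<le> \<epsilon>" for i
  proof -
    have "\<bar>\<mu> i\<bar> \<le> (\<integral>x. \<bar>\<eta> i x * (if \<bar>\<eta> i x\<bar> \<le> \<epsilon> then 1 else 0)\<bar> \<partial>S)" unfolding \<mu>_def by simp
    also have "\<dots> \<le> (\<integral>x. \<epsilon> \<partial>S)"
      by (intro integral_mono integrable_abs int1) (use t in auto)
    finally show ?thesis by (simp add: P.prob_space)
  qed
  have u_bound: "\<bar>u i x\<bar> \<le> 2 * \<epsilon>" for i x
    unfolding u_def using \<mu>_le[of i] t(1) by auto
  have u_square: "integrable S (\<lambda>x. (u i x)\<^sup>2)" for i
  proof (rule P.integrable_const_bound[of _ "(2 * \<epsilon>)\<^sup>2"])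
    have "(u i x)\<^sup>2 \<le> (2 * \<epsilon>)\<^sup>2" for x
      using power_mono[OF u_bound[of i x], of 2] by simp
    thus "AE x in S. norm ((u i x)\<^sup>2) \<le> (2 * \<epsilon>)\<^sup>2" by simp
  qed simp
  have w_eq: "w i x = \<eta> i x - u i x" for i x using uw[of i x] by simp
  have u_dep: "depends_on {i * m..<(i + 2) * m} (u i)" for i
    unfolding u_def by (rule depends_on_comp[OF \<eta>_depends])
  have u_mean: "(\<integral>x. u i x \<partial>S) = 0" for i
    unfolding u_def using int1 by (simp add: P.prob_space \<mu>_def)
  have w_square: "integrable S (\<lambda>x. (w i x)\<^sup>2)" for i
  proof -
    have "integrable S (\<lambda>x. (\<eta> i x + (- u i x))\<^sup>2)"
      by (rule integrable_add_square) (use u_square \<eta>_square in auto)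
    thus ?thesis by (simp add: w_eq)
  qed
  interpret w: one_dependent M m w
  proof
    show "depends_on {i * m..<(i + 2) * m} (w i)" for i
      unfolding w_def by (rule depends_on_comp[OF \<eta>_depends])
    show "(\<integral>x. w i x \<partial>S) = 0" for i
      unfolding w_eq using \<eta>_integrable[of i] P.square_integrable_imp_integrable[OF _ u_square[of i]]
      by (simp add: u_mean \<eta>_mean)
  qed (simp_all add: w_square)
  have w_var: "(\<integral>x. (w i x)\<^sup>2 \<partial>S) \<le> lam" for i
  proof -
    let ?v = "\<lambda>x. \<eta> i x * (if \<bar>\<eta> i x\<bar> > \<epsilon> then 1 else 0)"
    have v2: "(?v x)\<^sup>2 = (\<eta> i x)\<^sup>2 * (if \<bar>\<eta> i x\<bar> > \<epsilon> then 1 else 0)" for x by simp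
    have "(\<integral>x. w i x \<partial>S) = (\<integral>x. ?v x \<partial>S) + \<mu> i" unfolding w_def using int1 by (simp add: P.prob_space)
    \<comment> \<open>As \<open>\<eta> i\<close> has mean zero, \<open>\<mu> i\<close> is minus the
      mean of the discarded part, so \<open>w i\<close> is that part centred and its second moment
      is a variance.\<close>
    hence \<mu>: "\<mu> i = - (\<integral>x. ?v x \<partial>S)" using w.\<eta>_mean[of i] by simp
    have "(\<integral>x. (w i x)\<^sup>2 \<partial>S) = P.variance ?v" unfolding w_def \<mu> by simp
    also have "\<dots> = (\<integral>x. (?v x)\<^sup>2 \<partial>S) - (\<integral>x. ?v x \<partial>S)\<^sup>2"
      by (rule P.variance_eq) (use int1 in \<open>simp_all only: v2\<close>)
    also have "\<dots> \<le> (\<integral>x. (?v x)\<^sup>2 \<partial>S)" by simp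
    also have "\<dots> \<le> lam" using tail[of i] by (simp only: v2)
    finally show ?thesis .
  qed
  have lam0: "lam \<ge> 0" by (rule order_trans[OF _ w_var[of 0]]) simp
  have W: "(\<integral>x. (\<Sum>i=a..<b. w i x)\<^sup>2 \<partial>S) \<le> 3 * p * lam" if "a \<le> b" "b \<le> a + p" for a b
  proof -
    have "(\<integral>x. (\<Sum>i=a..<b. w i x)\<^sup>2 \<partial>S) \<le> 3 * real (b - a) * lam"
      by (rule w.variance_sum_le[OF w_var that(1)])
    also have "\<dots> \<le> 3 * p * lam" using that lam0 by (intro mult_right_mono) auto
    finally show ?thesis .
  qed
  have u_sum_sq: "integrable S (\<lambda>x. (\<Sum>i=a..<b. u i x)\<^sup>2)" for a b
    by (intro integrable_sum_square u_square) auto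
  have U: "(\<integral>x. (\<Sum>i=a..<b. u i x)\<^sup>2 \<partial>S) \<le> 2 * V + 6 * p * lam" if "a \<le> b" "b \<le> a + p" for a b
  proof -
    have "(\<integral>x. (\<Sum>i=a..<b. u i x)\<^sup>2 \<partial>S) \<le> (\<integral>x. 2 * (\<Sum>i=a..<b. \<eta> i x)\<^sup>2 + 2 * (\<Sum>i=a..<b. w i x)\<^sup>2 \<partial>S)"
    proof (intro integral_mono u_sum_sq)
      fix x
      have "(\<Sum>i=a..<b. u i x) = (\<Sum>i=a..<b. \<eta> i x) - (\<Sum>i=a..<b. w i x)"
        by (simp add: w_eq sum_subtractf)
      thus "(\<Sum>i=a..<b. u i x)\<^sup>2 \<le> 2 * (\<Sum>i=a..<b. \<eta> i x)\<^sup>2 + 2 * (\<Sum>i=a..<b. w i x)\<^sup>2"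
        using sum_squares_bound[of "\<Sum>i=a..<b. \<eta> i x" "- (\<Sum>i=a..<b. w i x)"]
        by (simp add: power2_diff)
    qed (auto intro!: \<eta>_sum_square w.\<eta>_sum_square)
    also have "\<dots> = 2 * (\<integral>x. (\<Sum>i=a..<b. \<eta> i x)\<^sup>2 \<partial>S) + 2 * (\<integral>x. (\<Sum>i=a..<b. w i x)\<^sup>2 \<partial>S)"
      using \<eta>_sum_square w.\<eta>_sum_square by simp
    also have "\<dots> \<le> 2 * V + 6 * p * lam" using V[OF that] W[OF that] by simp
    finally show ?thesis .
  qed
  let ?B = "\<lambda>x. \<Sum>i=q..<q+p. \<eta> i x" and ?U = "\<lambda>x. \<Sum>i=q..<q+p. u i x" and ?W = "\<lambda>x. \<Sum>i=q..<q+p. w i x"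
  have shift: "(\<Sum>i=q+a..<q+b. u i x) = (\<Sum>i=a..<b. u (q + i) x)" for a b x
    using sum.shift_bounds_nat_ivl[of "\<lambda>i. u i x" a q b] by (simp add: add.commute)
  have shiftp: "?U x = (\<Sum>i<p. u (q + i) x)" for x
    unfolding lessThan_atLeast0 shift[symmetric] by simp
  have main: "(\<integral>x. (?U x)\<^sup>2 * (if \<bar>?U x\<bar> > 2 * t then 1 else 0) \<partial>S) \<le> 72 * (2 * V + 6 * p * lam)\<^sup>2 / t\<^sup>2"
    unfolding shiftp
  proof (rule first_passage_tail[where \<epsilon> = "2 * \<epsilon>" and q = q and m = m])
    show "depends_on {(q + i) * m..<(q + i + 2) * m} (u (q + i))" for i by (rule u_dep)
    show "(\<integral>x. (\<Sum>i=a..<b. u (q + i) x)\<^sup>2 \<partial>S) \<le> 2 * V + 6 * p * lam" if "a \<le> b" "b \<le> p" for a b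
      using U[of "q + a" "q + b"] that by (simp add: shift)
  qed (use t u_bound in auto)
  have intU: "integrable S (\<lambda>x. (?U x)\<^sup>2 * (if \<bar>?U x\<bar> > 2 * t then 1 else 0))"
    by (rule Bochner_Integration.integrable_bound[OF u_sum_sq[of q "q + p"]]) auto
  \<comment> \<open>The larger of \<open>|U|\<close> and \<open>|W|\<close> is at least half of
    \<open>|B|\<close>. If it is \<open>|U|\<close>, then \<open>|U| > 2 * t\<close> and the
    first-passage bound applies; otherwise the second moment of \<open>W\<close> pays. The resulting
    factor 4 gives 288 = 4 * 72 and 12 = 4 * 3.\<close>
  have "(\<integral>x. (?B x)\<^sup>2 * (if \<bar>?B x\<bar> > 4 * t then 1 else 0) \<partial>S)
      \<le> (\<integral>x. 4 * ((?U x)\<^sup>2 * (if \<bar>?U x\<bar> > 2 * t then 1 else 0)) + 4 * (?W x)\<^sup>2 \<partial>S)"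
  proof (rule integral_mono)
    show "integrable S (\<lambda>x. (?B x)\<^sup>2 * (if \<bar>?B x\<bar> > 4 * t then 1 else 0))"
      by (rule Bochner_Integration.integrable_bound[OF \<eta>_sum_square[of q "q + p"]]) auto
    show "integrable S (\<lambda>x. 4 * ((?U x)\<^sup>2 * (if \<bar>?U x\<bar> > 2 * t then 1 else 0)) + 4 * (?W x)\<^sup>2)"
      by (intro Bochner_Integration.integrable_add integrable_mult_right intU w.\<eta>_sum_square)
    fix x
    have B: "?B x = ?U x + ?W x" by (simp add: uw sum.distrib)
    show "(?B x)\<^sup>2 * (if \<bar>?B x\<bar> > 4 * t then 1 else 0)
      \<le> 4 * ((?U x)\<^sup>2 * (if \<bar>?U x\<bar> > 2 * t then 1 else 0)) + 4 * (?W x)\<^sup>2"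
    proof (cases "\<bar>?B x\<bar> > 4 * t")
      case True
      show ?thesis
      proof (cases "\<bar>?W x\<bar> \<le> \<bar>?U x\<bar>")
        case le: True
        have "\<bar>?B x\<bar> \<le> 2 * \<bar>?U x\<bar>" using B le by linarith
        hence "(?B x)\<^sup>2 \<le> (2 * \<bar>?U x\<bar>)\<^sup>2" by (metis abs_ge_zero power2_abs power_mono)
        moreover have "\<bar>?U x\<bar> > 2 * t" using \<open>\<bar>?B x\<bar> \<le> 2 * \<bar>?U x\<bar>\<close> True by linarith
        ultimately show ?thesis using True by (simp add: add_increasing2)
      next
        case False
        have "\<bar>?B x\<bar> \<le> 2 * \<bar>?W x\<bar>" using B False by linarith
        hence "(?B x)\<^sup>2 \<le> (2 * \<bar>?W x\<bar>)\<^sup>2" by (metis abs_ge_zero power2_abs power_mono)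
        thus ?thesis using True by (simp add: add_increasing)
      qed
    qed simp
  qed
  also have "\<dots> = 4 * (\<integral>x. (?U x)\<^sup>2 * (if \<bar>?U x\<bar> > 2 * t then 1 else 0) \<partial>S) + 4 * (\<integral>x. (?W x)\<^sup>2 \<partial>S)"
    using intU w.\<eta>_sum_square by simp
  also have "\<dots> \<le> 4 * (72 * (2 * V + 6 * p * lam)\<^sup>2 / t\<^sup>2) + 4 * (3 * p * lam)"
    using main W[of q "q + p"] by (intro add_mono mult_left_mono) auto
  finally show ?thesis by simp
qed

end

section \<open>Characteristic functions and Bernstein blocking\<close>

lemma norm_integral_le:
  fixes f :: "'a \<Rightarrow> 'b::{banach, second_countable_topology}"
  assumes "integrable M f" "integrable M g" "\<And>x. norm (f x) \<le> g x"
  shows "norm (\<integral>x. f x \<partial>M) \<le> (\<integral>x. g x \<partial>M)"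
  using integral_norm_bound[of M f] integral_mono[OF integrable_norm[OF assms(1)] assms(2)] assms(3)
  by (meson order_trans)

text \<open>The cubic Taylor remainder serves for small \<open>b\<close> and the quadratic one for
  large \<open>b\<close>. In this way a truncated second moment takes the place of a third
  moment.\<close>

lemma iexp_second_order:
  assumes "s \<ge> 0"
  shows "cmod (iexp b - 1 - \<i> * b + (b\<^sup>2 / 2 :: real)) \<le> s / 6 * b\<^sup>2 + b\<^sup>2 * (if \<bar>b\<bar> > s then 1 else 0)"
proof -
  have eq: "iexp b - (\<Sum>k\<le>2. (\<i> * b)^k / fact k) = iexp b - 1 - \<i> * b + (b\<^sup>2 / 2 :: real)"
    by (simp add: numeral_2_eq_2 power_mult_distrib)
  show ?thesis
  proof (cases "\<bar>b\<bar> > s")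
    case True
    have "cmod (iexp b - 1 - \<i> * b + (b\<^sup>2 / 2 :: real)) \<le> b\<^sup>2"
      using iexp_approx2[of b 2] unfolding eq by simp
    also have "\<dots> \<le> s / 6 * b\<^sup>2 + b\<^sup>2" using assms by simp
    finally show ?thesis using True by simp
  next
    case False
    have "cmod (iexp b - 1 - \<i> * b + (b\<^sup>2 / 2 :: real)) \<le> \<bar>b\<bar> ^ 3 / 6"
      using iexp_approx1[of b 2] unfolding eq by (simp add: eval_nat_numeral)
    also have "\<dots> = \<bar>b\<bar> / 6 * b\<^sup>2" by (simp add: power2_eq_square power3_eq_cube)
    also have "\<dots> \<le> s / 6 * b\<^sup>2" using False by (intro mult_right_mono) auto
    finally show ?thesis using False by simp
  qed
qed

lemma (in sequence_space) char_second_order: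
  fixes B :: "(nat \<Rightarrow> 'a) \<Rightarrow> real"
  assumes [measurable]: "B \<in> borel_measurable S" and sq: "integrable S (\<lambda>x. (B x)\<^sup>2)"
    and mean: "(\<integral>x. B x \<partial>S) = 0" and "s \<ge> 0"
  shows "cmod ((CLINT x|S. iexp (B x)) - (1 - (\<integral>x. (B x)\<^sup>2 \<partial>S) / 2))
    \<le> s / 6 * (\<integral>x. (B x)\<^sup>2 \<partial>S) + (\<integral>x. (B x)\<^sup>2 * (if \<bar>B x\<bar> > s then 1 else 0) \<partial>S)"
proof -
  have iB: "integrable S B" using P.square_integrable_imp_integrable[OF _ sq] by simp
  have ie: "integrable S (\<lambda>x. iexp (B x))"
    by (rule P.integrable_const_bound[of _ 1]) auto
  have "(CLINT x|S. iexp (B x) - 1 - \<i> * B x + ((B x)\<^sup>2 / 2 :: real))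
    = (CLINT x|S. iexp (B x)) - 1 - \<i> * (CLINT x|S. complex_of_real (B x)) + (CLINT x|S. complex_of_real ((B x)\<^sup>2 / 2))"
  proof -
    have 1: "integrable S (\<lambda>x. complex_of_real (B x))" using iB by (rule integrable_of_real)
    have 2: "integrable S (\<lambda>x. complex_of_real ((B x)\<^sup>2 / 2))" using sq by (intro integrable_of_real) simp
    show ?thesis using ie 1 2
      by (subst Bochner_Integration.integral_add Bochner_Integration.integral_diff;
          (intro Bochner_Integration.integrable_diff integrable_mult_right)?; simp add: P.prob_space)+
  qed
  also have "\<dots> = (CLINT x|S. iexp (B x)) - (1 - (\<integral>x. (B x)\<^sup>2 \<partial>S) / 2)"
    by (simp only: integral_complex_of_real mean) simp
  finally have "cmod ((CLINT x|S. iexp (B x)) - (1 - (\<integral>x. (B x)\<^sup>2 \<partial>S) / 2))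
    = cmod (CLINT x|S. iexp (B x) - 1 - \<i> * B x + ((B x)\<^sup>2 / 2 :: real))" by simp
  also have "\<dots> \<le> (\<integral>x. s / 6 * (B x)\<^sup>2 + (B x)\<^sup>2 * (if \<bar>B x\<bar> > s then 1 else 0) \<partial>S)"
  proof (rule norm_integral_le)
    show "integrable S (\<lambda>x. iexp (B x) - 1 - \<i> * B x + ((B x)\<^sup>2 / 2 :: real))"
      using ie iB sq by (intro Bochner_Integration.integrable_add Bochner_Integration.integrable_diff
        integrable_mult_right integrable_of_real) auto
    show "integrable S (\<lambda>x. s / 6 * (B x)\<^sup>2 + (B x)\<^sup>2 * (if \<bar>B x\<bar> > s then 1 else 0))"
      using sq by (intro Bochner_Integration.integrable_add integrable_mult_right
        Bochner_Integration.integrable_bound[OF sq, of "\<lambda>x. (B x)\<^sup>2 * (if \<bar>B x\<bar> > s then 1 else 0)"]) auto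
  qed (rule iexp_second_order[OF \<open>s \<ge> 0\<close>])
  also have "\<dots> = s / 6 * (\<integral>x. (B x)\<^sup>2 \<partial>S) + (\<integral>x. (B x)\<^sup>2 * (if \<bar>B x\<bar> > s then 1 else 0) \<partial>S)"
    using sq Bochner_Integration.integrable_bound[OF sq, of "\<lambda>x. (B x)\<^sup>2 * (if \<bar>B x\<bar> > s then 1 else 0)"]
    by (subst Bochner_Integration.integral_add) auto
  finally show ?thesis .
qed

lemma (in sequence_space) char_diff_le:
  fixes F G :: "(nat \<Rightarrow> 'a) \<Rightarrow> real"
  assumes [measurable]: "F \<in> borel_measurable S" "G \<in> borel_measurable S" "integrable S (\<lambda>x. F x - G x)"
  shows "cmod ((CLINT x|S. iexp (F x)) - (CLINT x|S. iexp (G x))) \<le> (\<integral>x. \<bar>F x - G x\<bar> \<partial>S)"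
proof -
  have i: "integrable S (\<lambda>x. iexp (F x))" "integrable S (\<lambda>x. iexp (G x))"
    by (rule P.integrable_const_bound[of _ 1]; simp)+
  hence "(CLINT x|S. iexp (F x)) - (CLINT x|S. iexp (G x)) = (CLINT x|S. iexp (F x) - iexp (G x))"
    by simp
  also have "cmod \<dots> \<le> (\<integral>x. \<bar>F x - G x\<bar> \<partial>S)"
    using i assms(3) by (intro norm_integral_le norm_cis_diff_le) auto
  finally show ?thesis .
qed

context one_dependent
begin

text \<open>One omitted term between blocks of \<open>p\<close> terms suffices for independence,
  because a term reaches only one stretch beyond its own.\<close>

lemma char_blocks:
  "(CLINT x|S. iexp (\<Sum>j<L. \<Sum>i=j * Suc p..<j * Suc p + p. \<eta> i x)) =
    (\<Prod>j<L. CLINT x|S. iexp (\<Sum>i=j * Suc p..<j * Suc p + p. \<eta> i x))"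
proof (induction L)
  case 0
  show ?case by (simp add: P.prob_space)
next
  case (Suc L)
  let ?B = "\<lambda>j x. \<Sum>i=j * Suc p..<j * Suc p + p. \<eta> i x"
  have "(CLINT x|S. iexp (\<Sum>j<Suc L. ?B j x)) = (CLINT x|S. iexp (\<Sum>j<L. ?B j x) * iexp (?B L x))"
    by (simp add: distrib_left exp_add)
  also have "\<dots> = (CLINT x|S. iexp (\<Sum>j<L. ?B j x)) * (CLINT x|S. iexp (?B L x))"
  proof (rule integral_mult_depends)
    show "depends_on {..<L * Suc p * m} (\<lambda>x. iexp (\<Sum>j<L. ?B j x))"
    proof (rule depends_on_comp[where g = "\<lambda>z. iexp z"], rule depends_on_sum)
      fix j assume "j \<in> {..<L}"
      hence "Suc j * Suc p \<le> L * Suc p" by (intro mult_le_mono1) simp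
      hence "Suc (j * Suc p + p) * m \<le> L * Suc p * m" by (intro mult_le_mono1) simp
      thus "depends_on {..<L * Suc p * m} (?B j)"
        by (intro depends_on_mono[OF \<eta>_sum_depends])
           (meson atLeastLessThan_iff lessThan_iff less_le_trans subsetI)
    qed
    show "depends_on {L * Suc p * m..} (\<lambda>x. iexp (?B L x))"
      by (rule depends_on_comp[where g = "\<lambda>z. iexp z"], rule depends_on_mono[OF \<eta>_sum_depends]) auto
  qed (rule P.integrable_const_bound[of _ 1]; simp)+
  finally show ?case using Suc by simp
qed

text \<open>The omitted terms are \<open>p + 1\<close>, hence at least 2, indices apart and
  therefore uncorrelated.\<close>

lemma variance_gaps:
  assumes "\<And>i. (\<integral>x. (\<eta> i x)\<^sup>2 \<partial>S) = \<gamma>\<^sub>0" "p \<ge> 1"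
  shows "(\<integral>x. (\<Sum>j<L. \<eta> (j * Suc p + p) x)\<^sup>2 \<partial>S) = L * \<gamma>\<^sub>0"
proof (induction L)
  case (Suc L)
  let ?D = "\<lambda>x. \<Sum>j<L. \<eta> (j * Suc p + p) x" and ?k = "L * Suc p + p"
  have D2: "integrable S (\<lambda>x. (?D x)\<^sup>2)" by (intro integrable_sum_square \<eta>_square) auto
  have "(\<integral>x. ?D x * \<eta> ?k x \<partial>S) = (\<integral>x. ?D x \<partial>S) * (\<integral>x. \<eta> ?k x \<partial>S)"
  proof (rule integral_mult_depends)
    show "depends_on {..<?k * m} ?D"
    proof (rule depends_on_sum)
      fix j assume "j \<in> {..<L}"
      hence "Suc j * Suc p \<le> L * Suc p" by (intro mult_le_mono1) simp
      hence "j * Suc p + p + 2 \<le> ?k" using assms(2) by simp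
      hence "(j * Suc p + p + 2) * m \<le> ?k * m" by (rule mult_le_mono1)
      thus "depends_on {..<?k * m} (\<eta> (j * Suc p + p))"
        by (intro depends_on_mono[OF \<eta>_depends]) auto
    qed
    show "depends_on {?k * m..} (\<eta> ?k)" by (rule depends_on_mono[OF \<eta>_depends]) auto
  qed (auto intro: \<eta>_integrable)
  hence 0: "(\<integral>x. ?D x * \<eta> ?k x \<partial>S) = 0" by (simp only: \<eta>_mean mult_zero_right)
  have i: "integrable S (\<lambda>x. ?D x * \<eta> ?k x)"
    by (intro integrable_mult_square D2 \<eta>_square) measurable
  have "(\<integral>x. (\<Sum>j<Suc L. \<eta> (j * Suc p + p) x)\<^sup>2 \<partial>S) = (\<integral>x. (?D x)\<^sup>2 + 2 * (?D x * \<eta> ?k x) + (\<eta> ?k x)\<^sup>2 \<partial>S)"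
    by (simp add: power2_sum mult_ac add_ac)
  also have "\<dots> = (\<integral>x. (?D x)\<^sup>2 \<partial>S) + 2 * (\<integral>x. ?D x * \<eta> ?k x \<partial>S) + (\<integral>x. (\<eta> ?k x)\<^sup>2 \<partial>S)"
    using D2 i \<eta>_square[of ?k]
    by (subst Bochner_Integration.integral_add Bochner_Integration.integral_mult_right; (intro Bochner_Integration.integrable_add integrable_mult_right)?; simp)+
  also have "\<dots> = Suc L * \<gamma>\<^sub>0" by (simp only: 0 Suc assms) (simp add: algebra_simps)
  finally show ?case .
qed simp

text \<open>The error has three sources: the omitted terms between blocks
  (\<open>sqrt (L * \<gamma>\<^sub>0)\<close>), the incomplete block at the end
  (\<open>sqrt V\<close>), and the second-order expansion of each of the \<open>L\<close> blocks
  with cut-off \<open>4 * t\<close>, whose tail is bounded by \<open>block_tail\<close>. The number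
  \<open>v\<close> is the variance of one block; \<open>v <= 4\<close> keeps
  \<open>1 - v / 2\<close> in [-1, 1], so that products can be compared factor by factor.\<close>

lemma char_sum_bound:
  assumes \<gamma>: "\<And>i. (\<integral>x. (\<eta> i x)\<^sup>2 \<partial>S) = \<gamma>\<^sub>0" "\<And>i. (\<integral>x. \<eta> i x * \<eta> (Suc i) x \<partial>S) = \<gamma>\<^sub>1"
    and tail: "\<And>i. (\<integral>x. (\<eta> i x)\<^sup>2 * (if \<bar>\<eta> i x\<bar> > \<epsilon> then 1 else 0) \<partial>S) \<le> lam"
    and V: "\<And>a b. a \<le> b \<Longrightarrow> b \<le> a + Suc p \<Longrightarrow> (\<integral>x. (\<Sum>i=a..<b. \<eta> i x)\<^sup>2 \<partial>S) \<le> V"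
    and t: "0 \<le> \<epsilon>" "t > 0" "16 * \<epsilon> \<le> t" "32 * (2 * V + 6 * p * lam) \<le> t\<^sup>2"
    and p: "p \<ge> 1" and v: "v = p * (\<gamma>\<^sub>0 + 2 * \<gamma>\<^sub>1) - 2 * \<gamma>\<^sub>1" "v \<le> 4" and L: "L = N div Suc p"
  shows "cmod ((CLINT x|S. iexp (\<Sum>i<N. \<eta> i x)) - (1 - v / 2) ^ L)
    \<le> sqrt (L * \<gamma>\<^sub>0) + sqrt V + L * (4 * t / 6 * v + (288 * (2 * V + 6 * p * lam)\<^sup>2 / t\<^sup>2 + 12 * p * lam))"
proof -
  let ?B = "\<lambda>j x. \<Sum>i=j * Suc p..<j * Suc p + p. \<eta> i x"
  let ?D = "\<lambda>x. \<Sum>j<L. \<eta> (j * Suc p + p) x" and ?R = "\<lambda>x. \<Sum>i=L * Suc p..<N. \<eta> i x"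
  have B_var: "(\<integral>x. (?B j x)\<^sup>2 \<partial>S) = v" for j
    using variance_sum_eq[OF \<gamma>, of "j * Suc p" "j * Suc p + p"] p v by simp
  have v0: "0 \<le> v" unfolding B_var[of 0, symmetric] by simp
  have LN: "L * Suc p \<le> N" "N \<le> L * Suc p + Suc p"
    unfolding L using mod_less_divisor[of "Suc p" N] div_mult_mod_eq[of N "Suc p"] by linarith+
  have decomp0: "(\<Sum>i<L * Suc p. \<eta> i x) = (\<Sum>j<L. ?B j x) + (\<Sum>j<L. \<eta> (j * Suc p + p) x)" for x L
  proof (induction L)
    case (Suc L)
    have "(\<Sum>i<Suc L * Suc p. \<eta> i x) = (\<Sum>i<L * Suc p. \<eta> i x) + (\<Sum>i=L * Suc p..<Suc L * Suc p. \<eta> i x)"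
      unfolding lessThan_atLeast0 by (rule sum.atLeastLessThan_concat[symmetric]) auto
    moreover have "Suc L * Suc p = Suc (L * Suc p + p)" by simp
    ultimately have "(\<Sum>i<Suc L * Suc p. \<eta> i x) = (\<Sum>i<L * Suc p. \<eta> i x) + (\<Sum>i=L * Suc p..<Suc (L * Suc p + p). \<eta> i x)"
      by (simp only:)
    thus ?case using Suc by (simp add: algebra_simps del: mult_Suc mult_Suc_right)
  qed simp
  have decomp: "(\<Sum>i<N. \<eta> i x) - (\<Sum>j<L. ?B j x) = ?D x + ?R x" for x
    using decomp0[of x L] sum.atLeastLessThan_concat[of 0 "L * Suc p" N "\<lambda>i. \<eta> i x"] LN(1)
    by (simp add: lessThan_atLeast0)
  have sqD: "integrable S (\<lambda>x. (?D x)\<^sup>2)" by (intro integrable_sum_square \<eta>_square) auto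
  have iD: "integrable S ?D" "integrable S ?R"
    by (intro Bochner_Integration.integrable_sum \<eta>_integrable)+
  have "(\<integral>x. \<bar>?D x + ?R x\<bar> \<partial>S) \<le> (\<integral>x. \<bar>?D x\<bar> + \<bar>?R x\<bar> \<partial>S)"
    using iD by (intro integral_mono) auto
  also have "\<dots> = (\<integral>x. \<bar>?D x\<bar> \<partial>S) + (\<integral>x. \<bar>?R x\<bar> \<partial>S)" using iD by simp
  also have "\<dots> \<le> sqrt (\<integral>x. (?D x)\<^sup>2 \<partial>S) + sqrt (\<integral>x. (?R x)\<^sup>2 \<partial>S)"
    by (intro add_mono set_integral_abs_le_square sqD \<eta>_sum_square) (auto simp: P.prob_space_axioms)
  also have "\<dots> \<le> sqrt (L * \<gamma>\<^sub>0) + sqrt V"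
    using variance_gaps[OF \<gamma>(1) p] V[OF LN] by simp
  finally have 1: "cmod ((CLINT x|S. iexp (\<Sum>i<N. \<eta> i x)) - (CLINT x|S. iexp (\<Sum>j<L. ?B j x))) \<le> sqrt (L * \<gamma>\<^sub>0) + sqrt V"
    by (intro order_trans[OF char_diff_le]) (simp_all only: decomp iD Bochner_Integration.integrable_add, measurable)
  have B_char: "cmod ((CLINT x|S. iexp (?B j x)) - (1 - v / 2)) \<le> 4 * t / 6 * v + (288 * (2 * V + 6 * p * lam)\<^sup>2 / t\<^sup>2 + 12 * p * lam)" for j
  proof -
    have "cmod ((CLINT x|S. iexp (?B j x)) - (1 - (\<integral>x. (?B j x)\<^sup>2 \<partial>S) / 2)) \<le> 4 * t / 6 * (\<integral>x. (?B j x)\<^sup>2 \<partial>S) + (\<integral>x. (?B j x)\<^sup>2 * (if \<bar>?B j x\<bar> > 4 * t then 1 else 0) \<partial>S)"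
      by (rule char_second_order) (use t in \<open>auto simp: \<eta>_sum_square \<eta>_mean \<eta>_integrable\<close>)
    also have "\<dots> \<le> 4 * t / 6 * v + (288 * (2 * V + 6 * p * lam)\<^sup>2 / t\<^sup>2 + 12 * p * lam)"
      unfolding B_var
    proof (intro add_left_mono)
      have V': "(\<integral>x. (\<Sum>i=a..<b. \<eta> i x)\<^sup>2 \<partial>S) \<le> V" if "a \<le> b" "b \<le> a + p" for a b
        using that by (intro V) auto
      show "(\<integral>x. (?B j x)\<^sup>2 * (if \<bar>?B j x\<bar> > 4 * t then 1 else 0) \<partial>S) \<le> 288 * (2 * V + 6 * p * lam)\<^sup>2 / t\<^sup>2 + 12 * p * lam"
        using block_tail[OF tail V' t, of "j * Suc p"] by simp
    qed
    finally show ?thesis unfolding B_var by simp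
  qed
  have "cmod ((\<Prod>j<L. CLINT x|S. iexp (?B j x)) - (\<Prod>j<L. complex_of_real (1 - v / 2)))
    \<le> (\<Sum>j<L. cmod ((CLINT x|S. iexp (?B j x)) - complex_of_real (1 - v / 2)))"
  proof (rule norm_prod_diff)
    fix j
    have "cmod (CLINT x|S. iexp (?B j x)) \<le> (\<integral>x. 1 \<partial>S)"
      by (rule norm_integral_le) (auto intro!: P.integrable_const_bound[of _ 1])
    thus "cmod (CLINT x|S. iexp (?B j x)) \<le> 1" by (simp add: P.prob_space)
    show "cmod (complex_of_real (1 - v / 2)) \<le> 1"
      using v0 v(2) by (simp only: norm_of_real)
  qed
  also have "\<dots> \<le> (\<Sum>j<L. 4 * t / 6 * v + (288 * (2 * V + 6 * p * lam)\<^sup>2 / t\<^sup>2 + 12 * p * lam))"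
    using B_char by (intro sum_mono) simp
  finally have 2: "cmod ((CLINT x|S. iexp (\<Sum>j<L. ?B j x)) - (1 - v / 2) ^ L)
    \<le> L * (4 * t / 6 * v + (288 * (2 * V + 6 * p * lam)\<^sup>2 / t\<^sup>2 + 12 * p * lam))"
    unfolding char_blocks by simp
  show ?thesis using norm_triangle_mono[OF 1 2] by (simp add: add_ac)
qed

end


section \<open>Central limit theorem for stationary one-dependent arrays\<close>

lemma abs_exp_minus_linear_le:
  assumes "0 \<le> (x::real)"
  shows "\<bar>exp (- x) - (1 - x)\<bar> \<le> x\<^sup>2 / 2"
proof -
  have "((1 - x) + x\<^sup>2 / 2) - exp (- x) \<ge> 0"
  proof -
    let ?f = "\<lambda>x::real. (1 - x) + x\<^sup>2 / 2 - exp (- x)"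
    have "?f 0 \<le> ?f x"
    proof (rule DERIV_nonneg_imp_nondecreasing[OF assms])
      fix y :: real assume "0 \<le> y" "y \<le> x"
      have "(?f has_real_derivative (-1 + y + exp (- y))) (at y)"
        by (auto intro!: derivative_eq_intros simp: power2_eq_square)
      moreover have "0 \<le> -1 + y + exp (- y)" using exp_ge_add_one_self[of "- y"] by simp
      ultimately show "\<exists>d. (?f has_real_derivative d) (at y) \<and> 0 \<le> d" by blast
    qed
    thus ?thesis by simp
  qed
  moreover have "1 - x \<le> exp (- x)" using exp_ge_add_one_self[of "- x"] by simp
  ultimately show ?thesis by simp
qed

lemma power_one_minus_exp_le:
  assumes "0 \<le> (v::real)" "v \<le> 4"
  shows "\<bar>(1 - v / 2) ^ L - exp (- (L * v) / 2)\<bar> \<le> L * v * v"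
proof -
  have "exp (- (L * v) / 2) = exp (- (v / 2)) ^ L" by (simp flip: exp_of_nat_mult)
  hence "\<bar>(1 - v / 2) ^ L - exp (- (L * v) / 2)\<bar> \<le> L * \<bar>(1 - v / 2) - exp (- (v / 2))\<bar>"
    using norm_power_diff[of "1 - v / 2" "exp (- (v / 2))" L] assms by (simp add: abs_if)
  also have "\<dots> \<le> L * ((v / 2)\<^sup>2 / 2)"
    using abs_exp_minus_linear_le[of "v / 2"] assms by (intro mult_left_mono) (auto simp: abs_minus_commute)
  also have "\<dots> \<le> L * (v * v)" by (intro mult_left_mono) (auto simp: power2_eq_square)
  finally show ?thesis by (simp add: mult_ac)
qed

text \<open>Row \<open>n\<close> has \<open>N n\<close> terms with common variance
  \<open>g0 n\<close> and neighbour covariance \<open>g1 n\<close>; \<open>lam \<epsilon> n\<close>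
  bounds the Lindeberg tail of one term. The proof balances the errors in
  \<open>char_sum_bound\<close>: the number of terms in a block grows, but is negligible against
  \<open>N n\<close>.\<close>

lemma (in sequence_space) one_dependent_clt:
  fixes \<eta> :: "nat \<Rightarrow> nat \<Rightarrow> (nat \<Rightarrow> 'a) \<Rightarrow> real" and N m :: "nat \<Rightarrow> nat" and g0 g1 :: "nat \<Rightarrow> real" and lam :: "real \<Rightarrow> nat \<Rightarrow> real" and s :: real
  assumes dep: "\<forall>\<^sub>F n in sequentially. one_dependent M (m n) (\<eta> n)"
    and g0: "\<forall>\<^sub>F n in sequentially. \<forall>i. (\<integral>x. (\<eta> n i x)\<^sup>2 \<partial>S) = g0 n"
    and g1: "\<forall>\<^sub>F n in sequentially. \<forall>i. (\<integral>x. \<eta> n i x * \<eta> n (Suc i) x \<partial>S) = g1 n"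
    and tail: "\<And>\<epsilon>. \<epsilon> > 0 \<Longrightarrow> \<forall>\<^sub>F n in sequentially. \<forall>i.
      (\<integral>x. (\<eta> n i x)\<^sup>2 * (if \<bar>\<eta> n i x\<bar> > \<epsilon> then 1 else 0) \<partial>S) \<le> lam \<epsilon> n"
    and lam: "\<And>\<epsilon>. \<epsilon> > 0 \<Longrightarrow> (\<lambda>n. N n * lam \<epsilon> n) \<longlonglongrightarrow> 0"
    and N: "filterlim N at_top sequentially"
    and s: "(\<lambda>n. N n * (g0 n + 2 * g1 n)) \<longlonglongrightarrow> s"
  shows "(\<lambda>n. CLINT x|S. iexp (\<Sum>i<N n. \<eta> n i x)) \<longlonglongrightarrow> exp (- s / 2)"
proof -
  have N1: "\<forall>\<^sub>F n in sequentially. N n \<ge> 1" using N by (simp add: filterlim_at_top)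
  have rN: "filterlim (\<lambda>n. real (N n)) at_top sequentially"
    using N filterlim_real_sequentially filterlim_compose by blast
  have g0_nonneg: "\<forall>\<^sub>F n in sequentially. g0 n \<ge> 0"
    using g0 by eventually_elim (metis integral_nonneg_AE AE_I2 zero_le_power2)
  have g1_le: "\<forall>\<^sub>F n in sequentially. \<bar>g1 n\<bar> \<le> g0 n"
    using g0 g1 dep
  proof eventually_elim
    case (elim n)
    then interpret one_dependent M "m n" "\<eta> n" by simp
    show ?case using abs_integral_mult_le[of "g0 n" 0 "Suc 0"] elim by simp
  qed
  have lam0: "\<forall>\<^sub>F n in sequentially. lam \<epsilon> n \<ge> 0" if "\<epsilon> > 0" for \<epsilon>
    using tail[OF that]
  proof eventually_elim
    case (elim n)
    have "0 \<le> (\<integral>x. (\<eta> n 0 x)\<^sup>2 * (if \<bar>\<eta> n 0 x\<bar> > \<epsilon> then 1 else 0) \<partial>S)" by simp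
    thus ?case using elim by (meson order_trans)
  qed
  have lam_lim: "lam \<epsilon> \<longlonglongrightarrow> 0" if "\<epsilon> > 0" for \<epsilon>
  proof (rule tendsto_sandwich[OF lam0[OF that] _ tendsto_const lam[OF that]])
    show "\<forall>\<^sub>F n in sequentially. lam \<epsilon> n \<le> N n * lam \<epsilon> n"
      using N1 lam0[OF that] by eventually_elim (simp add: mult_le_cancel_right1)
  qed
  \<comment> \<open>Single terms are asymptotically negligible, since \<open>g0 n\<close> is at most
    \<open>\<epsilon>\<^sup>2 + lam \<epsilon> n\<close> for every fixed \<epsilon>.\<close>
  have g0_lim: "g0 \<longlonglongrightarrow> 0"
  proof (rule tendstoI)
    fix e :: real assume "e > 0"
    define \<epsilon> where "\<epsilon> = sqrt (e / 2)"
    have \<epsilon>: "\<epsilon> > 0" "\<epsilon>\<^sup>2 = e / 2" using \<open>e > 0\<close> by (auto simp: \<epsilon>_def)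
    have "\<forall>\<^sub>F n in sequentially. lam \<epsilon> n < e / 2"
      using order_tendstoD(2)[OF lam_lim[OF \<epsilon>(1)], of "e / 2"] \<open>e > 0\<close> by simp
    thus "\<forall>\<^sub>F n in sequentially. dist (g0 n) 0 < e"
      using g0 tail[OF \<epsilon>(1)] dep g0_nonneg
    proof eventually_elim
      case (elim n)
      then interpret one_dependent M "m n" "\<eta> n" by simp
      have i: "integrable S (\<lambda>x. (\<eta> n 0 x)\<^sup>2 * (if \<bar>\<eta> n 0 x\<bar> > \<epsilon> then 1 else 0))"
        by (rule Bochner_Integration.integrable_bound[OF \<eta>_square[of 0]]) auto
      have "g0 n = (\<integral>x. (\<eta> n 0 x)\<^sup>2 \<partial>S)" using elim by simp
      also have "\<dots> \<le> (\<integral>x. \<epsilon>\<^sup>2 + (\<eta> n 0 x)\<^sup>2 * (if \<bar>\<eta> n 0 x\<bar> > \<epsilon> then 1 else 0) \<partial>S)"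
      proof (intro integral_mono Bochner_Integration.integrable_add i \<eta>_square)
        show "(\<eta> n 0 x)\<^sup>2 \<le> \<epsilon>\<^sup>2 + (\<eta> n 0 x)\<^sup>2 * (if \<bar>\<eta> n 0 x\<bar> > \<epsilon> then 1 else 0)" for x
          using \<epsilon>(1) power_mono[of "\<bar>\<eta> n 0 x\<bar>" \<epsilon> 2] by auto
      qed simp
      also have "\<dots> = \<epsilon>\<^sup>2 + (\<integral>x. (\<eta> n 0 x)\<^sup>2 * (if \<bar>\<eta> n 0 x\<bar> > \<epsilon> then 1 else 0) \<partial>S)"
        using i by (subst Bochner_Integration.integral_add) (auto simp: P.prob_space)
      also have "\<dots> < e" using elim(1) spec[OF elim(3), of 0] \<epsilon> by linarith
      finally show ?case using elim by simp
    qed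
  qed
  \<comment> \<open>From \<open>p >= N * sqrt g0\<close> it follows that
    \<open>L * g0 <= sqrt g0\<close>, so the omitted terms vanish in the limit. From
    \<open>p >= sqrt N\<close> it follows that \<open>p\<close> tends to infinity, and
    \<open>g0\<close> tending to 0 gives \<open>p / N\<close> tending to 0.\<close>
  define p where "p n = nat \<lceil>sqrt ((N n)\<^sup>2 * g0 n + N n)\<rceil>" for n
  define L where "L n = N n div Suc (p n)" for n
  have p_ge: "\<forall>\<^sub>F n in sequentially. sqrt ((N n)\<^sup>2 * g0 n + N n) \<le> p n \<and> p n \<le> sqrt ((N n)\<^sup>2 * g0 n + N n) + 1 \<and> p n \<ge> 1"
    using g0_nonneg N1
  proof eventually_elim
    case (elim n)
    have "0 + 1 \<le> (real (N n))\<^sup>2 * g0 n + N n" using elim by (intro add_mono) auto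
    hence 1: "1 \<le> sqrt ((N n)\<^sup>2 * g0 n + N n)" by simp
    let ?r = "sqrt ((N n)\<^sup>2 * g0 n + N n)"
    have "real (nat \<lceil>?r\<rceil>) = of_int \<lceil>?r\<rceil>" using 1 by simp
    moreover have "?r \<le> of_int \<lceil>?r\<rceil>" "of_int \<lceil>?r\<rceil> \<le> ?r + 1" by linarith+
    ultimately have "?r \<le> real (p n) \<and> real (p n) \<le> ?r + 1" unfolding p_def by simp
    moreover have "1 \<le> real (p n)" using calculation 1 by linarith
    ultimately show ?case by simp
  qed
  have pN: "(\<lambda>n. p n / N n) \<longlonglongrightarrow> 0"
  proof (rule tendsto_sandwich[OF _ _ tendsto_const])
    show "\<forall>\<^sub>F n in sequentially. p n / N n \<le> sqrt (g0 n + 1 / N n) + 1 / N n"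
      using p_ge N1
    proof eventually_elim
      case (elim n)
      have "(N n)\<^sup>2 * g0 n + N n = (N n)\<^sup>2 * (g0 n + 1 / N n)"
        using elim by (simp add: field_simps power2_eq_square)
      hence "sqrt ((N n)\<^sup>2 * g0 n + N n) = N n * sqrt (g0 n + 1 / N n)"
        by (simp add: real_sqrt_mult)
      thus ?case using elim by (simp add: field_simps)
    qed
    have "(\<lambda>n. 1 / real (N n)) \<longlonglongrightarrow> 0"
      using tendsto_inverse_0_at_top[OF rN] by (simp add: inverse_eq_divide)
    from tendsto_add[OF tendsto_real_sqrt[OF tendsto_add[OF g0_lim this]] this]
    show "(\<lambda>n. sqrt (g0 n + 1 / N n) + 1 / N n) \<longlonglongrightarrow> 0" by simp
  qed auto
  have ip: "(\<lambda>n. 1 / real (Suc (p n))) \<longlonglongrightarrow> 0"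
  proof (rule tendsto_sandwich[OF _ _ tendsto_const])
    show "\<forall>\<^sub>F n in sequentially. 1 / real (Suc (p n)) \<le> 1 / sqrt (N n)"
      using p_ge g0_nonneg N1
    proof eventually_elim
      case (elim n)
      have "sqrt (N n) \<le> sqrt ((N n)\<^sup>2 * g0 n + N n)" using elim by simp
      also have "\<dots> \<le> real (p n)" using elim by blast
      finally have "sqrt (N n) \<le> real (Suc (p n))" by simp
      thus ?case using elim by (intro divide_left_mono) auto
    qed
    have "filterlim (\<lambda>n. sqrt (N n)) at_top sequentially"
      using filterlim_compose[OF sqrt_at_top rN] .
    thus "(\<lambda>n. 1 / sqrt (N n)) \<longlonglongrightarrow> 0"
      using tendsto_inverse_0_at_top by (simp add: inverse_eq_divide)
  qed auto
  have LN_le: "L n * Suc (p n) \<le> N n" for n unfolding L_def by (rule div_times_less_eq_dividend)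
  have LN_ge: "N n \<le> L n * Suc (p n) + Suc (p n)" for n
    unfolding L_def using mod_less_divisor[of "Suc (p n)" "N n"] div_mult_mod_eq[of "N n" "Suc (p n)"] by linarith
  have iN: "(\<lambda>n. 1 / real (N n)) \<longlonglongrightarrow> 0"
    using tendsto_inverse_0_at_top[OF rN] by (simp add: inverse_eq_divide)
  have spN: "(\<lambda>n. Suc (p n) / N n) \<longlonglongrightarrow> 0"
    using tendsto_add[OF pN iN] by (simp add: add_divide_distrib add.commute)
  have LspN: "(\<lambda>n. L n * Suc (p n) / N n) \<longlonglongrightarrow> 1"
  proof (rule tendsto_sandwich[OF _ _ _ tendsto_const])
    show "\<forall>\<^sub>F n in sequentially. 1 - Suc (p n) / N n \<le> L n * Suc (p n) / N n"
      using N1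
    proof eventually_elim
      case (elim n)
      have "real (N n) - real (Suc (p n)) \<le> real (L n * Suc (p n))" using LN_ge[of n] by linarith
      hence "(real (N n) - real (Suc (p n))) / N n \<le> real (L n * Suc (p n)) / N n" by (rule divide_right_mono) simp
      thus ?case using elim by (simp add: diff_divide_distrib del: of_nat_Suc)
    qed
    show "\<forall>\<^sub>F n in sequentially. L n * Suc (p n) / N n \<le> 1"
      using N1
    proof eventually_elim
      case (elim n)
      have "real (L n * Suc (p n)) \<le> N n" using LN_le[of n] by (simp only: of_nat_le_iff)
      hence "real (L n * Suc (p n)) / N n \<le> real (N n) / N n" by (rule divide_right_mono) simp
      thus ?case using elim by simp
    qed
    show "(\<lambda>n. 1 - Suc (p n) / N n) \<longlonglongrightarrow> 1" using tendsto_diff[OF tendsto_const spN] by simp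
  qed
  have LpN: "(\<lambda>n. L n * p n / N n) \<longlonglongrightarrow> 1"
  proof -
    have "(\<lambda>n. L n * Suc (p n) / N n * (1 - 1 / Suc (p n))) \<longlonglongrightarrow> 1 * (1 - 0)"
      by (intro tendsto_mult LspN tendsto_diff tendsto_const ip)
    moreover have "L n * Suc (p n) / N n * (1 - 1 / Suc (p n)) = L n * p n / N n" for n
    proof -
      have "1 - 1 / real (Suc (p n)) = real (p n) / real (Suc (p n))" by (simp add: field_simps)
      moreover have "l * q / c * (P / q) = l * P / c" if "q \<noteq> 0" for l q c P :: real using that by simp
      ultimately show ?thesis by (simp only: of_nat_mult of_nat_eq_0_iff nat.distinct simp_thms)
    qed
    ultimately show ?thesis by (simp only: mult_1 diff_zero)
  qed
  have Lg0: "(\<lambda>n. L n * g0 n) \<longlonglongrightarrow> 0"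
  proof (rule tendsto_sandwich[OF _ _ tendsto_const])
    show "\<forall>\<^sub>F n in sequentially. 0 \<le> L n * g0 n" using g0_nonneg by eventually_elim simp
    show "\<forall>\<^sub>F n in sequentially. L n * g0 n \<le> sqrt (g0 n)"
      using g0_nonneg N1 p_ge
    proof eventually_elim
      case (elim n)
      have "N n * sqrt (g0 n) = sqrt ((N n)\<^sup>2 * g0 n)" by (simp add: real_sqrt_mult)
      also have "\<dots> \<le> sqrt ((N n)\<^sup>2 * g0 n + N n)" by simp
      also have "\<dots> \<le> Suc (p n)" using elim by simp
      finally have "N n * sqrt (g0 n) \<le> Suc (p n)" .
      hence "L n * (N n * sqrt (g0 n)) \<le> real (L n * Suc (p n))" unfolding of_nat_mult by (intro mult_left_mono) auto
      also have "\<dots> \<le> N n" using LN_le[of n] by (simp only: of_nat_le_iff)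
      finally have "L n * sqrt (g0 n) \<le> 1" using elim by (simp add: mult.left_commute[of _ "real (N n)"])
      hence "L n * sqrt (g0 n) * sqrt (g0 n) \<le> 1 * sqrt (g0 n)" using elim by (intro mult_right_mono) auto
      thus ?case using elim by (simp add: mult.assoc)
    qed
    show "(\<lambda>n. sqrt (g0 n)) \<longlonglongrightarrow> 0" using tendsto_real_sqrt[OF g0_lim] by simp
  qed
  have g1_lim: "g1 \<longlonglongrightarrow> 0"
    by (rule Lim_null_comparison[OF _ g0_lim]) (use g1_le in simp)
  have Lg1: "(\<lambda>n. L n * g1 n) \<longlonglongrightarrow> 0"
    by (rule Lim_null_comparison[OF _ Lg0])
       (use g1_le in \<open>eventually_elim, simp add: abs_mult mult_left_mono\<close>)
  define \<tau> where "\<tau> n = g0 n + 2 * g1 n" for n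
  define v where "v n = p n * \<tau> n - 2 * g1 n" for n
  \<comment> \<open>Bounds the variance of any stretch of at most \<open>p n + 1\<close> terms, via
    \<open>|g1| <= g0\<close>. It tends to 0 while \<open>L n * V n\<close> converges, so the block
    tails, of order \<open>L * V^2\<close>, disappear.\<close>
  define V where "V n = Suc (p n) * \<bar>\<tau> n\<bar> + 2 * g0 n" for n
  have s': "(\<lambda>n. N n * \<tau> n) \<longlonglongrightarrow> s" using s by (simp add: \<tau>_def)
  have cancelN: "(\<lambda>n. a n / N n * (N n * b n)) \<longlonglongrightarrow> c \<longleftrightarrow> (\<lambda>n. a n * b n) \<longlonglongrightarrow> c" for a b :: "nat \<Rightarrow> real" and c
    by (rule filterlim_cong[OF refl refl]) (use N1 in \<open>eventually_elim, simp\<close>)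
  have Lv: "(\<lambda>n. L n * v n) \<longlonglongrightarrow> s"
  proof -
    have "(\<lambda>n. L n * p n * \<tau> n) \<longlonglongrightarrow> s"
      using tendsto_mult[OF LpN s'] unfolding cancelN by simp
    from tendsto_diff[OF this tendsto_mult[OF tendsto_const[of 2] Lg1]]
    show ?thesis by (simp add: v_def algebra_simps)
  qed
  have v_lim: "v \<longlonglongrightarrow> 0"
  proof -
    have "(\<lambda>n. p n * \<tau> n) \<longlonglongrightarrow> 0" using tendsto_mult[OF pN s'] unfolding cancelN by simp
    from tendsto_diff[OF this tendsto_mult[OF tendsto_const[of 2] g1_lim]]
    show ?thesis by (simp add: v_def[abs_def])
  qed
  have V_lim: "V \<longlonglongrightarrow> 0"
  proof -
    have "(\<lambda>n. Suc (p n) * \<tau> n) \<longlonglongrightarrow> 0" using tendsto_mult[OF spN s'] unfolding cancelN by simp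
    from tendsto_add[OF tendsto_rabs[OF this] tendsto_mult[OF tendsto_const[of 2] g0_lim]]
    show ?thesis by (simp add: V_def[abs_def] abs_mult)
  qed
  have LV: "(\<lambda>n. L n * V n) \<longlonglongrightarrow> \<bar>s\<bar>"
  proof -
    have "(\<lambda>n. L n * Suc (p n) * \<tau> n) \<longlonglongrightarrow> s" using tendsto_mult[OF LspN s'] unfolding cancelN by simp
    from tendsto_add[OF tendsto_rabs[OF this] tendsto_mult[OF tendsto_const[of 2] Lg0]]
    moreover have "\<bar>L n * Suc (p n) * \<tau> n\<bar> + 2 * (L n * g0 n) = L n * V n" for n
      unfolding V_def of_nat_mult by (simp add: abs_mult distrib_left mult.assoc mult.left_commute del: of_nat_Suc)
    ultimately show ?thesis by simp
  qed
  have v_nonneg: "\<forall>\<^sub>F n in sequentially. 0 \<le> v n"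
    using dep g0 g1 p_ge
  proof eventually_elim
    case (elim n)
    then interpret one_dependent M "m n" "\<eta> n" by simp
    have "(\<integral>x. (\<Sum>i=0..<p n. \<eta> n i x)\<^sup>2 \<partial>S) = v n"
      using variance_sum_eq[of "g0 n" "g1 n" 0 "p n"] elim by (simp add: v_def \<tau>_def)
    thus ?case by (metis integral_nonneg_AE AE_I2 zero_le_power2)
  qed
  have main: "\<forall>\<^sub>F n in sequentially. cmod ((CLINT x|S. iexp (\<Sum>i<N n. \<eta> n i x)) - exp (- (L n * v n) / 2)) < t * (2 / 3 * (s + 1)) + t"
    if t: "t > 0" for t
  proof -
    \<comment> \<open>\<open>t / 16\<close> is the largest truncation level that
      \<open>char_sum_bound\<close> admits for the given \<open>t\<close>; \<open>t\<close> becomes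
      small only after \<open>n\<close> has become large.\<close>
    define l where "l = lam (t / 16)"
    have l_N: "(\<lambda>n. N n * l n) \<longlonglongrightarrow> 0" unfolding l_def using lam t by simp
    have pl: "(\<lambda>n. p n * l n) \<longlonglongrightarrow> 0" using tendsto_mult[OF pN l_N] unfolding cancelN by simp
    have Lpl: "(\<lambda>n. L n * p n * l n) \<longlonglongrightarrow> 0" using tendsto_mult[OF LpN l_N] unfolding cancelN by simp
    define W where "W n = 2 * V n + 6 * p n * l n" for n
    have W_lim: "W \<longlonglongrightarrow> 0"
      using tendsto_add[OF tendsto_mult[OF tendsto_const[of 2] V_lim] tendsto_mult[OF tendsto_const[of 6] pl]]
      by (simp add: W_def[abs_def] mult.assoc)
    have LW: "(\<lambda>n. L n * W n) \<longlonglongrightarrow> 2 * \<bar>s\<bar>"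
      using tendsto_add[OF tendsto_mult[OF tendsto_const[of 2] LV] tendsto_mult[OF tendsto_const[of 6] Lpl]]
      by (simp add: W_def[abs_def] algebra_simps)
    let ?E = "\<lambda>n. sqrt (L n * g0 n) + sqrt (V n) + L n * v n * v n + (288 / t\<^sup>2 * (L n * W n * W n) + 12 * (L n * p n * l n))"
    have "?E \<longlonglongrightarrow> sqrt 0 + sqrt 0 + s * 0 + (288 / t\<^sup>2 * (2 * \<bar>s\<bar> * 0) + 12 * 0)"
      by (intro tendsto_add tendsto_mult tendsto_const tendsto_real_sqrt Lg0 V_lim Lv v_lim LW W_lim Lpl)
    hence E: "\<forall>\<^sub>F n in sequentially. ?E n < t"
      using order_tendstoD(2)[of ?E 0 sequentially t] t by simp
    have s1: "\<forall>\<^sub>F n in sequentially. L n * v n < s + 1" using order_tendstoD(2)[OF Lv, of "s + 1"] by simp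
    have v4: "\<forall>\<^sub>F n in sequentially. v n < 4" using order_tendstoD(2)[OF v_lim, of 4] by simp
    have Wt: "\<forall>\<^sub>F n in sequentially. 32 * W n < t\<^sup>2"
      using order_tendstoD(2)[OF tendsto_mult[OF tendsto_const[of 32] W_lim], of "t\<^sup>2"] t by simp
    have tl: "\<forall>\<^sub>F n in sequentially. \<forall>i. (\<integral>x. (\<eta> n i x)\<^sup>2 * (if \<bar>\<eta> n i x\<bar> > t / 16 then 1 else 0) \<partial>S) \<le> l n"
      unfolding l_def using tail[of "t / 16"] t by simp
    show ?thesis
      using E s1 v4 Wt tl dep g0 g1 p_ge v_nonneg g1_le
    proof eventually_elim
      case (elim n)
      then interpret one_dependent M "m n" "\<eta> n" by simp
      have gg: "\<And>i. (\<integral>x. (\<eta> n i x)\<^sup>2 \<partial>S) = g0 n" "\<And>i. (\<integral>x. \<eta> n i x * \<eta> n (Suc i) x \<partial>S) = g1 n" using elim by auto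
      have V: "(\<integral>x. (\<Sum>i=a..<b. \<eta> n i x)\<^sup>2 \<partial>S) \<le> V n" if "a \<le> b" "b \<le> a + Suc (p n)" for a b
        proof (cases "a < b")
          case True
          have "(\<integral>x. (\<Sum>i=a..<b. \<eta> n i x)\<^sup>2 \<partial>S) = real (b - a) * \<tau> n - 2 * g1 n"
            using variance_sum_eq[OF gg True] by (simp add: \<tau>_def)
          also have "\<dots> \<le> real (b - a) * \<bar>\<tau> n\<bar> + 2 * g0 n"
          proof -
            have "\<bar>g1 n\<bar> \<le> g0 n" using elim by blast
            moreover have "real (b - a) * \<tau> n \<le> real (b - a) * \<bar>\<tau> n\<bar>" by (intro mult_left_mono) auto
            ultimately show ?thesis by linarith
          qed
          also have "real (b - a) * \<bar>\<tau> n\<bar> \<le> Suc (p n) * \<bar>\<tau> n\<bar>"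
            using that by (intro mult_right_mono) auto
          hence "real (b - a) * \<bar>\<tau> n\<bar> + 2 * g0 n \<le> V n" unfolding V_def by simp
          finally show ?thesis .
        next
          case False
          have "\<bar>g1 n\<bar> \<le> g0 n" using elim by blast
          hence "0 \<le> g0 n" by linarith
          thus ?thesis using False by (simp add: V_def)
        qed
      have tl: "\<And>i. (\<integral>x. (\<eta> n i x)\<^sup>2 * (if \<bar>\<eta> n i x\<bar> > t / 16 then 1 else 0) \<partial>S) \<le> l n"
        using elim by blast
      have "32 * (2 * V n + 6 * p n * l n) \<le> t\<^sup>2" using elim by (simp add: W_def)
      moreover have p1: "p n \<ge> 1" and v4: "v n \<le> 4" using elim by auto
      moreover have veq: "v n = p n * (g0 n + 2 * g1 n) - 2 * g1 n" by (simp add: v_def \<tau>_def)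
      ultimately have bound: "cmod ((CLINT x|S. iexp (\<Sum>i<N n. \<eta> n i x)) - (1 - v n / 2) ^ L n)
        \<le> sqrt (L n * g0 n) + sqrt (V n) + L n * (4 * t / 6 * v n + (288 * (W n)\<^sup>2 / t\<^sup>2 + 12 * p n * l n))"
        using char_sum_bound[OF gg tl V _ t _ _ p1 veq v4 L_def] t by (simp add: W_def)
      have bound2: "cmod ((1 - v n / 2) ^ L n - exp (- (L n * v n) / 2)) \<le> L n * v n * v n"
      proof -
        have "cmod (complex_of_real ((1 - v n / 2) ^ L n - exp (- (L n * v n) / 2))) \<le> L n * v n * v n"
          unfolding norm_of_real using power_one_minus_exp_le[of "v n" "L n"] elim by simp
        thus ?thesis by (simp add: exp_of_real)
      qed
      have "cmod ((CLINT x|S. iexp (\<Sum>i<N n. \<eta> n i x)) - exp (- (L n * v n) / 2))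
        \<le> sqrt (L n * g0 n) + sqrt (V n) + L n * (4 * t / 6 * v n + (288 * (W n)\<^sup>2 / t\<^sup>2 + 12 * p n * l n)) + L n * v n * v n"
        using norm_triangle_mono[OF bound bound2] by simp
      also have "\<dots> = ?E n + t * (2 / 3 * (L n * v n))"
        by (simp add: algebra_simps power2_eq_square)
      also have "\<dots> < t + t * (2 / 3 * (s + 1))" using elim t by (intro add_less_le_mono mult_left_mono) auto
      finally show ?case by simp
    qed
  qed
  have s0: "0 \<le> s"
  proof (rule tendsto_lowerbound[OF Lv])
    show "\<forall>\<^sub>F n in sequentially. 0 \<le> L n * v n" using v_nonneg by eventually_elim simp
  qed simp
  have "(\<lambda>n. (CLINT x|S. iexp (\<Sum>i<N n. \<eta> n i x)) - exp (- (L n * v n) / 2)) \<longlonglongrightarrow> 0"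
  proof (rule tendstoI)
    fix e :: real assume "e > 0"
    define t where "t = e / (2 / 3 * (s + 1) + 1)"
    have d: "2 / 3 * (s + 1) + 1 > 0" using s0 by (simp add: field_simps)
    have "t > 0" using \<open>e > 0\<close> d by (simp add: t_def)
    from main[OF this] show "\<forall>\<^sub>F n in sequentially. dist ((CLINT x|S. iexp (\<Sum>i<N n. \<eta> n i x)) - exp (- (L n * v n) / 2)) 0 < e"
    proof eventually_elim
      case (elim n)
      have "t * (2 / 3 * (s + 1)) + t = t * (2 / 3 * (s + 1) + 1)" by (simp add: algebra_simps)
      also have "\<dots> = e" using d by (simp add: t_def)
      finally show ?case using elim by (simp add: dist_norm)
    qed
  qed
  moreover have "(\<lambda>n. exp (- (L n * v n) / 2)) \<longlonglongrightarrow> exp (- s / 2)"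
    by (intro tendsto_intros Lv) auto
  hence "(\<lambda>n. complex_of_real (exp (- (L n * v n) / 2))) \<longlonglongrightarrow> complex_of_real (exp (- s / 2))"
    by (rule tendsto_of_real)
  ultimately have "(\<lambda>n. (CLINT x|S. iexp (\<Sum>i<N n. \<eta> n i x)) - exp (- (L n * v n) / 2)
      + complex_of_real (exp (- (L n * v n) / 2))) \<longlonglongrightarrow> 0 + complex_of_real (exp (- s / 2))"
    by (rule tendsto_add)
  thus ?thesis by simp
qed

section \<open>Real sequences with iid exponential or uniform entries\<close>

abbreviation seqs :: "(nat \<Rightarrow> real) measure" where
  "seqs \<equiv> PiM UNIV (\<lambda>_. borel)"

lemma space_seqs [simp]: "space seqs = UNIV"
  by (simp add: space_PiM)

lemma measurable_seqsI:
  assumes "\<And>i. (\<lambda>x. f x i) \<in> borel_measurable M"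
  shows "f \<in> measurable M seqs"
  by (rule measurable_PiM_single') (use assms in auto)

lemma measurable_seqs_component [measurable (raw)]:
  "f \<in> measurable M seqs \<Longrightarrow> (\<lambda>x. f x i) \<in> borel_measurable M"
  by (rule measurable_compose[OF _ measurable_component_singleton]) auto

text \<open>Finite vectors are represented by sequences that vanish from index \<open>n\<close> on,
  so that vectors of all lengths live in the one measurable space \<open>seqs\<close>.\<close>

definition trunc :: "nat \<Rightarrow> (nat \<Rightarrow> real) \<Rightarrow> nat \<Rightarrow> real" where
  "trunc n x = (\<lambda>i. if i < n then x i else 0)"

definition psum :: "nat \<Rightarrow> (nat \<Rightarrow> real) \<Rightarrow> real" where
  "psum n x = (\<Sum>i<n. x i)"

lemma measurable_trunc [measurable (raw)]:
  "f \<in> measurable M seqs \<Longrightarrow> (\<lambda>x. trunc n (f x)) \<in> measurable M seqs"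
  by (rule measurable_seqsI) (simp add: trunc_def)

lemma measurable_psum [measurable (raw)]:
  "f \<in> measurable M seqs \<Longrightarrow> (\<lambda>x. psum n (f x)) \<in> borel_measurable M"
  unfolding psum_def by measurable

lemma measurable_case_nat_seqs [measurable (raw)]:
  "f \<in> borel_measurable M \<Longrightarrow> g \<in> measurable M seqs \<Longrightarrow> (\<lambda>x. case_nat (f x) (g x)) \<in> measurable M seqs"
  by (rule measurable_case_nat') 

lemma psum_case_nat: "psum (Suc n) (case_nat b x) = b + psum n x"
  unfolding psum_def by (subst sum.lessThan_Suc_shift) simp

lemma trunc_case_nat: "trunc (Suc n) (case_nat b x) = case_nat b (trunc n x)"
  by (auto simp: trunc_def fun_eq_iff split: nat.split)

lemma depends_on_trunc: "depends_on {..<k} F \<Longrightarrow> k \<le> n \<Longrightarrow> F (trunc n x) = F x"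
  by (rule depends_onD[of "{..<k}"]) (auto simp: trunc_def)

lemma depends_on_psum: "depends_on {..<k} (psum k)"
  by (rule depends_onI) (simp add: psum_def)

locale real_sequence_space = sequence_space M for M :: "real measure" +
  assumes sets_M [measurable_cong]: "sets M = sets borel"
begin

lemma sets_S [measurable_cong]: "sets S = sets seqs"
  by (rule sets_PiM_cong) (auto simp: sets_M)

lemma space_S [simp]: "space S = UNIV"
  using sets_eq_imp_space_eq[OF sets_S] by simp

lemma space_M [simp]: "space M = UNIV"
  using sets_eq_imp_space_eq[OF sets_M] by simp

lemma nn_integral_case_nat:
  assumes [measurable]: "F \<in> borel_measurable seqs"
  shows "(\<integral>\<^sup>+x. F x \<partial>S) = (\<integral>\<^sup>+b. (\<integral>\<^sup>+x. F (case_nat b x) \<partial>S) \<partial>M)"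
proof -
  have "(\<integral>\<^sup>+x. F x \<partial>S) = (\<integral>\<^sup>+x. F x \<partial>distr (M \<Otimes>\<^sub>M S) S (\<lambda>(s, \<omega>). case_nat s \<omega>))"
    by (simp only: PiM_iter)
  also have "\<dots> = (\<integral>\<^sup>+p. F (case_nat (fst p) (snd p)) \<partial>(M \<Otimes>\<^sub>M S))"
    by (subst nn_integral_distr) (simp_all add: split_beta')
  also have "\<dots> = (\<integral>\<^sup>+b. (\<integral>\<^sup>+x. F (case_nat b x) \<partial>S) \<partial>M)"
    by (subst P.nn_integral_fst[symmetric]) simp_all
  finally show ?thesis .
qed

lemma nn_integral_comb_seq:
  assumes [measurable]: "F \<in> borel_measurable seqs"
  shows "(\<integral>\<^sup>+x. F x \<partial>S) = (\<integral>\<^sup>+x. (\<integral>\<^sup>+y. F (comb_seq k x y) \<partial>S) \<partial>S)"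
proof -
  have "(\<integral>\<^sup>+x. F x \<partial>S) = (\<integral>\<^sup>+x. F x \<partial>distr (S \<Otimes>\<^sub>M S) S (\<lambda>(x, y). comb_seq k x y))"
    by (simp only: PiM_comb_seq)
  also have "\<dots> = (\<integral>\<^sup>+p. F (comb_seq k (fst p) (snd p)) \<partial>(S \<Otimes>\<^sub>M S))"
    by (subst nn_integral_distr) (simp_all add: split_beta')
  also have "\<dots> = (\<integral>\<^sup>+x. (\<integral>\<^sup>+y. F (comb_seq k x y) \<partial>S) \<partial>S)"
    by (subst P.nn_integral_fst[symmetric]) simp_all
  finally show ?thesis .
qed

text \<open>Supplies the exchangeability behind sorting and behind cyclic shifts.\<close>

lemma distr_permute:
  assumes "inj p"
  shows "distr S S (\<lambda>x i. x (p i)) = S"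
proof -
  have "distr (PiM UNIV (\<lambda>_. M)) (PiM UNIV (\<lambda>_. M)) (\<lambda>\<omega>. \<lambda>n\<in>UNIV. \<omega> (p n)) = PiM UNIV (\<lambda>_. M)"
    by (rule distr_PiM_reindex[where K = UNIV and M = "\<lambda>_. M"]) (use assms M.prob_space_axioms in auto)
  thus ?thesis by (simp add: restrict_UNIV)
qed

lemma nn_integral_permute:
  assumes [measurable]: "F \<in> borel_measurable seqs" and "inj p"
  shows "(\<integral>\<^sup>+x. F (\<lambda>i. x (p i)) \<partial>S) = (\<integral>\<^sup>+x. F x \<partial>S)"
proof -
  have [measurable]: "(\<lambda>x i. x (p i)) \<in> measurable S S"
    unfolding measurable_cong_sets[OF refl sets_S] by (rule measurable_seqsI) simp
  have "(\<integral>\<^sup>+x. F x \<partial>S) = (\<integral>\<^sup>+x. F x \<partial>distr S S (\<lambda>x i. x (p i)))"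
    by (simp only: distr_permute[OF assms(2)])
  also have "\<dots> = (\<integral>\<^sup>+x. F (\<lambda>i. x (p i)) \<partial>S)"
    by (subst nn_integral_distr) simp_all
  finally show ?thesis by simp
qed

end

abbreviation expo :: "real measure" where
  "expo \<equiv> density lborel (exponential_density 1)"

definition unif :: "real \<Rightarrow> real measure" where
  "unif c = density lborel (\<lambda>x. ennreal (indicator {0..c} x / c))"

lemma real_sequence_spaceI:
  "prob_space M \<Longrightarrow> sets M = sets borel \<Longrightarrow> real_sequence_space M"
  unfolding real_sequence_space_def real_sequence_space_axioms_def sequence_space_def
  by (auto intro: product_prob_spaceI)

lemma prob_space_unif: "c > 0 \<Longrightarrow> prob_space (unif c)"
proof
  assume "c > 0"
  have "emeasure (unif c) (space (unif c)) = (\<integral>\<^sup>+x. ennreal (1 / c) * indicator {0..c} x \<partial>lborel)"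
    unfolding unif_def by (subst emeasure_density) (auto intro!: nn_integral_cong simp: indicator_def)
  also have "\<dots> = 1"
    using \<open>c > 0\<close> by (subst nn_integral_cmult_indicator) (auto simp flip: ennreal_mult')
  finally show "emeasure (unif c) (space (unif c)) = 1" .
qed

interpretation E: real_sequence_space expo
  by (rule real_sequence_spaceI) (auto simp: prob_space_exponential_density)

lemma unif_sequence_space: "c > 0 \<Longrightarrow> real_sequence_space (unif c)"
  by (rule real_sequence_spaceI, rule prob_space_unif) (simp_all add: unif_def)

abbreviation "expo_seq \<equiv> E.S"

lemma AE_expo_seq_nonneg: "AE x in expo_seq. \<forall>i. x i \<ge> 0"
proof -
  have "AE x in expo. x \<ge> 0"
    by (subst AE_density) (auto simp: exponential_density_def)
  hence "AE x in expo_seq. x i \<ge> 0" for i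
    using AE_PiM_component[of UNIV "\<lambda>_. expo" i "\<lambda>x. x \<ge> 0"] E.M.prob_space_axioms by auto
  thus ?thesis by (simp add: AE_all_countable)
qed

lemma AE_psum_nonneg: "AE x in expo_seq. \<forall>n. psum n x \<ge> 0"
  using AE_expo_seq_nonneg by eventually_elim (simp add: psum_def sum_nonneg)

lemma nn_integral_expo_case_nat:
  assumes [measurable]: "F \<in> borel_measurable seqs"
  shows "(\<integral>\<^sup>+x. F x \<partial>expo_seq) = (\<integral>\<^sup>+b. ennreal (exp (- b)) * indicator {0..} b * (\<integral>\<^sup>+x. F (case_nat b x) \<partial>expo_seq) \<partial>lborel)"
proof -
  have [measurable]: "(\<lambda>b. \<integral>\<^sup>+x. F (case_nat b x) \<partial>expo_seq) \<in> borel_measurable borel" by measurable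
  have "(\<integral>\<^sup>+x. F x \<partial>expo_seq) = (\<integral>\<^sup>+b. (\<integral>\<^sup>+x. F (case_nat b x) \<partial>expo_seq) \<partial>expo)"
    by (rule E.nn_integral_case_nat[OF assms])
  also have "\<dots> = (\<integral>\<^sup>+b. ennreal (exponential_density 1 b) * (\<integral>\<^sup>+x. F (case_nat b x) \<partial>expo_seq) \<partial>lborel)"
    by (rule nn_integral_density) simp_all
  also have "\<dots> = (\<integral>\<^sup>+b. ennreal (exp (- b)) * indicator {0..} b * (\<integral>\<^sup>+x. F (case_nat b x) \<partial>expo_seq) \<partial>lborel)"
  proof (rule nn_integral_cong)
    fix b :: real
    have "ennreal (exponential_density 1 b) = ennreal (exp (- b)) * indicator {0..} b"
      by (simp add: exponential_density_def indicator_def)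
    thus "ennreal (exponential_density 1 b) * (\<integral>\<^sup>+x. F (case_nat b x) \<partial>expo_seq)
      = ennreal (exp (- b)) * indicator {0..} b * (\<integral>\<^sup>+x. F (case_nat b x) \<partial>expo_seq)" by simp
  qed
  finally show ?thesis .
qed

lemma nn_integral_unif_case_nat:
  assumes [measurable]: "F \<in> borel_measurable seqs" and "c > 0"
  shows "(\<integral>\<^sup>+x. F x \<partial>PiM UNIV (\<lambda>_. unif c)) =
    ennreal (1 / c) * (\<integral>\<^sup>+b. indicator {0..c} b * (\<integral>\<^sup>+x. F (case_nat b x) \<partial>PiM UNIV (\<lambda>_. unif c)) \<partial>lborel)"
proof -
  interpret U: real_sequence_space "unif c" by (rule unif_sequence_space) fact
  have [measurable]: "(\<lambda>b. \<integral>\<^sup>+x. F (case_nat b x) \<partial>U.S) \<in> borel_measurable borel" by measurable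
  have "(\<integral>\<^sup>+x. F x \<partial>U.S) = (\<integral>\<^sup>+b. (\<integral>\<^sup>+x. F (case_nat b x) \<partial>U.S) \<partial>unif c)"
    by (rule U.nn_integral_case_nat[OF assms(1)])
  also have "\<dots> = (\<integral>\<^sup>+b. ennreal (indicator {0..c} b / c) * (\<integral>\<^sup>+x. F (case_nat b x) \<partial>U.S) \<partial>lborel)"
    unfolding unif_def by (rule nn_integral_density) (simp_all flip: unif_def)
  also have "\<dots> = (\<integral>\<^sup>+b. ennreal (1 / c) * (indicator {0..c} b * (\<integral>\<^sup>+x. F (case_nat b x) \<partial>U.S)) \<partial>lborel)"
    by (intro nn_integral_cong) (auto simp: indicator_def)
  also have "\<dots> = ennreal (1 / c) * (\<integral>\<^sup>+b. indicator {0..c} b * (\<integral>\<^sup>+x. F (case_nat b x) \<partial>U.S) \<partial>lborel)"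
    by (rule nn_integral_cmult) simp
  finally show ?thesis .
qed

section \<open>Order statistics of a uniform sample\<close>

definition incr :: "real \<Rightarrow> nat \<Rightarrow> (nat \<Rightarrow> real) \<Rightarrow> bool" where
  "incr a n y \<longleftrightarrow> (\<forall>i<n. case_nat a y i < y i)"

lemma incr_0: "incr a 0 y" by (simp add: incr_def)

lemma incr_case_nat: "incr a (Suc n) (case_nat b y) \<longleftrightarrow> a < b \<and> incr b n y"
  unfolding incr_def by (simp add: All_less_Suc2)

lemma measurable_incr [measurable]: "Measurable.pred seqs (incr a n)"
proof -
  have "(\<lambda>y. case_nat a y i) \<in> borel_measurable seqs" for i by (cases i) simp_all
  thus ?thesis unfolding incr_def by measurable
qed

text \<open>Induction that peels off the first point \<open>b\<close>; the others form an increasing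
  sample started at \<open>b\<close>. In terms of the increments the uniform density is constant,
  and relative to independent exponentials a constant density is the factor
  \<open>exp (psum n x)\<close> on the event that the sum stays within range.\<close>

lemma increasing_points_law:
  assumes "c > 0" "0 \<le> a" "a \<le> c" and F: "F \<in> borel_measurable seqs"
  shows "(\<integral>\<^sup>+y. F (trunc n y) * indicator {y. incr a n y} y \<partial>PiM UNIV (\<lambda>_. unif c)) =
    ennreal (1 / c ^ n) * (\<integral>\<^sup>+x. F (trunc n (\<lambda>i. a + psum (Suc i) x)) * (ennreal (exp (psum n x)) * indicator {x. a + psum n x \<le> c} x) \<partial>expo_seq)"
  using assms(2-)
proof (induction n arbitrary: a F)
  case 0
  interpret U: real_sequence_space "unif c" by (rule unif_sequence_space) fact
  show ?case using 0 by (simp add: incr_0 psum_def trunc_def U.P.emeasure_space_1[simplified] E.P.emeasure_space_1[simplified])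
next
  case (Suc n)
  note [measurable] = Suc.prems(3)
  interpret U: real_sequence_space "unif c" by (rule unif_sequence_space) fact
  define H where "H b = (\<integral>\<^sup>+x. F (case_nat b (trunc n (\<lambda>i. b + psum (Suc i) x))) *
      (ennreal (exp (psum n x)) * indicator {x. b + psum n x \<le> c} x) \<partial>expo_seq)" for b
  have [measurable]: "(\<lambda>p. trunc n (\<lambda>i. fst p + psum (Suc i) (snd p))) \<in> measurable (borel \<Otimes>\<^sub>M seqs) seqs"
    by (rule measurable_seqsI) (simp add: trunc_def)
  have [measurable]: "(\<lambda>(b, x). F (case_nat b (trunc n (\<lambda>i. b + psum (Suc i) x))) *
      (ennreal (exp (psum n x)) * indicator {x. b + psum n x \<le> c} x)) \<in> borel_measurable (borel \<Otimes>\<^sub>M seqs)"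
    unfolding indicator_def mem_Collect_eq split_beta' by measurable
  have [measurable]: "(\<lambda>x. trunc n (\<lambda>i. b + psum (Suc i) x)) \<in> measurable seqs seqs" for b
    by (rule measurable_seqsI) (simp add: trunc_def)
  have mH: "(\<lambda>x. F (case_nat b (trunc n (\<lambda>i. b + psum (Suc i) x))) *
      (ennreal (exp (psum n x)) * indicator {x. b + psum n x \<le> c} x)) \<in> borel_measurable expo_seq" for b
    unfolding indicator_def mem_Collect_eq by measurable
  have [measurable]: "H \<in> borel_measurable borel"
    unfolding H_def using E.P.borel_measurable_nn_integral[of "\<lambda>b x. F (case_nat b (trunc n (\<lambda>i. b + psum (Suc i) x))) *
      (ennreal (exp (psum n x)) * indicator {x. b + psum n x \<le> c} x)" borel] by simp
  have "(\<integral>\<^sup>+y. F (trunc (Suc n) y) * indicator {y. incr a (Suc n) y} y \<partial>U.S) =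
      ennreal (1 / c) * (\<integral>\<^sup>+b. indicator {0..c} b * (\<integral>\<^sup>+y. F (case_nat b (trunc n y)) * (indicator {a<..} b * indicator {y. incr b n y} y) \<partial>U.S) \<partial>lborel)"
    by (subst nn_integral_unif_case_nat)
       (auto simp: assms(1) trunc_case_nat incr_case_nat indicator_def intro!: arg_cong[where f = "(*) _"] nn_integral_cong)
  also have "\<dots> = ennreal (1 / c) * (\<integral>\<^sup>+b. ennreal (1 / c ^ n) * (indicator {0..c} b * indicator {a<..} b * H b) \<partial>lborel)"
  proof (intro arg_cong[where f = "(*) _"] nn_integral_cong)
    fix b
    have "(\<integral>\<^sup>+y. F (case_nat b (trunc n y)) * (indicator {a<..} b * indicator {y. incr b n y} y) \<partial>U.S)
        = indicator {a<..} b * (\<integral>\<^sup>+y. F (case_nat b (trunc n y)) * indicator {y. incr b n y} y \<partial>U.S)"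
      by (subst nn_integral_cmult[symmetric]) (auto simp: mult_ac)
    also have "indicator {0..c} b * \<dots> = ennreal (1 / c ^ n) * (indicator {0..c} b * indicator {a<..} b * H b)"
    proof (cases "b \<in> {0..c}")
      case True
      thus ?thesis using Suc.IH[of b "\<lambda>y. F (case_nat b y)"] by (simp add: H_def mult_ac)
    qed simp
    finally show "indicator {0..c} b * (\<integral>\<^sup>+y. F (case_nat b (trunc n y)) * (indicator {a<..} b * indicator {y. incr b n y} y) \<partial>U.S)
      = ennreal (1 / c ^ n) * (indicator {0..c} b * indicator {a<..} b * H b)" .
  qed
  also have "\<dots> = ennreal (1 / c ^ Suc n) * (\<integral>\<^sup>+b. indicator {0..c} b * indicator {a<..} b * H b \<partial>lborel)"
    using assms(1) by (subst nn_integral_cmult) (auto simp: mult.assoc[symmetric] simp flip: ennreal_mult')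
  also have "(\<integral>\<^sup>+b. indicator {0..c} b * indicator {a<..} b * H b \<partial>lborel) = (\<integral>\<^sup>+z. indicator {0..} z * H (a + z) \<partial>lborel)"
  proof -
    have "(\<integral>\<^sup>+b. indicator {0..c} b * indicator {a<..} b * H b \<partial>lborel) = (\<integral>\<^sup>+z. indicator {0..c} (a + z) * indicator {a<..} (a + z) * H (a + z) \<partial>lborel)"
      by (subst nn_integral_real_affine[where c = 1 and t = a]) auto
    also have "\<dots> = (\<integral>\<^sup>+z. indicator {0..} z * H (a + z) \<partial>lborel)"
    proof (rule nn_integral_cong_AE)
      \<comment> \<open>A start beyond \<open>c\<close> is impossible because the increments are
        almost surely nonnegative; this removes the upper limit of integration.\<close>
      have H0: "H b = 0" if "b > c" for b
      proof -
        have "AE x in expo_seq. F (case_nat b (trunc n (\<lambda>i. b + psum (Suc i) x))) * (ennreal (exp (psum n x)) * indicator {x. b + psum n x \<le> c} x) = 0"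
          using AE_psum_nonneg
        proof eventually_elim
          case (elim x)
          thus ?case using that by (auto simp: indicator_def not_le add_strict_increasing2 dest: spec[of _ n])
        qed
        thus ?thesis unfolding H_def by (subst nn_integral_cong_AE[where v = "\<lambda>_. 0"]) auto
      qed
      \<comment> \<open>\<open>incr\<close> is strict whereas increments range over [0, oo); the two
        conditions differ only at the null point 0.\<close>
      have "AE z in lborel. z \<noteq> (0::real)" by (rule AE_lborel_singleton)
      thus "AE z in lborel. indicator {0..c} (a + z) * indicator {a<..} (a + z) * H (a + z) = indicator {0..} z * H (a + z)"
      proof eventually_elim
        case (elim z)
        thus ?case using H0[of "a + z"] Suc.prems(1) by (auto simp: indicator_def)
      qed
    qed
    finally show ?thesis .
  qed
  also have "\<dots> = (\<integral>\<^sup>+x. F (trunc (Suc n) (\<lambda>i. a + psum (Suc i) x)) * (ennreal (exp (psum (Suc n) x)) * indicator {x. a + psum (Suc n) x \<le> c} x) \<partial>expo_seq)"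
  proof -
    have [measurable]: "(\<lambda>x. trunc (Suc n) (\<lambda>i. a + psum (Suc i) x)) \<in> measurable seqs seqs"
      by (rule measurable_seqsI) (simp add: trunc_def)
    have mF: "(\<lambda>x. F (trunc (Suc n) (\<lambda>i. a + psum (Suc i) x)) * (ennreal (exp (psum (Suc n) x)) * indicator {x. a + psum (Suc n) x \<le> c} x)) \<in> borel_measurable seqs"
      unfolding indicator_def mem_Collect_eq
      by (intro borel_measurable_times_ennreal measurable_compose[OF _ Suc.prems(3)]) measurable
    have eq: "trunc (Suc n) (\<lambda>i. a + z + psum i x) = case_nat (a + z) (trunc n (\<lambda>i. a + z + psum (Suc i) x))" for z x
      by (auto simp: trunc_def fun_eq_iff split: nat.split) (simp add: psum_def)
    have "(\<integral>\<^sup>+x. F (trunc (Suc n) (\<lambda>i. a + psum (Suc i) x)) * (ennreal (exp (psum (Suc n) x)) * indicator {x. a + psum (Suc n) x \<le> c} x) \<partial>expo_seq)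
      = (\<integral>\<^sup>+z. ennreal (exp (- z)) * indicator {0..} z * (\<integral>\<^sup>+x. F (case_nat (a + z) (trunc n (\<lambda>i. a + z + psum (Suc i) x))) * (ennreal (exp (z + psum n x)) * indicator {x. a + z + psum n x \<le> c} x) \<partial>expo_seq) \<partial>lborel)"
      by (subst nn_integral_expo_case_nat[OF mF])
         (simp only: eq psum_case_nat indicator_def mem_Collect_eq add.assoc[symmetric])
    also have "\<dots> = (\<integral>\<^sup>+z. indicator {0..} z * H (a + z) \<partial>lborel)"
    proof (intro nn_integral_cong)
      fix z
      have "(\<integral>\<^sup>+x. F (case_nat (a + z) (trunc n (\<lambda>i. a + z + psum (Suc i) x))) * (ennreal (exp (z + psum n x)) * indicator {x. a + z + psum n x \<le> c} x) \<partial>expo_seq)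
        = ennreal (exp z) * H (a + z)"
        unfolding H_def by (subst nn_integral_cmult[symmetric, OF mH])
          (auto simp: exp_add ennreal_mult' mult_ac intro!: nn_integral_cong)
      moreover have "ennreal (exp (- z)) * ennreal (exp z) = 1"
        by (simp flip: ennreal_mult' exp_add)
      ultimately show "ennreal (exp (- z)) * indicator {0..} z * (\<integral>\<^sup>+x. F (case_nat (a + z) (trunc n (\<lambda>i. a + z + psum (Suc i) x))) * (ennreal (exp (z + psum n x)) * indicator {x. a + z + psum n x \<le> c} x) \<partial>expo_seq)
        = indicator {0..} z * H (a + z)"
        by (metis (no_types, lifting) mult.assoc mult.commute mult.left_neutral)
    qed
    finally show ?thesis by simp
  qed
  finally show ?case .
qed

definition svec :: "nat \<Rightarrow> (nat \<Rightarrow> real) \<Rightarrow> nat \<Rightarrow> real" where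
  "svec n y = trunc n (\<lambda>i. sort (map y [0..<n]) ! i)"

lemma sort_permutation:
  obtains p where "p permutes {..<n}" "sort (map y [0..<n]) = map (\<lambda>i. y (p i)) [0..<n]"
proof -
  obtain p where p: "p permutes {..<n}" "permute_list p (map y [0..<n]) = sort (map y [0..<n])"
    using mset_eq_permutation[of "sort (map y [0..<n])" "map y [0..<n]"] by auto
  have "p i < n" if "i < n" for i using permutes_in_image[OF p(1), of i] that by simp
  hence "permute_list p (map y [0..<n]) = map (\<lambda>i. y (p i)) [0..<n]"
    by (simp add: permute_list_def)
  thus ?thesis using that p by simp
qed

lemma sort_permutation_unique:
  assumes "p permutes {..<n}" "sorted (map (\<lambda>i. y (p i)) [0..<n])"
  shows "sort (map y [0..<n]) = map (\<lambda>i. y (p i)) [0..<n]"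
proof -
  have "p i < n" if "i < n" for i using permutes_in_image[OF assms(1), of i] that by simp
  hence eq: "permute_list p (map y [0..<n]) = map (\<lambda>i. y (p i)) [0..<n]"
    by (simp add: permute_list_def)
  show ?thesis
    using mset_permute_list[of p "map y [0..<n]"] assms eq by (intro properties_for_sort) auto
qed

lemma svec_permutation:
  assumes "sort (map y [0..<n]) = map (\<lambda>i. y (p i)) [0..<n]"
  shows "svec n y = trunc n (\<lambda>i. y (p i))"
  by (simp add: svec_def assms trunc_def fun_eq_iff)

lemma sets_le_coordinates: "{y :: nat \<Rightarrow> real. y i \<le> y j} \<in> sets seqs"
proof -
  have [measurable]: "(\<lambda>y. y k) \<in> borel_measurable seqs" for k :: nat
    by (rule measurable_component_singleton) simp
  have "{y \<in> space seqs. y i \<le> y j} \<in> sets seqs" by measurable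
  thus ?thesis by simp
qed

text \<open>Sorting is a permutation of coordinates on each of finitely many measurable pieces, one
  for each permutation that may sort the sample, and these pieces cover the space.\<close>

lemma measurable_svec [measurable]: "svec n \<in> measurable seqs seqs"
proof (rule measurable_piecewise_restrict)
  let ?A = "\<lambda>p. {y. \<forall>i<n. \<forall>j<n. i \<le> j \<longrightarrow> y (p i) \<le> (y (p j) :: real)}"
  let ?C = "?A ` {p. p permutes {..<n}}"
  show "countable ?C" by (intro countable_image countable_finite finite_permutations) simp
  have srt: "y \<in> ?A p \<longleftrightarrow> sorted (map (\<lambda>i. y (p i)) [0..<n])" for y :: "nat \<Rightarrow> real" and p
    by (auto simp: sorted_iff_nth_mono)
  show "\<Omega> \<inter> space seqs \<in> sets seqs" if "\<Omega> \<in> ?C" for \<Omega>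
  proof -
    from that obtain p where p: "\<Omega> = ?A p" by (rule imageE)
    define B where "B i j = (if i \<le> j then {y :: nat \<Rightarrow> real. y (p i) \<le> y (p j)} else UNIV)" for i j
    have B: "B i j \<in> sets seqs" for i j
      using sets.top[of seqs] sets_le_coordinates[of "p i" "p j"] by (simp add: B_def)
    have "?A p = (\<Inter>i\<in>{..<n}. \<Inter>j\<in>{..<n}. B i j)" by (auto simp: B_def)
    also have "\<dots> \<in> sets seqs"
    proof (cases "n = 0")
      case True
      thus ?thesis using sets.top[of seqs] by simp
    next
      case False
      thus ?thesis by (intro sets.finite_INT B) auto
    qed
    finally show ?thesis using p by simp
  qed
  show "space seqs \<subseteq> \<Union>?C"
  proof
    fix y :: "nat \<Rightarrow> real"
    obtain p where p: "p permutes {..<n}" "sort (map y [0..<n]) = map (\<lambda>i. y (p i)) [0..<n]"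
      by (rule sort_permutation)
    hence "y \<in> ?A p" unfolding srt by (metis sorted_sort)
    thus "y \<in> \<Union>?C" using p by blast
  qed
  show "svec n \<in> measurable (restrict_space seqs \<Omega>) seqs" if "\<Omega> \<in> ?C" for \<Omega>
  proof -
    from that obtain p where "p \<in> {p. p permutes {..<n}}" and p2: "\<Omega> = ?A p" by (rule imageE)
    hence p: "p permutes {..<n}" "\<Omega> = ?A p" by simp_all
    have eq: "svec n y = trunc n (\<lambda>i. y (p i))" if "y \<in> \<Omega>" for y
      using that p(1) unfolding p(2) srt by (intro svec_permutation sort_permutation_unique)
    have "(\<lambda>y. trunc n (\<lambda>i. y (p i))) \<in> measurable seqs seqs"
      by (rule measurable_seqsI) (simp add: trunc_def)
    hence "(\<lambda>y. trunc n (\<lambda>i. y (p i))) \<in> measurable (restrict_space seqs \<Omega>) seqs"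
      by (rule measurable_restrict_space1)
    thus ?thesis by (subst measurable_cong[of _ _ "\<lambda>y. trunc n (\<lambda>i. y (p i))"]) (auto simp: eq space_restrict_space)
  qed
qed

lemma AE_unif_singleton: "AE x in unif c. x \<noteq> b"
  unfolding unif_def using AE_lborel_singleton[of b] by (subst AE_density) auto

lemma AE_unif_pos: "AE x in unif c. 0 < x"
proof -
  have "AE x in lborel. x \<noteq> (0::real)" by (rule AE_lborel_singleton)
  hence "AE x in lborel. 0 < ennreal (indicator {0..c} x / c) \<longrightarrow> 0 < x"
    by eventually_elim (auto simp: indicator_def)
  thus ?thesis unfolding unif_def by (subst AE_density) auto
qed

lemma measurable_equal_coordinates:
  "(\<lambda>y. indicator {y. y i = y j} y :: ennreal) \<in> borel_measurable seqs"
proof -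
  have [measurable]: "(\<lambda>y. y k) \<in> borel_measurable seqs" for k :: nat
    by (rule measurable_component_singleton) simp
  have "{y \<in> space seqs. y i = y j} \<in> sets seqs" by measurable
  thus ?thesis by (intro borel_measurable_indicator) simp
qed

lemma AE_sample_distinct:
  assumes "c > 0"
  shows "AE y in PiM UNIV (\<lambda>_::nat. unif c). (\<forall>i. 0 < y i) \<and> inj y"
proof -
  interpret U: real_sequence_space "unif c" by (rule unif_sequence_space) fact
  have "AE y in U.S. 0 < y i" for i
    using AE_PiM_component[of UNIV "\<lambda>_. unif c" i "\<lambda>x. 0 < x"] AE_unif_pos U.M.prob_space_axioms by auto
  moreover have "AE y in U.S. y i \<noteq> y j" if "i \<noteq> j" for i j
  proof -
    \<comment> \<open>An injection taking 0 to \<open>i\<close> and 1 to \<open>j\<close>;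
      invariance under reindexing then reduces the claim to the first two coordinates.\<close>
    define p where "p k = (if k = 0 then i else if k = 1 then j else i + j + k)" for k :: nat
    have "inj p" using that by (auto simp: inj_def p_def)
    have 0: "(\<integral>\<^sup>+y. indicator {y. b = y 0} y \<partial>U.S) = 0" for b
    proof -
      have "AE y in U.S. y 0 \<noteq> b"
        using AE_PiM_component[of UNIV "\<lambda>_. unif c" 0 "\<lambda>x. x \<noteq> b"] AE_unif_singleton U.M.prob_space_axioms by auto
      hence "AE y in U.S. indicator {y. b = y 0} y = (0::ennreal)" by eventually_elim auto
      thus ?thesis by (subst nn_integral_cong_AE[where v = "\<lambda>_. 0"]) auto
    qed
    note [measurable] = measurable_equal_coordinates
    have "(\<integral>\<^sup>+y. indicator {y. y 0 = y 1} (\<lambda>k. y (p k)) \<partial>U.S) = (\<integral>\<^sup>+y. indicator {y. y 0 = y 1} y \<partial>U.S)"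
      by (rule U.nn_integral_permute[OF _ \<open>inj p\<close>]) simp
    also have "\<dots> = (\<integral>\<^sup>+b. (\<integral>\<^sup>+y. indicator {y. b = y 0} y \<partial>U.S) \<partial>unif c)"
      by (subst U.nn_integral_case_nat[OF measurable_equal_coordinates]) (simp add: indicator_def[abs_def])
    also have "\<dots> = 0" by (simp add: 0)
    finally have "(\<integral>\<^sup>+y. indicator {y. y i = y j} y \<partial>U.S) = 0"
      by (simp add: p_def indicator_def)
    moreover have "(\<lambda>y. indicator {y. y i = y j} y :: ennreal) \<in> borel_measurable U.S"
      by measurable
    ultimately have "AE y in U.S. indicator {y. y i = y j} y = (0::ennreal)"
      by (simp add: nn_integral_0_iff_AE)
    thus ?thesis by eventually_elim (auto simp: indicator_def split: if_splits)
  qed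
  ultimately have "AE y in U.S. (\<forall>i. 0 < y i) \<and> (\<forall>i j. i \<noteq> j \<longrightarrow> y i \<noteq> y j)"
    by (simp add: AE_all_countable)
  thus ?thesis by eventually_elim (auto simp: inj_def)
qed

text \<open>Almost surely exactly one permutation makes the sample strictly increasing. So the
  integral splits into \<open>fact n\<close> summands, which agree by exchangeability and are given
  by \<open>increasing_points_law\<close>.\<close>

lemma sorted_sample_law:
  assumes "c > 0" and [measurable]: "F \<in> borel_measurable seqs"
  shows "(\<integral>\<^sup>+y. F (svec n y) \<partial>PiM UNIV (\<lambda>_. unif c)) =
    ennreal (fact n / c ^ n) * (\<integral>\<^sup>+x. F (trunc n (\<lambda>i. psum (Suc i) x)) * (ennreal (exp (psum n x)) * indicator {x. psum n x \<le> c} x) \<partial>expo_seq)"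
proof -
  interpret U: real_sequence_space "unif c" by (rule unif_sequence_space) fact
  let ?G = "\<lambda>y. F (trunc n y) * indicator {y. incr 0 n y} y"
  let ?P = "{p. p permutes {..<n}}"
  have finP: "finite ?P" by (rule finite_permutations) simp
  have G [measurable]: "?G \<in> borel_measurable seqs" unfolding indicator_def mem_Collect_eq by measurable
  have G' [measurable]: "(\<lambda>y. ?G (\<lambda>i. y (p i))) \<in> borel_measurable seqs" for p
  proof -
    have "(\<lambda>y i. y (p i)) \<in> measurable seqs seqs" by (rule measurable_seqsI) simp
    thus ?thesis by (rule measurable_compose[OF _ G])
  qed
  have law: "(\<integral>\<^sup>+y. ?G y \<partial>U.S) = ennreal (1 / c ^ n) * (\<integral>\<^sup>+x. F (trunc n (\<lambda>i. psum (Suc i) x)) * (ennreal (exp (psum n x)) * indicator {x. psum n x \<le> c} x) \<partial>expo_seq)"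
    using increasing_points_law[OF assms(1) order_refl less_imp_le[OF assms(1)] assms(2), of n]
    by (simp only: add_0)
  have "(\<integral>\<^sup>+y. F (svec n y) \<partial>U.S) = (\<integral>\<^sup>+y. (\<Sum>p\<in>?P. ?G (\<lambda>i. y (p i))) \<partial>U.S)"
  proof (rule nn_integral_cong_AE)
    show "AE y in U.S. F (svec n y) = (\<Sum>p\<in>?P. ?G (\<lambda>i. y (p i)))"
      using AE_sample_distinct[OF assms(1)]
    proof eventually_elim
      case (elim y)
      obtain p where p: "p permutes {..<n}" "sort (map y [0..<n]) = map (\<lambda>i. y (p i)) [0..<n]"
        by (rule sort_permutation)
      have srt: "sorted (map (\<lambda>i. y (p i)) [0..<n])" by (metis p(2) sorted_sort)
      have injp: "inj p" using p(1) permutes_inj by blast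
      have inc: "incr 0 n (\<lambda>i. y (p i))"
        unfolding incr_def
      proof (intro allI impI)
        fix i assume i: "i < n"
        show "case_nat 0 (\<lambda>i. y (p i)) i < y (p i)"
        proof (cases i)
          case 0
          thus ?thesis using elim by simp
        next
          case (Suc k)
          have "y (p k) \<le> y (p i)" using sorted_nth_mono[OF srt, of k i] i Suc by simp
          moreover have "y (p k) \<noteq> y (p i)" using elim injp Suc by (metis inj_eq n_not_Suc_n)
          ultimately show ?thesis using Suc by simp
        qed
      qed
      have uniq: "q = p" if q: "q permutes {..<n}" and inc': "incr 0 n (\<lambda>i. y (q i))" for q
      proof -
        have step: "y (q k) \<le> y (q (Suc k))" if "Suc k < n" for k
          using inc'[unfolded incr_def, rule_format, of "Suc k"] that by simp
        have "sorted (map (\<lambda>i. y (q i)) [0..<n])"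
          unfolding sorted_iff_nth_Suc using step by simp
        hence eq: "map (\<lambda>i. y (p i)) [0..<n] = map (\<lambda>i. y (q i)) [0..<n]"
          using sort_permutation_unique[OF q, of y] p(2) by simp
        show "q = p"
        proof
          fix i
          show "q i = p i"
          proof (cases "i < n")
            case True
            hence "y (p i) = y (q i)" using eq by (auto simp: map_eq_conv)
            thus ?thesis using elim by (simp add: inj_eq)
          next
            case False
            thus ?thesis using permutes_not_in[OF p(1), of i] permutes_not_in[OF q, of i] by simp
          qed
        qed
      qed
      have "(\<Sum>q\<in>?P. ?G (\<lambda>i. y (q i))) = (\<Sum>q\<in>?P. if q = p then F (svec n y) else 0)"
      proof (rule sum.cong[OF refl])
        fix q assume "q \<in> ?P"
        hence q: "q permutes {..<n}" by simp
        show "?G (\<lambda>i. y (q i)) = (if q = p then F (svec n y) else 0)"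
        proof (cases "q = p")
          case True
          thus ?thesis using inc by (simp add: svec_permutation[OF p(2)] indicator_def)
        next
          case False
          hence "\<not> incr 0 n (\<lambda>i. y (q i))" using uniq[OF q] by blast
          thus ?thesis using False by (simp add: indicator_def)
        qed
      qed
      also have "\<dots> = F (svec n y)" using finP p(1) by simp
      finally show ?case by simp
    qed
  qed
  also have "\<dots> = (\<Sum>p\<in>?P. \<integral>\<^sup>+y. ?G (\<lambda>i. y (p i)) \<partial>U.S)"
    by (rule nn_integral_sum) (use G' in simp)
  also have "\<dots> = (\<Sum>p\<in>?P. \<integral>\<^sup>+y. ?G y \<partial>U.S)"
    by (intro sum.cong refl U.nn_integral_permute G) (use permutes_inj in auto)
  also have "\<dots> = fact n * (\<integral>\<^sup>+y. ?G y \<partial>U.S)"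
    by (simp add: card_permutations[of "{..<n}" n])
  also have "\<dots> = fact n * (ennreal (1 / c ^ n) * (\<integral>\<^sup>+x. F (trunc n (\<lambda>i. psum (Suc i) x)) * (ennreal (exp (psum n x)) * indicator {x. psum n x \<le> c} x) \<partial>expo_seq))"
    by (simp only: law)
  also have "\<dots> = fact n * ennreal (1 / c ^ n) * (\<integral>\<^sup>+x. F (trunc n (\<lambda>i. psum (Suc i) x)) * (ennreal (exp (psum n x)) * indicator {x. psum n x \<le> c} x) \<partial>expo_seq)"
    by (rule mult.assoc[symmetric])
  also have "fact n * ennreal (1 / c ^ n) = ennreal (fact n / c ^ n)"
  proof -
    have "(fact n :: ennreal) = of_nat (fact n)" by (rule of_nat_fact[symmetric])
    also have "\<dots> = ennreal (real (fact n))" by (rule ennreal_of_nat_eq_real_of_nat)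
    also have "real (fact n) = fact n" by (rule of_nat_fact)
    finally have "fact n * ennreal (1 / c ^ n) = ennreal (fact n) * ennreal (1 / c ^ n)" by (rule arg_cong)
    also have "\<dots> = ennreal (fact n * (1 / c ^ n))" by (rule ennreal_mult'[symmetric]) simp
    also have "fact n * (1 / c ^ n) = fact n / c ^ n" by simp
    finally show ?thesis .
  qed
  finally show ?thesis .
qed

section \<open>The law of the gaps and its invariance under rotation\<close>

definition gaps :: "nat \<Rightarrow> real \<Rightarrow> (nat \<Rightarrow> real) \<Rightarrow> nat \<Rightarrow> real" where
  "gaps N c s = (\<lambda>j. if j < N then s j - case_nat 0 s j else if j = N then c - case_nat 0 s N else 0)"

text \<open>The full vector of \<open>N + 1\<close> gaps recovered from the first \<open>N\<close>:
  the last one is determined by the total length \<open>c\<close>.\<close>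

definition resid :: "nat \<Rightarrow> real \<Rightarrow> (nat \<Rightarrow> real) \<Rightarrow> nat \<Rightarrow> real" where
  "resid N c x = (\<lambda>i. if i < N then x i else if i = N then c - psum N x else 0)"

text \<open>Up to the constant \<open>fact N / c ^ N\<close>, the density of the first
  \<open>N\<close> gaps relative to independent exponentials: it converts the exponential law into
  the uniform law on a simplex.\<close>

definition weight :: "nat \<Rightarrow> real \<Rightarrow> (nat \<Rightarrow> real) \<Rightarrow> ennreal" where
  "weight N c x = ennreal (exp (psum N x)) * indicator {x. psum N x \<le> c} x"

lemma measurable_gaps [measurable]: "gaps N c \<in> measurable seqs seqs"
proof (rule measurable_seqsI)
  have "(\<lambda>s. case_nat 0 s j) \<in> borel_measurable seqs" for j by (cases j) simp_all
  thus "(\<lambda>x. gaps N c x i) \<in> borel_measurable seqs" for i by (auto simp: gaps_def)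
qed

lemma measurable_resid [measurable]: "resid N c \<in> measurable seqs seqs"
  by (rule measurable_seqsI) (simp add: resid_def)

lemma measurable_weight [measurable]: "weight N c \<in> borel_measurable seqs"
  unfolding weight_def[abs_def] indicator_def mem_Collect_eq by measurable

lemma gaps_partial_sums: "gaps N c (trunc N (\<lambda>i. psum (Suc i) x)) = resid N c x"
proof
  fix j
  have 1: "psum (Suc j) x - psum j x = x j" for j by (simp add: psum_def)
  have 2: "case_nat 0 (trunc N (\<lambda>i. psum (Suc i) x)) j = psum j x" if "j \<le> N" for j
    using that by (cases j) (auto simp: trunc_def psum_def)
  show "gaps N c (trunc N (\<lambda>i. psum (Suc i) x)) j = resid N c x j"
    using 1[of j] by (auto simp: gaps_def resid_def 2) (simp add: trunc_def)
qed

text \<open>By \<open>distr_sample_gaps\<close> this is the law of the \<open>N + 1\<close> gaps of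
  \<open>N\<close> uniform points on [0, c]. Encoding it as a reweighted exponential law makes it
  directly comparable with independent exponentials. The later use is \<open>N = n - 1\<close> and
  \<open>c = n\<close>, for which the mean gap is 1.\<close>

definition spacing_law :: "nat \<Rightarrow> real \<Rightarrow> (nat \<Rightarrow> real) measure" where
  "spacing_law N c = distr (density expo_seq (\<lambda>x. ennreal (fact N / c ^ N) * weight N c x)) seqs (resid N c)"

lemma sets_spacing_law [measurable_cong]: "sets (spacing_law N c) = sets seqs"
  by (simp add: spacing_law_def)

lemma space_spacing_law [simp]: "space (spacing_law N c) = UNIV"
  by (simp add: spacing_law_def)

lemma nn_integral_spacing_law:
  assumes [measurable]: "F \<in> borel_measurable seqs"
  shows "(\<integral>\<^sup>+d. F d \<partial>spacing_law N c) = ennreal (fact N / c ^ N) * (\<integral>\<^sup>+x. F (resid N c x) * weight N c x \<partial>expo_seq)"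
proof -
  have "(\<integral>\<^sup>+d. F d \<partial>spacing_law N c) = (\<integral>\<^sup>+x. F (resid N c x) \<partial>density expo_seq (\<lambda>x. ennreal (fact N / c ^ N) * weight N c x))"
    unfolding spacing_law_def by (rule nn_integral_distr) measurable
  also have "\<dots> = (\<integral>\<^sup>+x. ennreal (fact N / c ^ N) * weight N c x * F (resid N c x) \<partial>expo_seq)"
    by (rule nn_integral_density) measurable
  also have "\<dots> = (\<integral>\<^sup>+x. ennreal (fact N / c ^ N) * (F (resid N c x) * weight N c x) \<partial>expo_seq)"
    by (simp only: mult.assoc mult.commute[of "weight N c _"])
  also have "\<dots> = ennreal (fact N / c ^ N) * (\<integral>\<^sup>+x. F (resid N c x) * weight N c x \<partial>expo_seq)"
    by (rule nn_integral_cmult) measurable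
  finally show ?thesis .
qed

lemma distr_sample_gaps:
  assumes "c > 0"
  shows "distr (PiM UNIV (\<lambda>_. unif c)) seqs (\<lambda>y. gaps N c (svec N y)) = spacing_law N c"
proof (rule measure_eqI)
  interpret U: real_sequence_space "unif c" by (rule unif_sequence_space) fact
  show "sets (distr U.S seqs (\<lambda>y. gaps N c (svec N y))) = sets (spacing_law N c)"
    by (simp add: sets_spacing_law)
  fix A assume "A \<in> sets (distr U.S seqs (\<lambda>y. gaps N c (svec N y)))"
  hence [measurable]: "A \<in> sets seqs" by simp
  have "emeasure (distr U.S seqs (\<lambda>y. gaps N c (svec N y))) A = (\<integral>\<^sup>+y. indicator A (gaps N c (svec N y)) \<partial>U.S)"
    by (subst nn_integral_indicator[symmetric], simp, rule nn_integral_distr) measurable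
  also have "\<dots> = (\<integral>\<^sup>+d. indicator A d \<partial>spacing_law N c)"
    unfolding nn_integral_spacing_law[OF borel_measurable_indicator[OF \<open>A \<in> sets seqs\<close>]]
    using sorted_sample_law[OF assms, of "\<lambda>s. indicator A (gaps N c s)" N]
    by (simp add: gaps_partial_sums weight_def)
  also have "\<dots> = emeasure (spacing_law N c) A"
    by (rule nn_integral_indicator) (simp add: sets_spacing_law)
  finally show "emeasure (distr U.S seqs (\<lambda>y. gaps N c (svec N y))) A = emeasure (spacing_law N c) A" .
qed

lemma prob_space_spacing_law: "c > 0 \<Longrightarrow> prob_space (spacing_law N c)"
proof -
  assume c: "c > 0"
  interpret U: real_sequence_space "unif c" by (rule unif_sequence_space) fact
  show ?thesis unfolding distr_sample_gaps[OF c, symmetric]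
    by (rule U.P.prob_space_distr) simp
qed

definition rotate_seq :: "nat \<Rightarrow> (nat \<Rightarrow> real) \<Rightarrow> nat \<Rightarrow> real" where
  "rotate_seq N d = (\<lambda>i. if i \<le> N then d (Suc i mod Suc N) else 0)"

lemma measurable_rotate_seq [measurable]: "rotate_seq N \<in> measurable seqs seqs"
  by (rule measurable_seqsI) (simp add: rotate_seq_def)

lemma psum_shift_permute:
  "psum (Suc N) (\<lambda>i. x (if i < N then Suc i else if i = N then 0 else i)) = psum (Suc N) x"
proof -
  have "psum (Suc N) (\<lambda>i. x (if i < N then Suc i else if i = N then 0 else i)) = (\<Sum>i<N. x (Suc i)) + x 0"
    by (simp add: psum_def)
  also have "\<dots> = psum (Suc N) x" unfolding psum_def by (subst sum.lessThan_Suc_shift) simp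
  finally show ?thesis .
qed

text \<open>With the gaps \<open>y\<close> in between held fixed, the first gap \<open>b\<close> and
  the residual gap add up to \<open>c - psum N y\<close>, and the weighted density does not depend
  on \<open>b\<close>. Exchanging the two gaps is therefore a reflection of an interval under
  Lebesgue measure.\<close>

lemma nn_integral_rotate_resid:
  assumes [measurable]: "F \<in> borel_measurable seqs"
  shows "(\<integral>\<^sup>+x. F (rotate_seq (Suc N) (resid (Suc N) c x)) * weight (Suc N) c x \<partial>expo_seq)
    = (\<integral>\<^sup>+x. F (resid (Suc N) c x) * weight (Suc N) c x \<partial>expo_seq)"
proof -
  define V where "V y b = (\<lambda>i. if i < N then y i else if i = N then c - psum N y - b else if i = Suc N then b else 0)" for y b
  define \<Phi> where "\<Phi> y b = F (V y b) * (ennreal (exp (psum N y)) * indicator {0..c - psum N y} b)" for y b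
  define p where "p i = (if i < N then Suc i else if i = N then 0 else i)" for i
  have injp: "inj p" by (auto simp: inj_def p_def)
  have V_meas [measurable]: "(\<lambda>q. V (fst q) (snd q)) \<in> measurable (seqs \<Otimes>\<^sub>M borel) seqs"
    by (rule measurable_seqsI) (simp add: V_def)
  have \<Phi>_meas: "(\<lambda>q. \<Phi> (fst q) (snd q)) \<in> borel_measurable (seqs \<Otimes>\<^sub>M borel)"
    unfolding \<Phi>_def indicator_def atLeastAtMost_iff by measurable
  have \<Phi>1 [measurable]: "(\<lambda>y. \<Phi> y b) \<in> borel_measurable seqs" for b
    using measurable_compose[OF _ \<Phi>_meas, of "\<lambda>y. (y, b)" seqs] by simp
  have \<Phi>2 [measurable]: "\<Phi> y \<in> borel_measurable borel" for y
    using measurable_compose[OF _ \<Phi>_meas, of "\<lambda>b. (y, b)" borel] by simp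
  interpret LS: pair_sigma_finite expo_seq lborel
    by (intro pair_sigma_finite.intro E.P.sigma_finite_measure_axioms lborel.sigma_finite_measure_axioms)
  have exp0: "ennreal (exp (- b)) * ennreal (exp (b + z)) = ennreal (exp z)" for b z :: real
    by (simp flip: ennreal_mult' exp_add)
  have rot: "rotate_seq (Suc N) (resid (Suc N) c (case_nat b y)) = V y b" for b y
  proof
    fix i
    consider "i < N" | "i = N" | "i = Suc N" | "i > Suc N" by linarith
    thus "rotate_seq (Suc N) (resid (Suc N) c (case_nat b y)) i = V y b i"
      by cases (simp_all add: rotate_seq_def resid_def V_def psum_case_nat)
  qed
  \<comment> \<open>Here the exponentials are first permuted cyclically, which puts \<open>b\<close>
    just before the residual gap. The same vector \<open>V\<close> appears, with its second argument
    reflected.\<close>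
  have perm: "resid (Suc N) c (\<lambda>i. case_nat b y (p i)) = V y (c - psum N y - b)" for b y
    unfolding resid_def V_def p_def psum_shift_permute psum_case_nat
    by (auto simp: fun_eq_iff less_Suc_eq)
  have wt: "weight (Suc N) c (case_nat b y) = ennreal (exp (b + psum N y)) * indicator {..c - psum N y} b" for b y
    by (auto simp: weight_def psum_case_nat indicator_def)
  have wtp: "weight (Suc N) c (\<lambda>i. case_nat b y (p i)) = weight (Suc N) c (case_nat b y)" for b y
    unfolding weight_def p_def by (simp only: psum_shift_permute indicator_def mem_Collect_eq)
  have G1: "(\<lambda>x. F (rotate_seq (Suc N) (resid (Suc N) c x)) * weight (Suc N) c x) \<in> borel_measurable seqs"
    by measurable
  have G2: "(\<lambda>x. F (resid (Suc N) c x) * weight (Suc N) c x) \<in> borel_measurable seqs"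
    by measurable
  have pm: "(\<lambda>x i. x (p i)) \<in> measurable seqs seqs" by (rule measurable_seqsI) simp
  have G3: "(\<lambda>x. F (resid (Suc N) c (\<lambda>i. x (p i))) * weight (Suc N) c (\<lambda>i. x (p i))) \<in> borel_measurable seqs"
    using measurable_compose[OF pm G2] .
  have "(\<integral>\<^sup>+x. F (rotate_seq (Suc N) (resid (Suc N) c x)) * weight (Suc N) c x \<partial>expo_seq) =
      (\<integral>\<^sup>+b. (\<integral>\<^sup>+y. \<Phi> y b \<partial>expo_seq) \<partial>lborel)"
    unfolding nn_integral_expo_case_nat[OF G1] rot wt
  proof (rule nn_integral_cong)
    fix b
    have "(\<integral>\<^sup>+y. \<Phi> y b \<partial>expo_seq) = (\<integral>\<^sup>+y. ennreal (exp (- b)) * indicator {0..} b * (F (V y b) * (ennreal (exp (b + psum N y)) * indicator {..c - psum N y} b)) \<partial>expo_seq)"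
    proof (rule nn_integral_cong)
      fix y
      have "ennreal (exp (- b)) * indicator {0..} b * (F (V y b) * (ennreal (exp (b + psum N y)) * indicator {..c - psum N y} b))
        = F (V y b) * ((ennreal (exp (- b)) * ennreal (exp (b + psum N y))) * (indicator {0..} b * indicator {..c - psum N y} b))"
        by (simp only: mult_ac)
      also have "indicator {0..} b * indicator {..c - psum N y} b = (indicator {0..c - psum N y} b :: ennreal)"
        by (auto simp: indicator_def)
      finally show "\<Phi> y b = ennreal (exp (- b)) * indicator {0..} b * (F (V y b) * (ennreal (exp (b + psum N y)) * indicator {..c - psum N y} b))"
        by (simp only: exp0 \<Phi>_def)
    qed
    also have "\<dots> = ennreal (exp (- b)) * indicator {0..} b * (\<integral>\<^sup>+y. F (V y b) * (ennreal (exp (b + psum N y)) * indicator {..c - psum N y} b) \<partial>expo_seq)"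
    proof (rule nn_integral_cmult)
      have "(\<lambda>y. F (V y b)) \<in> borel_measurable seqs"
        using measurable_compose[OF measurable_compose[OF _ V_meas, of "\<lambda>y. (y, b)" seqs] assms] by simp
      thus "(\<lambda>y. F (V y b) * (ennreal (exp (b + psum N y)) * indicator {..c - psum N y} b)) \<in> borel_measurable expo_seq"
        unfolding indicator_def atMost_iff by measurable
    qed
    finally show "ennreal (exp (- b)) * indicator {0..} b * (\<integral>\<^sup>+y. F (V y b) * (ennreal (exp (b + psum N y)) * indicator {..c - psum N y} b) \<partial>expo_seq) = (\<integral>\<^sup>+y. \<Phi> y b \<partial>expo_seq)"
      by simp
  qed
  also have "\<dots> = (\<integral>\<^sup>+y. (\<integral>\<^sup>+b. \<Phi> y b \<partial>lborel) \<partial>expo_seq)"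
    by (rule LS.Fubini') (use \<Phi>_meas in \<open>simp add: split_beta'\<close>)
  \<comment> \<open>The reflection that swaps the two gaps.\<close>
  also have "\<dots> = (\<integral>\<^sup>+y. (\<integral>\<^sup>+b. \<Phi> y (c - psum N y - b) \<partial>lborel) \<partial>expo_seq)"
  proof (rule nn_integral_cong)
    fix y
    have "(\<integral>\<^sup>+b. \<Phi> y b \<partial>lborel) = ennreal \<bar>- 1\<bar> * (\<integral>\<^sup>+b. \<Phi> y ((c - psum N y) + (- 1) * b) \<partial>lborel)"
      by (rule nn_integral_real_affine) simp_all
    thus "(\<integral>\<^sup>+b. \<Phi> y b \<partial>lborel) = (\<integral>\<^sup>+b. \<Phi> y (c - psum N y - b) \<partial>lborel)" by simp
  qed
  also have "\<dots> = (\<integral>\<^sup>+b. (\<integral>\<^sup>+y. \<Phi> y (c - psum N y - b) \<partial>expo_seq) \<partial>lborel)"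
  proof (rule LS.Fubini'[symmetric])
    have "(\<lambda>q. (fst q, c - psum N (fst q) - snd q)) \<in> measurable (seqs \<Otimes>\<^sub>M borel) (seqs \<Otimes>\<^sub>M borel)" by measurable
    from measurable_compose[OF this \<Phi>_meas]
    show "(\<lambda>(y, b). \<Phi> y (c - psum N y - b)) \<in> borel_measurable (expo_seq \<Otimes>\<^sub>M lborel)"
      by (simp add: split_beta')
  qed
  also have "\<dots> = (\<integral>\<^sup>+x. F (resid (Suc N) c (\<lambda>i. x (p i))) * weight (Suc N) c (\<lambda>i. x (p i)) \<partial>expo_seq)"
    unfolding nn_integral_expo_case_nat[OF G3] perm wtp wt
  proof (rule nn_integral_cong)
    fix b
    have "(\<integral>\<^sup>+y. \<Phi> y (c - psum N y - b) \<partial>expo_seq) = (\<integral>\<^sup>+y. ennreal (exp (- b)) * indicator {0..} b * (F (V y (c - psum N y - b)) * (ennreal (exp (b + psum N y)) * indicator {..c - psum N y} b)) \<partial>expo_seq)"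
    proof (rule nn_integral_cong)
      fix y
      have "ennreal (exp (- b)) * indicator {0..} b * (F (V y (c - psum N y - b)) * (ennreal (exp (b + psum N y)) * indicator {..c - psum N y} b))
        = F (V y (c - psum N y - b)) * ((ennreal (exp (- b)) * ennreal (exp (b + psum N y))) * (indicator {0..} b * indicator {..c - psum N y} b))"
        by (simp only: mult_ac)
      also have "indicator {0..} b * indicator {..c - psum N y} b = (indicator {0..c - psum N y} (c - psum N y - b) :: ennreal)"
        by (auto simp: indicator_def)
      finally show "\<Phi> y (c - psum N y - b) = ennreal (exp (- b)) * indicator {0..} b * (F (V y (c - psum N y - b)) * (ennreal (exp (b + psum N y)) * indicator {..c - psum N y} b))"
        by (simp only: exp0 \<Phi>_def)
    qed
    also have "\<dots> = ennreal (exp (- b)) * indicator {0..} b * (\<integral>\<^sup>+y. F (V y (c - psum N y - b)) * (ennreal (exp (b + psum N y)) * indicator {..c - psum N y} b) \<partial>expo_seq)"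
    proof (rule nn_integral_cmult)
      have "(\<lambda>y. F (V y (c - psum N y - b))) \<in> borel_measurable seqs"
        using measurable_compose[OF measurable_compose[OF _ V_meas, of "\<lambda>y. (y, c - psum N y - b)" seqs] assms] by simp
      thus "(\<lambda>y. F (V y (c - psum N y - b)) * (ennreal (exp (b + psum N y)) * indicator {..c - psum N y} b)) \<in> borel_measurable expo_seq"
        unfolding indicator_def atMost_iff by measurable
    qed
    finally show "(\<integral>\<^sup>+y. \<Phi> y (c - psum N y - b) \<partial>expo_seq) = ennreal (exp (- b)) * indicator {0..} b * (\<integral>\<^sup>+y. F (V y (c - psum N y - b)) * (ennreal (exp (b + psum N y)) * indicator {..c - psum N y} b) \<partial>expo_seq)" .
  qed
  also have "\<dots> = (\<integral>\<^sup>+x. F (resid (Suc N) c x) * weight (Suc N) c x \<partial>expo_seq)"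
    by (rule E.nn_integral_permute[OF G2 injp])
  finally show ?thesis .
qed

lemma distr_rotate_spacing_law:
  "distr (spacing_law N c) seqs (rotate_seq N) = spacing_law N c"
proof (rule measure_eqI)
  fix A assume "A \<in> sets (distr (spacing_law N c) seqs (rotate_seq N))"
  hence A: "A \<in> sets seqs" by simp
  note [measurable] = A
  have eq: "(\<integral>\<^sup>+d. indicator A (rotate_seq N d) \<partial>spacing_law N c) = (\<integral>\<^sup>+d. indicator A d \<partial>spacing_law N c)"
  proof (cases N)
    case 0
    have "AE x in expo_seq. indicator A (rotate_seq 0 (resid 0 c x)) * weight 0 c x = indicator A (resid 0 c x) * weight 0 c x"
    proof (rule AE_I2)
      fix x
      have "rotate_seq 0 (resid 0 c x) = resid 0 c x" by (auto simp: rotate_seq_def resid_def fun_eq_iff)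
      thus "indicator A (rotate_seq 0 (resid 0 c x)) * weight 0 c x = indicator A (resid 0 c x) * weight 0 c x" by simp
    qed
    thus ?thesis unfolding 0 by (subst (1 2) nn_integral_spacing_law) (auto intro!: nn_integral_cong_AE arg_cong[where f = "(*) _"])
  next
    case (Suc M)
    show ?thesis unfolding Suc
      using nn_integral_rotate_resid[OF borel_measurable_indicator[OF A], of M c]
      by (subst (1 2) nn_integral_spacing_law) simp_all
  qed
  have "emeasure (distr (spacing_law N c) seqs (rotate_seq N)) A = (\<integral>\<^sup>+d. indicator A (rotate_seq N d) \<partial>spacing_law N c)"
    by (subst nn_integral_indicator[symmetric], simp, rule nn_integral_distr) measurable
  also have "\<dots> = emeasure (spacing_law N c) A" unfolding eq by (rule nn_integral_indicator) (simp add: sets_spacing_law)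
  finally show "emeasure (distr (spacing_law N c) seqs (rotate_seq N)) A = emeasure (spacing_law N c) A" .
qed (simp add: sets_spacing_law)

lemma rotate_seq_iterate:
  assumes "j < Suc N"
  shows "(rotate_seq N ^^ K) d j = (if K = 0 then d j else d ((j + K) mod Suc N))"
  using assms
proof (induction K arbitrary: j)
  case (Suc K)
  have "(rotate_seq N ^^ Suc K) d j = (rotate_seq N ^^ K) d (Suc j mod Suc N)"
    using Suc.prems by (simp add: rotate_seq_def)
  also have "\<dots> = d ((j + Suc K) mod Suc N)"
    using Suc.IH[of "Suc j mod Suc N"] by (cases "K = 0") (auto simp: mod_simps)
  finally show ?case by simp
qed simp

lemma measurable_rotate_seq_iterate [measurable]: "(rotate_seq N ^^ K) \<in> measurable seqs seqs"
  by (induction K) (auto intro: measurable_comp[OF _ measurable_rotate_seq])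

lemma distr_rotate_iterate_spacing_law:
  "distr (spacing_law N c) seqs (rotate_seq N ^^ K) = spacing_law N c"
proof (induction K)
  case 0
  show ?case by (simp add: id_def distr_id2 sets_spacing_law)
next
  case (Suc K)
  have "distr (spacing_law N c) seqs (rotate_seq N ^^ Suc K) = distr (distr (spacing_law N c) seqs (rotate_seq N ^^ K)) seqs (rotate_seq N)"
    by (subst distr_distr) (simp_all add: comp_def)
  thus ?case by (simp only: Suc distr_rotate_spacing_law)
qed

section \<open>Density of the initial gaps\<close>

text \<open>The weight cancels the exponential density, so the integral is the volume of a simplex
  of side \<open>z\<close> in dimension \<open>q\<close>.\<close>

lemma expo_partial_sum_integral:
  assumes "z \<ge> 0"
  shows "(\<integral>\<^sup>+y. weight q z y \<partial>expo_seq) = ennreal (z ^ q / fact q)"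
  using assms
proof (induction q arbitrary: z)
  case 0
  thus ?case by (simp add: weight_def psum_def E.P.emeasure_space_1[simplified])
next
  case (Suc q)
  have neg: "(\<integral>\<^sup>+y. weight q w y \<partial>expo_seq) = 0" if "w < 0" for w
  proof -
    have "AE y in expo_seq. weight q w y = 0"
      using AE_psum_nonneg
    proof eventually_elim
      case (elim y)
      have "\<not> psum q y \<le> w" using elim that by (metis not_le order_less_le_trans)
      thus ?case by (simp add: weight_def)
    qed
    thus ?thesis by (subst nn_integral_cong_AE[where v = "\<lambda>_. 0"]) auto
  qed
  have "(\<integral>\<^sup>+y. weight (Suc q) z y \<partial>expo_seq) = (\<integral>\<^sup>+b. ennreal (exp (- b)) * indicator {0..} b * (\<integral>\<^sup>+y. ennreal (exp b) * weight q (z - b) y \<partial>expo_seq) \<partial>lborel)"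
    by (subst nn_integral_expo_case_nat[OF measurable_weight])
       (auto intro!: nn_integral_cong arg_cong[where f = "(*) _"] simp: weight_def psum_case_nat exp_add ennreal_mult' mult.assoc indicator_def)
  also have "\<dots> = (\<integral>\<^sup>+b. indicator {0..} b * (\<integral>\<^sup>+y. weight q (z - b) y \<partial>expo_seq) \<partial>lborel)"
  proof (rule nn_integral_cong)
    fix b :: real
    have "(\<integral>\<^sup>+y. ennreal (exp b) * weight q (z - b) y \<partial>expo_seq) = ennreal (exp b) * (\<integral>\<^sup>+y. weight q (z - b) y \<partial>expo_seq)"
      by (rule nn_integral_cmult) measurable
    moreover have "ennreal (exp (- b)) * ennreal (exp b) = 1" by (simp flip: ennreal_mult' exp_add)
    ultimately show "ennreal (exp (- b)) * indicator {0..} b * (\<integral>\<^sup>+y. ennreal (exp b) * weight q (z - b) y \<partial>expo_seq)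
      = indicator {0..} b * (\<integral>\<^sup>+y. weight q (z - b) y \<partial>expo_seq)"
      by (metis (no_types, lifting) mult.assoc mult.commute mult.left_neutral)
  qed
  also have "\<dots> = (\<integral>\<^sup>+b. ennreal ((z - b) ^ q / fact q) * indicator {0..z} b \<partial>lborel)"
  proof (rule nn_integral_cong)
    fix b :: real
    consider "b < 0" | "0 \<le> b" "b \<le> z" | "b > z" by linarith
    thus "indicator {0..} b * (\<integral>\<^sup>+y. weight q (z - b) y \<partial>expo_seq) = ennreal ((z - b) ^ q / fact q) * indicator {0..z} b"
      by cases (simp_all add: Suc.IH neg)
  qed
  also have "\<dots> = ennreal (- ((z - z) ^ Suc q / fact (Suc q)) - (- ((z - 0) ^ Suc q / fact (Suc q))))"
  proof (rule nn_integral_FTC_Icc)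
    show "((\<lambda>b. - ((z - b) ^ Suc q / fact (Suc q))) has_real_derivative (z - b) ^ q / fact q) (at b)" for b
    proof -
      have "((\<lambda>b. (z - b) ^ Suc q) has_real_derivative - (real (Suc q) * (z - b) ^ q)) (at b)"
        by (rule derivative_eq_intros refl | simp)+
      from DERIV_minus[OF DERIV_cdivide[OF this, of "fact (Suc q)"]]
      show ?thesis by (simp del: power_Suc)
    qed
  qed (use Suc.prems in auto)
  also have "\<dots> = ennreal (z ^ Suc q / fact (Suc q))" by simp
  finally show ?case .
qed

text \<open>Integrating out the later gaps leaves a density that sees the first \<open>k\<close>
  gaps only through their sum. The condition \<open>k < N\<close> hides the residual gap from
  \<open>F\<close> and keeps the exponent positive, so that the density vanishes when the sum
  exceeds \<open>c\<close>.\<close>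

lemma spacing_law_initial:
  assumes [measurable]: "F \<in> borel_measurable seqs" and dep: "depends_on {..<k} F" and k: "k < N"
  shows "(\<integral>\<^sup>+d. F d \<partial>spacing_law N c) = ennreal (fact N / c ^ N) *
    (\<integral>\<^sup>+x. F x * ennreal (exp (psum k x) * (max 0 (c - psum k x)) ^ (N - k) / fact (N - k)) \<partial>expo_seq)"
proof -
  have [measurable]: "(\<lambda>x. F (resid N c x) * weight N c x) \<in> borel_measurable seqs" by measurable
  have ps: "psum N (comb_seq k x y) = psum k x + psum (N - k) y" for x y
  proof -
    have "psum N (comb_seq k x y) = (\<Sum>i<k. comb_seq k x y i) + (\<Sum>i=k..<N. comb_seq k x y i)"
      unfolding psum_def lessThan_atLeast0 using k by (subst sum.atLeastLessThan_concat) auto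
    also have "(\<Sum>i=k..<N. comb_seq k x y i) = (\<Sum>i=0+k..<(N-k)+k. comb_seq k x y i)" using k by simp
    also have "\<dots> = (\<Sum>i=0..<N-k. y i)"
      unfolding sum.shift_bounds_nat_ivl by (simp add: comb_seq_def)
    also have "(\<Sum>i<k. comb_seq k x y i) = psum k x" by (simp add: comb_seq_def psum_def)
    finally show ?thesis by (simp add: psum_def lessThan_atLeast0)
  qed
  have "(\<integral>\<^sup>+x. F (resid N c x) * weight N c x \<partial>expo_seq) = (\<integral>\<^sup>+x. (\<integral>\<^sup>+y. F (resid N c (comb_seq k x y)) * weight N c (comb_seq k x y) \<partial>expo_seq) \<partial>expo_seq)"
    by (rule E.nn_integral_comb_seq) measurable
  also have "\<dots> = (\<integral>\<^sup>+x. F x * ennreal (exp (psum k x) * (max 0 (c - psum k x)) ^ (N - k) / fact (N - k)) \<partial>expo_seq)"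
  proof (rule nn_integral_cong)
    fix x
    have F: "F (resid N c (comb_seq k x y)) = F x" for y
      by (rule depends_onD[OF dep]) (use k in \<open>auto simp: resid_def comb_seq_def\<close>)
    have w: "weight N c (comb_seq k x y) = ennreal (exp (psum k x)) * weight (N - k) (c - psum k x) y" for y
      by (auto simp: weight_def ps exp_add ennreal_mult' mult.assoc indicator_def)
    have "(\<integral>\<^sup>+y. F (resid N c (comb_seq k x y)) * weight N c (comb_seq k x y) \<partial>expo_seq)
      = (\<integral>\<^sup>+y. (F x * ennreal (exp (psum k x))) * weight (N - k) (c - psum k x) y \<partial>expo_seq)"
      by (simp only: F w mult.assoc)
    also have "\<dots> = F x * ennreal (exp (psum k x)) * (\<integral>\<^sup>+y. weight (N - k) (c - psum k x) y \<partial>expo_seq)"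
      by (rule nn_integral_cmult) measurable
    also have "(\<integral>\<^sup>+y. weight (N - k) (c - psum k x) y \<partial>expo_seq) = ennreal ((max 0 (c - psum k x)) ^ (N - k) / fact (N - k))"
    proof (cases "0 \<le> c - psum k x")
      case True
      thus ?thesis by (simp add: expo_partial_sum_integral)
    next
      case False
      have "AE y in expo_seq. weight (N - k) (c - psum k x) y = 0"
        using AE_psum_nonneg
      proof eventually_elim
        case (elim y)
        have "\<not> psum (N - k) y \<le> c - psum k x" using elim False by (metis not_le order_less_le_trans)
        thus ?case by (simp add: weight_def)
      qed
      hence "(\<integral>\<^sup>+y. weight (N - k) (c - psum k x) y \<partial>expo_seq) = 0"
        by (subst nn_integral_cong_AE[where v = "\<lambda>_. 0"]) auto
      thus ?thesis using False k by (simp add: max_def)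
    qed
    also have "F x * ennreal (exp (psum k x)) * ennreal ((max 0 (c - psum k x)) ^ (N - k) / fact (N - k))
      = F x * ennreal (exp (psum k x) * (max 0 (c - psum k x)) ^ (N - k) / fact (N - k))"
      unfolding times_divide_eq_right[symmetric] by (subst ennreal_mult') (simp_all add: mult.assoc)
    finally show "(\<integral>\<^sup>+y. F (resid N c (comb_seq k x y)) * weight N c (comb_seq k x y) \<partial>expo_seq)
      = F x * ennreal (exp (psum k x) * (max 0 (c - psum k x)) ^ (N - k) / fact (N - k))" .
  qed
  finally show ?thesis by (subst nn_integral_spacing_law) simp_all
qed

section \<open>Finite samples inside the sequence space, and moments\<close>

text \<open>Moves a finite iid sample from an arbitrary probability space to the canonical product,
  where all computations take place.\<close>

lemma distr_indep_trunc:
  fixes X :: "nat \<Rightarrow> 'b \<Rightarrow> real"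
  assumes "prob_space M" "real_sequence_space \<mu>"
    and indep: "prob_space.indep_vars M (\<lambda>_. borel) X {..<N}"
    and law: "\<And>i. i < N \<Longrightarrow> distr M borel (X i) = \<mu>"
  shows "distr M seqs (\<lambda>\<omega>. trunc N (\<lambda>i. X i \<omega>)) = distr (PiM UNIV (\<lambda>_. \<mu>)) seqs (trunc N)"
proof (cases "N = 0")
  case True
  interpret M: prob_space M by fact
  interpret U: real_sequence_space \<mu> by fact
  have 0: "trunc 0 x = (\<lambda>_. 0)" for x by (simp add: trunc_def fun_eq_iff)
  show ?thesis unfolding True 0
    by (subst M.distr_const, simp, subst U.P.distr_const) simp_all
next
  case False
  interpret M: prob_space M by fact
  interpret U: real_sequence_space \<mu> by fact
  have rv [measurable]: "X i \<in> borel_measurable M" if "i < N" for i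
    using indep that unfolding M.indep_vars_def2 by auto
  define e where "e g = (\<lambda>i. if i < N then g i else 0 :: real)" for g :: "nat \<Rightarrow> real"
  have e [measurable]: "e \<in> measurable (PiM {..<N} (\<lambda>_. borel)) seqs"
  proof (rule measurable_seqsI)
    show "(\<lambda>x. e x i) \<in> borel_measurable (PiM {..<N} (\<lambda>_. borel))" for i
      by (cases "i < N") (simp_all add: e_def measurable_component_singleton)
  qed
  have R: "(\<lambda>\<omega>. \<lambda>i\<in>{..<N}. X i \<omega>) \<in> measurable M (PiM {..<N} (\<lambda>_. borel))"
    by (intro measurable_restrict) simp
  have "distr M seqs (\<lambda>\<omega>. trunc N (\<lambda>i. X i \<omega>)) = distr (distr M (PiM {..<N} (\<lambda>_. borel)) (\<lambda>\<omega>. \<lambda>i\<in>{..<N}. X i \<omega>)) seqs e"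
    by (subst distr_distr[OF e R]) (auto simp: o_def e_def trunc_def fun_eq_iff intro!: distr_cong)
  also have "distr M (PiM {..<N} (\<lambda>_. borel)) (\<lambda>\<omega>. \<lambda>i\<in>{..<N}. X i \<omega>) = PiM {..<N} (\<lambda>i. distr M borel (X i))"
    using M.indep_vars_iff_distr_eq_PiM'[where I = "{..<N}" and M' = "\<lambda>_. borel" and X = X] False indep rv by auto
  also have "\<dots> = PiM {..<N} (\<lambda>_. \<mu>)" by (intro PiM_cong) (auto simp: law)
  also have "\<dots> = distr U.S (PiM {..<N} (\<lambda>_. \<mu>)) (\<lambda>x. restrict x {..<N})"
    by (rule U.distr_PiM_restrict_finite[symmetric]) auto
  also have "distr \<dots> seqs e = distr U.S seqs (\<lambda>x. e (restrict x {..<N}))"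
  proof (subst distr_distr)
    show "e \<in> measurable (PiM {..<N} (\<lambda>_. \<mu>)) seqs"
    proof -
      have s: "sets (PiM {..<N} (\<lambda>_. \<mu>)) = sets (PiM {..<N} (\<lambda>_. borel))"
        by (rule sets_PiM_cong) (auto simp: U.sets_M)
      show ?thesis using e measurable_cong_sets[OF s refl, of seqs] by simp
    qed
    show "(\<lambda>x. restrict x {..<N}) \<in> measurable U.S (PiM {..<N} (\<lambda>_. \<mu>))"
      by (rule measurable_restrict_subset) simp
  qed (simp add: o_def)
  also have "\<dots> = distr U.S seqs (trunc N)"
    by (intro distr_cong) (auto simp: e_def trunc_def fun_eq_iff)
  finally show ?thesis .
qed

lemma abs_sum_powr_le:
  fixes y :: "'i \<Rightarrow> real"
  assumes "finite J" "r \<ge> 1"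
  shows "\<bar>\<Sum>i\<in>J. y i\<bar> powr r \<le> card J powr (r - 1) * (\<Sum>i\<in>J. \<bar>y i\<bar> powr r)"
proof -
  \<comment> \<open>Zero terms add nothing on either side; without them Jensen's inequality is
    applied to positive numbers only.\<close>
  let ?P = "{i \<in> J. y i \<noteq> 0}"
  have fP: "finite ?P" using assms by simp
  have "\<bar>\<Sum>i\<in>J. y i\<bar> \<le> (\<Sum>i\<in>J. \<bar>y i\<bar>)" by (rule sum_abs)
  also have "\<dots> = (\<Sum>i\<in>?P. \<bar>y i\<bar>)"
    using assms by (intro sum.mono_neutral_right) auto
  finally have le: "\<bar>\<Sum>i\<in>J. y i\<bar> \<le> (\<Sum>i\<in>?P. \<bar>y i\<bar>)" .
  show ?thesis
  proof (cases "?P = {}")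
    case True
    hence "\<bar>\<Sum>i\<in>J. y i\<bar> = 0" using le by (simp only: sum.empty abs_le_zero_iff abs_0_eq)
    thus ?thesis by (simp add: sum_nonneg)
  next
    case False
    let ?n = "real (card ?P)"
    have n: "?n > 0" using False fP by (simp add: card_gt_0_iff)
    have "(\<Sum>i\<in>?P. (1 / ?n) *\<^sub>R \<bar>y i\<bar>) powr r \<le> (\<Sum>i\<in>?P. (1 / ?n) * \<bar>y i\<bar> powr r)"
      by (rule convex_on_sum[OF fP False powr_convex[OF assms(2)]]) (use n in auto)
    hence "((\<Sum>i\<in>?P. \<bar>y i\<bar>) / ?n) powr r \<le> (\<Sum>i\<in>?P. \<bar>y i\<bar> powr r) / ?n"
      by (simp add: sum_divide_distrib)
    hence "(\<Sum>i\<in>?P. \<bar>y i\<bar>) powr r / ?n powr r \<le> (\<Sum>i\<in>?P. \<bar>y i\<bar> powr r) / ?n"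
      using n by (simp add: powr_divide sum_nonneg)
    hence "(\<Sum>i\<in>?P. \<bar>y i\<bar>) powr r \<le> ?n powr r / ?n * (\<Sum>i\<in>?P. \<bar>y i\<bar> powr r)"
      using n by (simp add: field_simps)
    also have "?n powr r / ?n = ?n powr (r - 1)" using n by (simp add: powr_diff)
    also have "?n powr (r - 1) * (\<Sum>i\<in>?P. \<bar>y i\<bar> powr r) \<le> card J powr (r - 1) * (\<Sum>i\<in>J. \<bar>y i\<bar> powr r)"
      using assms by (intro mult_mono powr_mono2 sum_mono2 sum_nonneg) (auto intro!: card_mono)
    finally have "(\<Sum>i\<in>?P. \<bar>y i\<bar>) powr r \<le> card J powr (r - 1) * (\<Sum>i\<in>J. \<bar>y i\<bar> powr r)" .
    moreover have "\<bar>\<Sum>i\<in>J. y i\<bar> powr r \<le> (\<Sum>i\<in>?P. \<bar>y i\<bar>) powr r"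
      using le assms by (intro powr_mono2) auto
    ultimately show ?thesis by linarith
  qed
qed

context real_sequence_space
begin

lemma prob_UNIV [simp]: "measure S UNIV = 1"
  using P.prob_space by simp

lemma
  fixes F :: "(nat \<Rightarrow> real) \<Rightarrow> 'b::{banach, second_countable_topology}"
  assumes [measurable]: "F \<in> borel_measurable seqs" and "inj p"
  shows integral_permute: "(\<integral>x. F (\<lambda>i. x (p i)) \<partial>S) = (\<integral>x. F x \<partial>S)"
    and integrable_permute: "integrable S (\<lambda>x. F (\<lambda>i. x (p i))) \<longleftrightarrow> integrable S F"
proof -
  have [measurable]: "(\<lambda>x i. x (p i)) \<in> measurable S S"
    unfolding measurable_cong_sets[OF refl sets_S] by (rule measurable_seqsI) simp
  show "(\<integral>x. F (\<lambda>i. x (p i)) \<partial>S) = (\<integral>x. F x \<partial>S)"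
    using integral_distr[of "\<lambda>x i. x (p i)" S S F] by (simp add: distr_permute[OF assms(2)])
  show "integrable S (\<lambda>x. F (\<lambda>i. x (p i))) \<longleftrightarrow> integrable S F"
    using integrable_distr_eq[of "\<lambda>x i. x (p i)" S S F] by (simp add: distr_permute[OF assms(2)])
qed

end

lemma expo_coordinate: "distributed expo_seq lborel (\<lambda>x. x i) (exponential_density 1)"
proof -
  have "distr (PiM UNIV (\<lambda>_::nat. expo)) expo (\<lambda>x. x i) = expo"
    using distr_PiM_component[of UNIV "\<lambda>_. expo" i] E.M.prob_space_axioms by simp
  hence "distr expo_seq lborel (\<lambda>x. x i) = expo"
    by (metis distr_cong sets_density)
  thus ?thesis unfolding distributed_def by simp
qed

lemma expo_coordinate_moment:
  "integrable expo_seq (\<lambda>x. x i ^ k)" "(\<integral>x. x i ^ k \<partial>expo_seq) = fact k"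
  using E.P.erlang_ith_moment_integrable[OF _ expo_coordinate, of i k]
    E.P.erlang_ith_moment[OF _ expo_coordinate, of i k] by simp_all

definition dev :: "nat \<Rightarrow> (nat \<Rightarrow> real) \<Rightarrow> real" where
  "dev i x = x i - 1"

lemma dev_measurable [measurable]: "dev i \<in> borel_measurable seqs"
  unfolding dev_def by measurable

lemma dev_depends: "depends_on {i} (dev i)"
  by (rule depends_onI) (simp add: dev_def)

lemma dev_power_expand:
  "dev i x ^ 2 = x i ^ 2 - 2 * x i ^ 1 + 1"
  "dev i x ^ 3 = x i ^ 3 - 3 * x i ^ 2 + 3 * x i ^ 1 - 1"
  "dev i x ^ 4 = x i ^ 4 - 4 * x i ^ 3 + 6 * x i ^ 2 - 4 * x i ^ 1 + 1"
  by (simp_all add: dev_def power2_eq_square power3_eq_cube power4_eq_xxxx algebra_simps)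

lemma dev_moments:
  "integrable expo_seq (dev i)" "(\<integral>x. dev i x \<partial>expo_seq) = 0"
  "integrable expo_seq (\<lambda>x. (dev i x)\<^sup>2)" "(\<integral>x. (dev i x)\<^sup>2 \<partial>expo_seq) = 1"
  "integrable expo_seq (\<lambda>x. (dev i x) ^ 3)"
  "integrable expo_seq (\<lambda>x. (dev i x) ^ 4)" "(\<integral>x. (dev i x) ^ 4 \<partial>expo_seq) = 9"
proof -
  note m = expo_coordinate_moment[of i]
  have m1: "integrable expo_seq (\<lambda>x. x i)" "(\<integral>x. x i \<partial>expo_seq) = 1"
    using m[of 1] by simp_all
  show "integrable expo_seq (dev i)" "(\<integral>x. dev i x \<partial>expo_seq) = 0"
    using m1 by (simp_all add: dev_def[abs_def] E.P.prob_space)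
  show "integrable expo_seq (\<lambda>x. (dev i x)\<^sup>2)" "integrable expo_seq (\<lambda>x. (dev i x) ^ 3)" "integrable expo_seq (\<lambda>x. (dev i x) ^ 4)"
    unfolding dev_power_expand
    by (intro Bochner_Integration.integrable_add Bochner_Integration.integrable_diff integrable_mult_right m E.P.integrable_const)+
  have "(\<integral>x. (dev i x)\<^sup>2 \<partial>expo_seq) = fact 2 - 2 * fact 1 + 1"
    unfolding dev_power_expand m(2)[symmetric] using m1(1) m(1)[of 2] m(1)[of 3] m(1)[of 4] by simp
  thus "(\<integral>x. (dev i x)\<^sup>2 \<partial>expo_seq) = 1" by (simp add: fact_numeral)
  have "(\<integral>x. (dev i x) ^ 4 \<partial>expo_seq) = fact 4 - 4 * fact 3 + 6 * fact 2 - 4 * fact 1 + 1"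
    unfolding dev_power_expand m(2)[symmetric] using m1(1) m(1)[of 2] m(1)[of 3] m(1)[of 4] by simp
  thus "(\<integral>x. (dev i x) ^ 4 \<partial>expo_seq) = 9" by (simp add: fact_numeral)
qed

lemma dev_sum_depends: "depends_on {a..<b} (\<lambda>x. \<Sum>i=a..<b. dev i x)"
  by (rule depends_on_sum) (rule depends_on_mono[OF dev_depends], simp)

text \<open>In the induction step cross terms containing a first power vanish, and what is left is
  bounded by \<open>9 * q^2 + 6 * q + 9\<close>, at most \<open>9 * (q + 1)^2\<close>. Third moments
  are carried along because they occur in the expansion of the fourth power.\<close>

lemma dev_sum_fourth:
  "integrable expo_seq (\<lambda>x. (\<Sum>i=a..<a+q. dev i x)\<^sup>2) \<and> (\<integral>x. (\<Sum>i=a..<a+q. dev i x)\<^sup>2 \<partial>expo_seq) = q \<and>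
   integrable expo_seq (\<lambda>x. (\<Sum>i=a..<a+q. dev i x) ^ 3) \<and>
   integrable expo_seq (\<lambda>x. (\<Sum>i=a..<a+q. dev i x) ^ 4) \<and> (\<integral>x. (\<Sum>i=a..<a+q. dev i x) ^ 4 \<partial>expo_seq) \<le> 9 * (real q)\<^sup>2"
proof (induction q)
  case (Suc q)
  let ?T = "\<lambda>x. \<Sum>i=a..<a+q. dev i x" and ?z = "dev (a + q)"
  have iT: "integrable expo_seq (\<lambda>x. ?T x ^ j)" if "j \<le> 4" for j
  proof -
    have "integrable expo_seq ?T" by (intro Bochner_Integration.integrable_sum dev_moments)
    moreover have "j = 0 \<or> j = 1 \<or> j = 2 \<or> j = 3 \<or> j = 4" using that by linarith
    ultimately show ?thesis using Suc by auto
  qed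
  have iz: "integrable expo_seq (\<lambda>x. ?z x ^ j)" if "j \<le> 4" for j
  proof -
    have "j = 0 \<or> j = 1 \<or> j = 2 \<or> j = 3 \<or> j = 4" using that by linarith
    thus ?thesis using dev_moments[of "a + q"] by auto
  qed
  have ET: "(\<integral>x. ?T x \<partial>expo_seq) = 0"
    by (simp add: Bochner_Integration.integral_sum dev_moments)
  have prod: "integrable expo_seq (\<lambda>x. ?T x ^ j * ?z x ^ l)"
      "(\<integral>x. ?T x ^ j * ?z x ^ l \<partial>expo_seq) = (\<integral>x. ?T x ^ j \<partial>expo_seq) * (\<integral>x. ?z x ^ l \<partial>expo_seq)" if "j \<le> 4" "l \<le> 4" for j l
  proof -
    have d1: "depends_on {..<a + q} (\<lambda>x. ?T x ^ j)"
      by (rule depends_on_comp[where g = "\<lambda>z. z ^ j"], rule depends_on_mono[OF dev_sum_depends]) auto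
    have d2: "depends_on {a + q..} (\<lambda>x. ?z x ^ l)"
      by (rule depends_on_comp[where g = "\<lambda>z. z ^ l"], rule depends_on_mono[OF dev_depends]) auto
    show "integrable expo_seq (\<lambda>x. ?T x ^ j * ?z x ^ l)"
      "(\<integral>x. ?T x ^ j * ?z x ^ l \<partial>expo_seq) = (\<integral>x. ?T x ^ j \<partial>expo_seq) * (\<integral>x. ?z x ^ l \<partial>expo_seq)"
      using E.integrable_mult_depends[OF iT[OF that(1)] d1 iz[OF that(2)] d2]
        E.integral_mult_depends[OF iT[OF that(1)] d1 iz[OF that(2)] d2] by simp_all
  qed
  have S: "(\<Sum>i=a..<a+Suc q. dev i x) = ?T x + ?z x" for x by simp
  have e2: "(?T x + ?z x)\<^sup>2 = ?T x ^ 2 * ?z x ^ 0 + 2 * (?T x ^ 1 * ?z x ^ 1) + ?T x ^ 0 * ?z x ^ 2" for x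
    by (simp add: power2_eq_square algebra_simps)
  have e3: "(?T x + ?z x) ^ 3 = ?T x ^ 3 * ?z x ^ 0 + 3 * (?T x ^ 2 * ?z x ^ 1) + 3 * (?T x ^ 1 * ?z x ^ 2) + ?T x ^ 0 * ?z x ^ 3" for x
    by (simp add: power2_eq_square power3_eq_cube algebra_simps)
  have e4: "(?T x + ?z x) ^ 4 = ?T x ^ 4 * ?z x ^ 0 + 4 * (?T x ^ 3 * ?z x ^ 1) + 6 * (?T x ^ 2 * ?z x ^ 2) + 4 * (?T x ^ 1 * ?z x ^ 3) + ?T x ^ 0 * ?z x ^ 4" for x
    by (simp add: power2_eq_square power3_eq_cube power4_eq_xxxx algebra_simps)
  have ET1: "(\<integral>x. ?T x ^ 1 \<partial>expo_seq) = 0" using ET by simp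
  have Ez1: "(\<integral>x. ?z x ^ 1 \<partial>expo_seq) = 0" using dev_moments(2) by simp
  have one: "(\<integral>x. (f x :: real) ^ 0 \<partial>expo_seq) = 1" for f by (simp add: E.P.prob_space)
  have I2: "integrable expo_seq (\<lambda>x. (?T x + ?z x)\<^sup>2)" "integrable expo_seq (\<lambda>x. (?T x + ?z x) ^ 3)" "integrable expo_seq (\<lambda>x. (?T x + ?z x) ^ 4)"
    unfolding e2 e3 e4 by (intro Bochner_Integration.integrable_add integrable_mult_right prod; simp)+
  have v2: "(\<integral>x. (?T x + ?z x)\<^sup>2 \<partial>expo_seq) = Suc q"
  proof -
    have "(\<integral>x. (?T x + ?z x)\<^sup>2 \<partial>expo_seq) = (\<integral>x. ?T x ^ 2 * ?z x ^ 0 \<partial>expo_seq) + 2 * (\<integral>x. ?T x ^ 1 * ?z x ^ 1 \<partial>expo_seq) + (\<integral>x. ?T x ^ 0 * ?z x ^ 2 \<partial>expo_seq)"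
      unfolding e2 using prod(1)[of 2 0] prod(1)[of 1 1] prod(1)[of 0 2]
      by (subst Bochner_Integration.integral_add Bochner_Integration.integral_mult_right_zero; (intro Bochner_Integration.integrable_add integrable_mult_right)?; simp)+
    also have "\<dots> = q + 1"
      using Suc dev_moments(4)[of "a + q"] by (simp only: prod(2) ET1 Ez1 one numeral_le_iff) (simp add: prod(2) ET ET1 Ez1 one)
    finally show ?thesis by simp
  qed
  have v4: "(\<integral>x. (?T x + ?z x) ^ 4 \<partial>expo_seq) \<le> 9 * (real (Suc q))\<^sup>2"
  proof -
    have "(\<integral>x. (?T x + ?z x) ^ 4 \<partial>expo_seq) = (\<integral>x. ?T x ^ 4 * ?z x ^ 0 \<partial>expo_seq) + 4 * (\<integral>x. ?T x ^ 3 * ?z x ^ 1 \<partial>expo_seq)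
      + 6 * (\<integral>x. ?T x ^ 2 * ?z x ^ 2 \<partial>expo_seq) + 4 * (\<integral>x. ?T x ^ 1 * ?z x ^ 3 \<partial>expo_seq) + (\<integral>x. ?T x ^ 0 * ?z x ^ 4 \<partial>expo_seq)"
      unfolding e4 using prod(1)[of 4 0] prod(1)[of 3 1] prod(1)[of 2 2] prod(1)[of 1 3] prod(1)[of 0 4]
      by (subst Bochner_Integration.integral_add Bochner_Integration.integral_mult_right_zero; (intro Bochner_Integration.integrable_add integrable_mult_right)?; simp)+
    also have "\<dots> = (\<integral>x. ?T x ^ 4 \<partial>expo_seq) + 6 * q + 9"
      using Suc dev_moments(4,7)[of "a + q"] prod(2)[of 4 0] prod(2)[of 3 1] prod(2)[of 2 2] prod(2)[of 1 3] prod(2)[of 0 4]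
      by (simp add: ET Ez1[simplified] E.P.prob_space)
    also have "\<dots> \<le> 9 * (real q)\<^sup>2 + 6 * q + 9" using Suc by simp
    also have "\<dots> \<le> 9 * (real (Suc q))\<^sup>2" by (simp add: power2_eq_square algebra_simps)
    finally show ?thesis .
  qed
  show ?case unfolding S using I2 v2 v4 by simp
qed simp

section \<open>Window statistics of independent exponentials\<close>

definition window :: "nat \<Rightarrow> nat \<Rightarrow> (nat \<Rightarrow> real) \<Rightarrow> real" where
  "window m k x = (\<Sum>i<m. x (k + i))"

lemma window_measurable [measurable]: "window m k \<in> borel_measurable seqs"
  unfolding window_def by measurable

lemma window_depends: "depends_on {k..<k + m} (window m k)"
  by (rule depends_onI) (simp add: window_def)

lemma window_shift: "window m k (\<lambda>i. x (l + i)) = window m (l + k) x"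
  by (simp add: window_def add.assoc)

lemma dev_shift: "dev k (\<lambda>i. x (l + i)) = dev (l + k) x"
  by (simp add: dev_def)

lemma sum_square_upper_triangle:
  fixes f :: "nat \<Rightarrow> real"
  shows "(\<Sum>k<m. f k)\<^sup>2 = (\<Sum>k<m. (f k)\<^sup>2 + 2 * (\<Sum>l=Suc k..<m. f k * f l))"
proof (induction m)
  case (Suc m)
  have "(\<Sum>k<Suc m. f k)\<^sup>2 = (\<Sum>k<m. f k)\<^sup>2 + (2 * (\<Sum>k<m. f k * f m) + (f m)\<^sup>2)"
    by (simp add: power2_sum sum_distrib_right mult.assoc)
  also have "\<dots> = (\<Sum>k<Suc m. (f k)\<^sup>2 + 2 * (\<Sum>l=Suc k..<Suc m. f k * f l))"
    by (simp add: Suc sum.distrib sum_distrib_left distrib_left algebra_simps)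
  finally show ?case .
qed simp

locale window_statistic =
  fixes m :: nat and h :: "real \<Rightarrow> real"
  assumes m_pos: "m \<ge> 1"
    and h_measurable [measurable]: "h \<in> borel_measurable borel"
    and h_square: "integrable expo_seq (\<lambda>x. (h (window m 0 x))\<^sup>2)"
begin

definition a :: real where "a = (\<integral>x. h (window m 0 x) \<partial>expo_seq)"

definition H :: "nat \<Rightarrow> (nat \<Rightarrow> real) \<Rightarrow> real" where
  "H k x = h (window m k x) - a"

text \<open>The covariance of the statistic with the window sum, the latter already centred through
  \<open>dev\<close>.\<close>

definition c :: real where "c = (\<integral>x. H 0 x * (\<Sum>i<m. dev i x) \<partial>expo_seq)"

definition g :: "nat \<Rightarrow> (nat \<Rightarrow> real) \<Rightarrow> real" where
  "g k x = H k x - dev k x * c"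

text \<open>The canonical form of \<open>sigma_sq\<close>: stationarity merges the lags d and
  -d.\<close>

definition s2 :: real where
  "s2 = (\<integral>x. (H 0 x)\<^sup>2 \<partial>expo_seq) + 2 * (\<Sum>d=1..<m. \<integral>x. H 0 x * H d x \<partial>expo_seq) - c\<^sup>2"

lemma H_measurable [measurable]: "H k \<in> borel_measurable seqs"
  unfolding H_def by measurable

lemma g_measurable [measurable]: "g k \<in> borel_measurable seqs"
  unfolding g_def by measurable

lemma H_shift: "H k (\<lambda>i. x (l + i)) = H (l + k) x"
  by (simp add: H_def window_shift)

lemma g_shift: "g k (\<lambda>i. x (l + i)) = g (l + k) x"
  by (simp add: g_def H_shift dev_shift)

lemma H_depends: "depends_on {k..<k + m} (H k)"
  unfolding H_def by (rule depends_on_comp[OF window_depends])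

lemma g_depends: "depends_on {k..<k + m} (g k)"
proof -
  have "depends_on {k..<k + m} (dev k)" by (rule depends_on_mono[OF dev_depends]) (use m_pos in auto)
  from depends_on_comp2[OF H_depends this, of "\<lambda>u v. u - v * c"]
  show ?thesis by (simp add: g_def[abs_def])
qed

lemma shift_inj: "inj (\<lambda>i. l + i :: nat)" by (auto simp: inj_def)

lemma H_square: "integrable expo_seq (\<lambda>x. (H k x)\<^sup>2)"
proof -
  have "integrable expo_seq (\<lambda>x. h (window m 0 x) + (- a))"
    using E.P.square_integrable_imp_integrable[OF _ h_square] by simp
  have "integrable expo_seq (\<lambda>x. (h (window m 0 x) + (- a))\<^sup>2)"
    by (rule E.integrable_add_square) (use h_square in auto)
  hence "integrable expo_seq (\<lambda>x. (H 0 x)\<^sup>2)" by (simp add: H_def)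
  hence "integrable expo_seq (\<lambda>x. (H 0 (\<lambda>i. x (k + i)))\<^sup>2)"
    using E.integrable_permute[OF _ shift_inj, of "\<lambda>x. (H 0 x)\<^sup>2" k] by simp
  thus ?thesis by (simp only: H_shift add_0_right)
qed

lemma H_integrable: "integrable expo_seq (H k)"
  using E.P.square_integrable_imp_integrable[OF _ H_square] by simp

lemma H_mean: "(\<integral>x. H k x \<partial>expo_seq) = 0"
proof -
  have "integrable expo_seq (\<lambda>x. h (window m 0 x))"
    using E.P.square_integrable_imp_integrable[OF _ h_square] by simp
  hence "(\<integral>x. H 0 x \<partial>expo_seq) = 0" by (simp add: H_def a_def)
  thus ?thesis using E.integral_permute[OF H_measurable shift_inj, of 0 k] by (simp only: H_shift add_0_right)
qed

text \<open>A general linear combination, in the spirit of Cramer and Wold, from which the joint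
  limit of the sums of \<open>g\<close> and of \<open>dev\<close> is read off.\<close>

definition \<xi> :: "real \<Rightarrow> real \<Rightarrow> nat \<Rightarrow> (nat \<Rightarrow> real) \<Rightarrow> real" where
  "\<xi> \<alpha> \<beta> k x = \<alpha> * g k x + \<beta> * dev k x"

lemma \<xi>_eq: "\<xi> \<alpha> \<beta> k x = \<alpha> * H k x + (\<beta> - \<alpha> * c) * dev k x"
  by (simp add: \<xi>_def g_def algebra_simps)

lemma \<xi>_measurable [measurable]: "\<xi> \<alpha> \<beta> k \<in> borel_measurable seqs"
  unfolding \<xi>_def by measurable

lemma \<xi>_shift: "\<xi> \<alpha> \<beta> k (\<lambda>i. x (l + i)) = \<xi> \<alpha> \<beta> (l + k) x"
  by (simp add: \<xi>_def g_shift dev_shift)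

lemma \<xi>_depends: "depends_on {k..<k + m} (\<xi> \<alpha> \<beta> k)"
proof -
  have "depends_on {k..<k + m} (dev k)" by (rule depends_on_mono[OF dev_depends]) (use m_pos in auto)
  from depends_on_comp2[OF g_depends this, of "\<lambda>u v. \<alpha> * u + \<beta> * v"]
  show ?thesis by (simp add: \<xi>_def[abs_def])
qed

lemma \<xi>_square: "integrable expo_seq (\<lambda>x. (\<xi> \<alpha> \<beta> k x)\<^sup>2)"
  unfolding \<xi>_eq
proof (rule E.integrable_add_square)
  show "integrable expo_seq (\<lambda>x. (\<alpha> * H k x)\<^sup>2)" "integrable expo_seq (\<lambda>x. ((\<beta> - \<alpha> * c) * dev k x)\<^sup>2)"
    unfolding power_mult_distrib using H_square dev_moments(3) by auto
qed measurable

lemma \<xi>_integrable: "integrable expo_seq (\<xi> \<alpha> \<beta> k)"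
  using E.P.square_integrable_imp_integrable[OF _ \<xi>_square] by simp

lemma \<xi>_mean: "(\<integral>x. \<xi> \<alpha> \<beta> k x \<partial>expo_seq) = 0"
  unfolding \<xi>_eq using H_integrable dev_moments(1) by (simp add: H_mean dev_moments(2))

lemma g_eq_\<xi>: "g k x = \<xi> 1 0 k x" by (simp add: \<xi>_def)

definition C :: "real \<Rightarrow> real \<Rightarrow> nat \<Rightarrow> real" where
  "C \<alpha> \<beta> d = (\<integral>x. \<xi> \<alpha> \<beta> 0 x * \<xi> \<alpha> \<beta> d x \<partial>expo_seq)"

lemma \<xi>_cov: "k \<le> l \<Longrightarrow> (\<integral>x. \<xi> \<alpha> \<beta> k x * \<xi> \<alpha> \<beta> l x \<partial>expo_seq) = C \<alpha> \<beta> (l - k)"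
  unfolding C_def
  using E.integral_permute[OF _ shift_inj, of "\<lambda>x. \<xi> \<alpha> \<beta> 0 x * \<xi> \<alpha> \<beta> (l - k) x" k]
  by (simp add: \<xi>_shift)

lemma \<xi>_prod_integrable: "integrable expo_seq (\<lambda>x. \<xi> \<alpha> \<beta> k x * \<xi> \<alpha> \<beta> l x)"
  by (intro E.integrable_mult_square \<xi>_square) measurable

lemma C_far:
  assumes "m \<le> d"
  shows "C \<alpha> \<beta> d = 0"
proof -
  have "C \<alpha> \<beta> d = (\<integral>x. \<xi> \<alpha> \<beta> 0 x \<partial>expo_seq) * (\<integral>x. \<xi> \<alpha> \<beta> d x \<partial>expo_seq)"
    unfolding C_def
  proof (rule E.integral_mult_depends[OF \<xi>_integrable _ \<xi>_integrable])
    show "depends_on {..<m} (\<xi> \<alpha> \<beta> 0)" by (rule depends_on_mono[OF \<xi>_depends]) auto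
    show "depends_on {m..} (\<xi> \<alpha> \<beta> d)" by (rule depends_on_mono[OF \<xi>_depends]) (use assms in auto)
  qed
  thus ?thesis by (simp add: \<xi>_mean)
qed

lemma dev_H_independent:
  assumes "1 \<le> d"
  shows "(\<integral>x. dev 0 x * H d x \<partial>expo_seq) = 0" "(\<integral>x. dev 0 x * dev d x \<partial>expo_seq) = 0"
proof -
  have dep: "depends_on {..<1} (dev 0)" by (rule depends_on_mono[OF dev_depends]) auto
  have "depends_on {1..} (H d)" by (rule depends_on_mono[OF H_depends]) (use assms in auto)
  from E.integral_mult_depends[OF dev_moments(1) dep H_integrable this]
  show "(\<integral>x. dev 0 x * H d x \<partial>expo_seq) = 0" by (simp add: H_mean)
  have "depends_on {1..} (dev d)" by (rule depends_on_mono[OF dev_depends]) (use assms in auto)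
  from E.integral_mult_depends[OF dev_moments(1) dep dev_moments(1) this]
  show "(\<integral>x. dev 0 x * dev d x \<partial>expo_seq) = 0" by (simp add: dev_moments)
qed

text \<open>
  Replacing \<open>h\<close> by \<open>g\<close> removes the correlation with the partial sums, so that the cross terms in
  the long-run variance vanish.
\<close>

lemma long_run_variance:
  "C \<alpha> \<beta> 0 + 2 * (\<Sum>d=1..<m. C \<alpha> \<beta> d) = \<alpha>\<^sup>2 * s2 + \<beta>\<^sup>2"
proof -
  define b where "b = \<beta> - \<alpha> * c"
  define e where "e d = (\<integral>x. H 0 x * dev d x \<partial>expo_seq)" for d
  define \<kappa> where "\<kappa> d = (\<integral>x. H 0 x * H d x \<partial>expo_seq)" for d
  have iHH: "integrable expo_seq (\<lambda>x. H 0 x * H d x)" for d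
    by (intro E.integrable_mult_square H_square) measurable
  have iHd: "integrable expo_seq (\<lambda>x. H k x * dev d x)" for k d
    by (intro E.integrable_mult_square H_square dev_moments) measurable
  have idd: "integrable expo_seq (\<lambda>x. dev k x * dev d x)" for k d
    by (intro E.integrable_mult_square dev_moments) measurable
  have expand: "C \<alpha> \<beta> d = \<alpha>\<^sup>2 * \<kappa> d + \<alpha> * b * e d + \<alpha> * b * (\<integral>x. dev 0 x * H d x \<partial>expo_seq) + b\<^sup>2 * (\<integral>x. dev 0 x * dev d x \<partial>expo_seq)" for d
  proof -
    have "C \<alpha> \<beta> d = (\<integral>x. \<alpha>\<^sup>2 * (H 0 x * H d x) + \<alpha> * b * (H 0 x * dev d x) + \<alpha> * b * (dev 0 x * H d x) + b\<^sup>2 * (dev 0 x * dev d x) \<partial>expo_seq)"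
      unfolding C_def \<xi>_eq b_def[symmetric]
      by (intro Bochner_Integration.integral_cong refl) (simp add: power2_eq_square algebra_simps)
    also have "\<dots> = \<alpha>\<^sup>2 * \<kappa> d + \<alpha> * b * e d + \<alpha> * b * (\<integral>x. dev 0 x * H d x \<partial>expo_seq) + b\<^sup>2 * (\<integral>x. dev 0 x * dev d x \<partial>expo_seq)"
      unfolding \<kappa>_def e_def
      using iHH[of d] iHd[of 0 d] iHd[of d 0] idd[of 0 d]
      by (simp add: mult.commute[of "dev 0 _" "H d _"])
    finally show ?thesis .
  qed
  have c: "c = (\<Sum>d<m. e d)"
  proof -
    have "c = (\<integral>x. (\<Sum>d<m. H 0 x * dev d x) \<partial>expo_seq)" unfolding c_def by (simp add: sum_distrib_left)
    also have "\<dots> = (\<Sum>d<m. e d)" unfolding e_def using iHd by (simp add: Bochner_Integration.integral_sum)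
    finally show ?thesis .
  qed
  have m0: "{..<m} = insert 0 {1..<m}" using m_pos by auto
  have c': "c = e 0 + (\<Sum>d=1..<m. e d)" unfolding c m0 by simp
  have C0: "C \<alpha> \<beta> 0 = \<alpha>\<^sup>2 * \<kappa> 0 + 2 * \<alpha> * b * e 0 + b\<^sup>2"
    unfolding expand e_def using dev_moments(4)[of 0] by (simp add: mult.commute[of "dev 0 _" "H 0 _"] flip: power2_eq_square)
  have Cd: "C \<alpha> \<beta> d = \<alpha>\<^sup>2 * \<kappa> d + \<alpha> * b * e d" if "d \<in> {1..<m}" for d
    unfolding expand using dev_H_independent[of d] that by simp
  have "(\<Sum>d=1..<m. C \<alpha> \<beta> d) = \<alpha>\<^sup>2 * (\<Sum>d=1..<m. \<kappa> d) + \<alpha> * b * (\<Sum>d=1..<m. e d)"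
    by (simp add: Cd sum.distrib sum_distrib_left)
  hence "C \<alpha> \<beta> 0 + 2 * (\<Sum>d=1..<m. C \<alpha> \<beta> d) = \<alpha>\<^sup>2 * (\<kappa> 0 + 2 * (\<Sum>d=1..<m. \<kappa> d)) + 2 * \<alpha> * b * c + b\<^sup>2"
    unfolding C0 c' by (simp add: algebra_simps)
  also have "\<kappa> 0 + 2 * (\<Sum>d=1..<m. \<kappa> d) = s2 + c\<^sup>2"
    unfolding s2_def \<kappa>_def by (simp add: power2_eq_square)
  also have "\<alpha>\<^sup>2 * (s2 + c\<^sup>2) + 2 * \<alpha> * b * c + b\<^sup>2 = \<alpha>\<^sup>2 * s2 + (\<alpha> * c + b)\<^sup>2"
    by (simp add: power2_eq_square algebra_simps)
  also have "\<alpha> * c + b = \<beta>" by (simp add: b_def)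
  finally show ?thesis .
qed

text \<open>Summation over stretches of length \<open>m\<close> makes the m-dependent sequence
  \<open>\<xi>\<close> one-dependent: a block reads its own stretch and part of the next.\<close>

definition block :: "real \<Rightarrow> real \<Rightarrow> nat \<Rightarrow> (nat \<Rightarrow> real) \<Rightarrow> real" where
  "block \<alpha> \<beta> i x = (\<Sum>k=i*m..<Suc i*m. \<xi> \<alpha> \<beta> k x)"

lemma block_shift: "block \<alpha> \<beta> i (\<lambda>j. x (l * m + j)) = block \<alpha> \<beta> (l + i) x"
proof -
  have "block \<alpha> \<beta> i (\<lambda>j. x (l * m + j)) = (\<Sum>k=i*m..<Suc i*m. \<xi> \<alpha> \<beta> (k + l * m) x)"
  proof -
    have "\<xi> \<alpha> \<beta> k (\<lambda>j. x (l * m + j)) = \<xi> \<alpha> \<beta> (k + l * m) x" for k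
      by (subst \<xi>_shift) (simp add: add.commute)
    thus ?thesis by (simp only: block_def)
  qed
  also have "\<dots> = (\<Sum>k=i*m+l*m..<Suc i*m+l*m. \<xi> \<alpha> \<beta> k x)"
    by (rule sum.shift_bounds_nat_ivl[symmetric])
  finally have shifted: "block \<alpha> \<beta> i (\<lambda>j. x (l * m + j)) = (\<Sum>k=i*m+l*m..<Suc i*m+l*m. \<xi> \<alpha> \<beta> k x)" .
  have eqs: "i*m+l*m = (l+i)*m" "Suc i*m+l*m = Suc (l+i)*m" by (simp_all add: algebra_simps)
  show ?thesis unfolding shifted eqs by (simp only: block_def)
qed

lemma one_dependent_block: "one_dependent expo m (block \<alpha> \<beta>)"
proof
  have [measurable]: "block \<alpha> \<beta> i \<in> borel_measurable seqs" for i unfolding block_def by measurable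
  show "block \<alpha> \<beta> i \<in> borel_measurable expo_seq" for i by measurable
  show "depends_on {i * m..<(i + 2) * m} (block \<alpha> \<beta> i)" for i
  proof -
    have "depends_on {i * m..<(i + 2) * m} (\<lambda>x. \<Sum>k=i*m..<Suc i*m. \<xi> \<alpha> \<beta> k x)"
    proof (rule depends_on_sum)
      fix k assume "k \<in> {i*m..<Suc i*m}"
      thus "depends_on {i * m..<(i + 2) * m} (\<xi> \<alpha> \<beta> k)"
        by (intro depends_on_mono[OF \<xi>_depends]) (auto simp: algebra_simps)
    qed
    thus ?thesis by (simp add: block_def[abs_def])
  qed
  show "integrable expo_seq (\<lambda>x. (block \<alpha> \<beta> i x)\<^sup>2)" for i
    unfolding block_def by (intro E.integrable_sum_square \<xi>_square) measurable
  show "(\<integral>x. block \<alpha> \<beta> i x \<partial>expo_seq) = 0" for i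
    unfolding block_def using \<xi>_integrable by (simp add: Bochner_Integration.integral_sum \<xi>_mean)
qed

lemma block_measurable [measurable]: "block \<alpha> \<beta> i \<in> borel_measurable seqs"
  unfolding block_def by measurable

lemma block_stationary:
  fixes F :: "real \<Rightarrow> real \<Rightarrow> real"
  assumes F: "case_prod F \<in> borel_measurable (borel \<Otimes>\<^sub>M borel)"
  shows "(\<integral>x. F (block \<alpha> \<beta> i x) (block \<alpha> \<beta> (Suc i) x) \<partial>expo_seq) = (\<integral>x. F (block \<alpha> \<beta> 0 x) (block \<alpha> \<beta> 1 x) \<partial>expo_seq)"
proof -
  have "(\<lambda>x. F (block \<alpha> \<beta> 0 x) (block \<alpha> \<beta> 1 x)) \<in> borel_measurable seqs"
    using measurable_compose[OF measurable_Pair[OF block_measurable block_measurable] F] by simp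
  from E.integral_permute[OF this shift_inj, of "i * m"]
  show ?thesis by (simp add: block_shift)
qed

text \<open>Each of the \<open>m\<close> terms in a block meets every lag from 1 to m - 1 exactly
  once, in its own block or in the next. Variance plus twice the neighbour covariance is therefore
  \<open>m\<close> times the long-run variance.\<close>

lemma block_covariance:
  "(\<integral>x. (block \<alpha> \<beta> i x)\<^sup>2 \<partial>expo_seq) + 2 * (\<integral>x. block \<alpha> \<beta> i x * block \<alpha> \<beta> (Suc i) x \<partial>expo_seq) = m * (\<alpha>\<^sup>2 * s2 + \<beta>\<^sup>2)"
proof -
  have 0: "(\<integral>x. (block \<alpha> \<beta> i x)\<^sup>2 \<partial>expo_seq) = (\<integral>x. (block \<alpha> \<beta> 0 x)\<^sup>2 \<partial>expo_seq)"
    using block_stationary[of "\<lambda>u v. u\<^sup>2" \<alpha> \<beta> i] by simp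
  have 1: "(\<integral>x. block \<alpha> \<beta> i x * block \<alpha> \<beta> (Suc i) x \<partial>expo_seq) = (\<integral>x. block \<alpha> \<beta> 0 x * block \<alpha> \<beta> 1 x \<partial>expo_seq)"
    using block_stationary[of "\<lambda>u v. u * v" \<alpha> \<beta> i] by simp
  have "(\<integral>x. (block \<alpha> \<beta> 0 x)\<^sup>2 \<partial>expo_seq) = (\<integral>x. (\<Sum>k<m. \<xi> \<alpha> \<beta> k x * \<xi> \<alpha> \<beta> k x + 2 * (\<Sum>l=Suc k..<m. \<xi> \<alpha> \<beta> k x * \<xi> \<alpha> \<beta> l x)) \<partial>expo_seq)"
    by (simp add: block_def sum_square_upper_triangle flip: lessThan_atLeast0 power2_eq_square)
  also have "\<dots> = (\<Sum>k<m. C \<alpha> \<beta> 0 + 2 * (\<Sum>l=Suc k..<m. C \<alpha> \<beta> (l - k)))"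
    using \<xi>_prod_integrable by (simp add: Bochner_Integration.integral_sum \<xi>_cov)
  finally have g0: "(\<integral>x. (block \<alpha> \<beta> 0 x)\<^sup>2 \<partial>expo_seq) = (\<Sum>k<m. C \<alpha> \<beta> 0 + 2 * (\<Sum>l=Suc k..<m. C \<alpha> \<beta> (l - k)))" .
  have "(\<integral>x. block \<alpha> \<beta> 0 x * block \<alpha> \<beta> 1 x \<partial>expo_seq) = (\<integral>x. (\<Sum>k<m. \<Sum>l=m..<2*m. \<xi> \<alpha> \<beta> k x * \<xi> \<alpha> \<beta> l x) \<partial>expo_seq)"
    by (simp add: block_def sum_product mult_2 flip: lessThan_atLeast0)
  also have "\<dots> = (\<Sum>k<m. \<Sum>l=m..<2*m. C \<alpha> \<beta> (l - k))"
    using \<xi>_prod_integrable by (simp add: Bochner_Integration.integral_sum \<xi>_cov)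
  finally have g1: "(\<integral>x. block \<alpha> \<beta> 0 x * block \<alpha> \<beta> 1 x \<partial>expo_seq) = (\<Sum>k<m. \<Sum>l=m..<2*m. C \<alpha> \<beta> (l - k))" .
  \<comment> \<open>The two sums run over adjacent ranges of \<open>l\<close>. Together they contain
    all lags below \<open>m\<close>; the larger ones drop out by \<open>C_far\<close>.\<close>
  have inner: "(\<Sum>l=Suc k..<m. C \<alpha> \<beta> (l - k)) + (\<Sum>l=m..<2*m. C \<alpha> \<beta> (l - k)) = (\<Sum>d=1..<m. C \<alpha> \<beta> d)" if "k < m" for k
  proof -
    have "(\<Sum>l=Suc k..<m. C \<alpha> \<beta> (l - k)) + (\<Sum>l=m..<2*m. C \<alpha> \<beta> (l - k)) = (\<Sum>l=Suc k..<2*m. C \<alpha> \<beta> (l - k))"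
      using that by (intro sum.atLeastLessThan_concat) auto
    also have "\<dots> = (\<Sum>l=1+k..<(2*m-k)+k. C \<alpha> \<beta> (l - k))" using that by simp
    also have "\<dots> = (\<Sum>d=1..<2*m-k. C \<alpha> \<beta> d)"
      unfolding sum.shift_bounds_nat_ivl by simp
    also have "\<dots> = (\<Sum>d=1..<m. C \<alpha> \<beta> d)"
      by (rule sum.mono_neutral_right) (use that in \<open>auto intro!: C_far\<close>)
    finally show ?thesis .
  qed
  have "(\<integral>x. (block \<alpha> \<beta> 0 x)\<^sup>2 \<partial>expo_seq) + 2 * (\<integral>x. block \<alpha> \<beta> 0 x * block \<alpha> \<beta> 1 x \<partial>expo_seq)
    = (\<Sum>k<m. C \<alpha> \<beta> 0 + 2 * ((\<Sum>l=Suc k..<m. C \<alpha> \<beta> (l - k)) + (\<Sum>l=m..<2*m. C \<alpha> \<beta> (l - k))))"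
    unfolding g0 g1 by (simp add: sum.distrib sum_distrib_left algebra_simps)
  also have "\<dots> = (\<Sum>k<m. C \<alpha> \<beta> 0 + 2 * (\<Sum>d=1..<m. C \<alpha> \<beta> d))"
    by (intro sum.cong refl) (simp add: inner)
  also have "\<dots> = m * (\<alpha>\<^sup>2 * s2 + \<beta>\<^sup>2)" unfolding long_run_variance by simp
  finally show ?thesis unfolding 0 1 .
qed

text \<open>The power-mean inequality and stationarity; the dependence among the terms is not
  exploited. The power of \<open>m\<close> obtained here, times about n / m blocks, explains the
  power m^(r-1) in the moment hypothesis.\<close>

lemma g_sum_moment:
  assumes r: "r > 2" and gr: "integrable expo_seq (\<lambda>x. \<bar>g 0 x\<bar> powr r)" and J: "finite J" "card J \<le> m"
  shows "integrable expo_seq (\<lambda>x. \<bar>\<Sum>k\<in>J. g k x\<bar> powr r)"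
    and "(\<integral>x. \<bar>\<Sum>k\<in>J. g k x\<bar> powr r \<partial>expo_seq) \<le> m powr r * (\<integral>x. \<bar>g 0 x\<bar> powr r \<partial>expo_seq)"
proof -
  let ?M = "\<integral>x. \<bar>g 0 x\<bar> powr r \<partial>expo_seq"
  have M0: "?M \<ge> 0" by simp
  have gk: "integrable expo_seq (\<lambda>x. \<bar>g k x\<bar> powr r)" "(\<integral>x. \<bar>g k x\<bar> powr r \<partial>expo_seq) = ?M" for k
    using E.integrable_permute[OF _ shift_inj, of "\<lambda>x. \<bar>g 0 x\<bar> powr r" k]
      E.integral_permute[OF _ shift_inj, of "\<lambda>x. \<bar>g 0 x\<bar> powr r" k] gr by (simp_all add: g_shift)
  have le: "\<bar>\<Sum>k\<in>J. g k x\<bar> powr r \<le> card J powr (r - 1) * (\<Sum>k\<in>J. \<bar>g k x\<bar> powr r)" for x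
    using J r by (intro abs_sum_powr_le) auto
  have i: "integrable expo_seq (\<lambda>x. card J powr (r - 1) * (\<Sum>k\<in>J. \<bar>g k x\<bar> powr r))"
    by (intro integrable_mult_right Bochner_Integration.integrable_sum gk)
  show I: "integrable expo_seq (\<lambda>x. \<bar>\<Sum>k\<in>J. g k x\<bar> powr r)"
    by (rule Bochner_Integration.integrable_bound[OF i]) (use le in \<open>auto intro!: AE_I2 intro: order_trans[OF _ abs_ge_self]\<close>)
  have "(\<integral>x. \<bar>\<Sum>k\<in>J. g k x\<bar> powr r \<partial>expo_seq) \<le> (\<integral>x. card J powr (r - 1) * (\<Sum>k\<in>J. \<bar>g k x\<bar> powr r) \<partial>expo_seq)"
    by (rule integral_mono[OF I i le])
  also have "\<dots> = card J powr (r - 1) * (card J * ?M)"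
  proof -
    have "(\<Sum>k\<in>J. \<integral>x. \<bar>g k x\<bar> powr r \<partial>expo_seq) = (\<Sum>k\<in>J. ?M)"
      by (intro sum.cong refl gk(2))
    also have "\<dots> = card J * ?M" by simp
    finally show ?thesis
      by (simp only: integral_mult_right_zero Bochner_Integration.integral_sum[OF gk(1)])
  qed
  also have "\<dots> \<le> m powr (r - 1) * (m * ?M)"
    using J r M0 by (intro mult_mono powr_mono2 mult_nonneg_nonneg) auto
  also have "\<dots> = m powr r * ?M" using m_pos by (simp add: powr_diff)
  finally show "(\<integral>x. \<bar>\<Sum>k\<in>J. g k x\<bar> powr r \<partial>expo_seq) \<le> m powr r * ?M" .
qed

text \<open>The \<open>g\<close>-part is controlled by its r-th moment and the
  \<open>dev\<close>-part by its fourth. When the block exceeds \<epsilon>, the larger part exceeds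
  \<open>\<epsilon> / 2\<close>, so its square may be multiplied by a positive power of a ratio
  above 1, as in Markov's inequality.\<close>

lemma block_tail_bound:
  assumes r: "r > 2" and gr: "integrable expo_seq (\<lambda>x. \<bar>g 0 x\<bar> powr r)" and \<epsilon>: "\<epsilon> > 0"
  shows "(\<integral>x. (block \<alpha> \<beta> i x)\<^sup>2 * (if \<bar>block \<alpha> \<beta> i x\<bar> > \<epsilon> then 1 else 0) \<partial>expo_seq)
    \<le> 4 * (2 / \<epsilon>) powr (r - 2) * (\<bar>\<alpha>\<bar> powr r * (m powr r * (\<integral>x. \<bar>g 0 x\<bar> powr r \<partial>expo_seq)))
      + 4 * (2 / \<epsilon>)\<^sup>2 * (\<beta> ^ 4 * (9 * (real m)\<^sup>2))"
proof -
  let ?J = "{i*m..<Suc i*m}"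
  let ?a = "\<lambda>x. \<alpha> * (\<Sum>k\<in>?J. g k x)" and ?b = "\<lambda>x. \<beta> * (\<Sum>k=i*m..<i*m+m. dev k x)"
  let ?M = "\<integral>x. \<bar>g 0 x\<bar> powr r \<partial>expo_seq"
  interpret D: one_dependent expo m "block \<alpha> \<beta>" by (rule one_dependent_block)
  have J: "finite ?J" "card ?J \<le> m" by auto
  have ab: "block \<alpha> \<beta> i x = ?a x + ?b x" for x
    by (simp add: block_def \<xi>_def sum.distrib sum_distrib_left add.commute)
  have ia: "integrable expo_seq (\<lambda>x. \<bar>?a x\<bar> powr r)"
    and a: "(\<integral>x. \<bar>?a x\<bar> powr r \<partial>expo_seq) \<le> \<bar>\<alpha>\<bar> powr r * (m powr r * ?M)"
    using g_sum_moment[OF r gr J] by (auto simp: abs_mult powr_mult intro!: mult_left_mono)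
  have ib: "integrable expo_seq (\<lambda>x. ?b x ^ 4)" and b: "(\<integral>x. ?b x ^ 4 \<partial>expo_seq) \<le> \<beta> ^ 4 * (9 * (real m)\<^sup>2)"
    using dev_sum_fourth[of "i*m" m] by (auto simp: power_mult_distrib intro!: mult_left_mono)
  have point: "(block \<alpha> \<beta> i x)\<^sup>2 * (if \<bar>block \<alpha> \<beta> i x\<bar> > \<epsilon> then 1 else 0)
      \<le> 4 * (2 / \<epsilon>) powr (r - 2) * \<bar>?a x\<bar> powr r + 4 * (2 / \<epsilon>)\<^sup>2 * ?b x ^ 4" for x
  proof -
    define A B where "A = ?a x" and "B = ?b x"
    have "(A + B)\<^sup>2 \<le> 4 * (2 / \<epsilon>) powr (r - 2) * \<bar>A\<bar> powr r + 4 * (2 / \<epsilon>)\<^sup>2 * B ^ 4" if gt: "\<bar>A + B\<bar> > \<epsilon>"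
    proof (cases "\<bar>B\<bar> \<le> \<bar>A\<bar>")
      case True
      have A: "\<bar>A\<bar> > \<epsilon> / 2" and le: "\<bar>A + B\<bar> \<le> 2 * \<bar>A\<bar>" using gt True by linarith+
      have "(A + B)\<^sup>2 \<le> (2 * \<bar>A\<bar>)\<^sup>2" using le by (metis abs_ge_zero power2_abs power_mono)
      also have "\<dots> = 4 * \<bar>A\<bar> powr 2" using A \<epsilon> by (simp add: powr_numeral)
      also have "\<bar>A\<bar> powr 2 \<le> (2 * \<bar>A\<bar> / \<epsilon>) powr (r - 2) * \<bar>A\<bar> powr 2"
        using A \<epsilon> r by (intro mult_le_cancel_right1[THEN iffD2] conjI impI ge_one_powr_ge_zero) (auto simp: field_simps)
      also have "\<dots> = (2 / \<epsilon>) powr (r - 2) * \<bar>A\<bar> powr r"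
        using A \<epsilon> by (simp add: powr_mult powr_divide powr_diff)
      finally have "(A + B)\<^sup>2 \<le> 4 * ((2 / \<epsilon>) powr (r - 2) * \<bar>A\<bar> powr r)" by simp
      moreover have "0 \<le> 4 * (2 / \<epsilon>)\<^sup>2 * B ^ 4" by simp
      ultimately show ?thesis by linarith
    next
      case False
      have B: "\<bar>B\<bar> > \<epsilon> / 2" and le: "\<bar>A + B\<bar> \<le> 2 * \<bar>B\<bar>" using gt False by linarith+
      have "(A + B)\<^sup>2 \<le> (2 * \<bar>B\<bar>)\<^sup>2" using le by (metis abs_ge_zero power2_abs power_mono)
      also have "\<dots> = 4 * (1 * B\<^sup>2)" by (simp add: power_mult_distrib)
      also have "1 * B\<^sup>2 \<le> (2 * \<bar>B\<bar> / \<epsilon>)\<^sup>2 * B\<^sup>2"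
        using B \<epsilon> by (intro mult_right_mono one_le_power) (auto simp: field_simps)
      also have "\<dots> = (2 / \<epsilon>)\<^sup>2 * B ^ 4"
        by (simp add: power_mult_distrib power_divide power2_eq_square power4_eq_xxxx)
      finally have "(A + B)\<^sup>2 \<le> 4 * ((2 / \<epsilon>)\<^sup>2 * B ^ 4)" by simp
      moreover have "0 \<le> 4 * (2 / \<epsilon>) powr (r - 2) * \<bar>A\<bar> powr r" by simp
      ultimately show ?thesis by linarith
    qed
    moreover have "0 \<le> 4 * (2 / \<epsilon>) powr (r - 2) * \<bar>A\<bar> powr r + 4 * (2 / \<epsilon>)\<^sup>2 * B ^ 4" by simp
    ultimately show ?thesis unfolding ab A_def[symmetric] B_def[symmetric] by simp
  qed
  have I: "integrable expo_seq (\<lambda>x. 4 * (2 / \<epsilon>) powr (r - 2) * \<bar>?a x\<bar> powr r + 4 * (2 / \<epsilon>)\<^sup>2 * ?b x ^ 4)"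
    by (intro Bochner_Integration.integrable_add integrable_mult_right ia ib)
  have "(\<integral>x. (block \<alpha> \<beta> i x)\<^sup>2 * (if \<bar>block \<alpha> \<beta> i x\<bar> > \<epsilon> then 1 else 0) \<partial>expo_seq)
    \<le> (\<integral>x. 4 * (2 / \<epsilon>) powr (r - 2) * \<bar>?a x\<bar> powr r + 4 * (2 / \<epsilon>)\<^sup>2 * ?b x ^ 4 \<partial>expo_seq)"
  proof (rule integral_mono[OF _ I point])
    show "integrable expo_seq (\<lambda>x. (block \<alpha> \<beta> i x)\<^sup>2 * (if \<bar>block \<alpha> \<beta> i x\<bar> > \<epsilon> then 1 else 0))"
      by (rule Bochner_Integration.integrable_bound[OF D.\<eta>_square[of i]]) auto
  qed
  also have "\<dots> = 4 * (2 / \<epsilon>) powr (r - 2) * (\<integral>x. \<bar>?a x\<bar> powr r \<partial>expo_seq) + 4 * (2 / \<epsilon>)\<^sup>2 * (\<integral>x. ?b x ^ 4 \<partial>expo_seq)"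
    using ia ib by (subst Bochner_Integration.integral_add) (simp_all only: integrable_mult_right integral_mult_right_zero)
  also have "\<dots> \<le> 4 * (2 / \<epsilon>) powr (r - 2) * (\<bar>\<alpha>\<bar> powr r * (m powr r * ?M)) + 4 * (2 / \<epsilon>)\<^sup>2 * (\<beta> ^ 4 * (9 * (real m)\<^sup>2))"
    using a b by (intro add_mono mult_left_mono) auto
  finally show ?thesis .
qed

text \<open>Serves for the incomplete stretch at the end of a sum. Values up to \<epsilon> count as
  \<epsilon>, and larger ones are dominated by the r-th power.\<close>

lemma g_sum_abs_bound:
  assumes r: "r > 2" and gr: "integrable expo_seq (\<lambda>x. \<bar>g 0 x\<bar> powr r)" and \<epsilon>: "\<epsilon> > 0"
    and J: "finite J" "card J \<le> m"
  shows "(\<integral>x. \<bar>\<alpha> * (\<Sum>k\<in>J. g k x)\<bar> \<partial>expo_seq)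
    \<le> \<epsilon> + \<epsilon> powr (1 - r) * (\<bar>\<alpha>\<bar> powr r * (m powr r * (\<integral>x. \<bar>g 0 x\<bar> powr r \<partial>expo_seq)))"
proof -
  let ?a = "\<lambda>x. \<alpha> * (\<Sum>k\<in>J. g k x)"
  let ?M = "\<integral>x. \<bar>g 0 x\<bar> powr r \<partial>expo_seq"
  have ia: "integrable expo_seq (\<lambda>x. \<bar>?a x\<bar> powr r)"
    and a: "(\<integral>x. \<bar>?a x\<bar> powr r \<partial>expo_seq) \<le> \<bar>\<alpha>\<bar> powr r * (m powr r * ?M)"
    using g_sum_moment[OF r gr J] by (auto simp: abs_mult powr_mult intro!: mult_left_mono)
  have point: "\<bar>y\<bar> \<le> \<epsilon> + \<epsilon> powr (1 - r) * \<bar>y\<bar> powr r" for y :: real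
  proof (cases "\<bar>y\<bar> \<le> \<epsilon>")
    case False
    have "\<bar>y\<bar> = \<bar>y\<bar> powr (1 - r) * \<bar>y\<bar> powr r" using False \<epsilon> by (simp flip: powr_add)
    also have "\<dots> \<le> \<epsilon> powr (1 - r) * \<bar>y\<bar> powr r"
      using False \<epsilon> r by (intro mult_right_mono powr_mono2') auto
    finally show ?thesis using \<epsilon> by linarith
  qed (use \<epsilon> in \<open>simp add: add_increasing2\<close>)
  have "(\<integral>x. \<bar>?a x\<bar> \<partial>expo_seq) \<le> (\<integral>x. \<epsilon> + \<epsilon> powr (1 - r) * \<bar>?a x\<bar> powr r \<partial>expo_seq)"
  proof (rule integral_mono[OF _ _ point])
    show "integrable expo_seq (\<lambda>x. \<bar>?a x\<bar>)"
      unfolding g_eq_\<xi> by (intro integrable_abs integrable_mult_right Bochner_Integration.integrable_sum \<xi>_integrable)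
    show "integrable expo_seq (\<lambda>x. \<epsilon> + \<epsilon> powr (1 - r) * \<bar>?a x\<bar> powr r)" using ia by simp
  qed
  also have "\<dots> = \<epsilon> + \<epsilon> powr (1 - r) * (\<integral>x. \<bar>?a x\<bar> powr r \<partial>expo_seq)" using ia by simp
  also have "\<dots> \<le> \<epsilon> + \<epsilon> powr (1 - r) * (\<bar>\<alpha>\<bar> powr r * (m powr r * ?M))"
    using a by (intro add_left_mono mult_left_mono) auto
  finally show ?thesis .
qed

end

section \<open>Joint central limit theorem for the exponentials\<close>

text \<open>The hypotheses of the theorem in canonical form. They are required only for large
  \<open>n\<close>, since their identification with the cyclic quantities uses
  \<open>2 * m n <= n\<close>.\<close>

locale spacing_array =
  fixes m :: "nat \<Rightarrow> nat" and h :: "nat \<Rightarrow> real \<Rightarrow> real" and \<sigma> :: "nat \<Rightarrow> real" and r :: real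
  assumes ws: "\<forall>\<^sub>F n in sequentially. window_statistic (m n) (h n)"
    and \<sigma>_pos: "\<forall>\<^sub>F n in sequentially. \<sigma> n > 0"
    and \<sigma>_eq: "\<forall>\<^sub>F n in sequentially. (\<sigma> n)\<^sup>2 = window_statistic.s2 (m n) (h n)"
    and m_small: "(\<lambda>n. m n / n) \<longlonglongrightarrow> 0"
    and r: "r > 2"
    and g_moment: "\<forall>\<^sub>F n in sequentially. integrable expo_seq (\<lambda>x. \<bar>window_statistic.g (m n) (h n) 0 x\<bar> powr r)"
    and lyapunov: "(\<lambda>n. m n powr (r - 1) / (n powr ((r - 2) / 2) * \<sigma> n powr r)
        * (\<integral>x. \<bar>window_statistic.g (m n) (h n) 0 x\<bar> powr r \<partial>expo_seq)) \<longlonglongrightarrow> 0"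
begin

abbreviation gn :: "nat \<Rightarrow> nat \<Rightarrow> (nat \<Rightarrow> real) \<Rightarrow> real" where
  "gn n \<equiv> window_statistic.g (m n) (h n)"

definition L :: "nat \<Rightarrow> real" where
  "L n = m n powr (r - 1) / (n powr ((r - 2) / 2) * \<sigma> n powr r) * (\<integral>x. \<bar>gn n 0 x\<bar> powr r \<partial>expo_seq)"

lemma L_lim: "L \<longlonglongrightarrow> 0" using lyapunov by (simp add: L_def[abs_def])

text \<open>The moment bound for one normalised block is \<open>m n / n\<close> times the Lyapunov
  ratio \<open>L n\<close>. Since a row has of the order of n / m blocks, their total is of order
  \<open>L n\<close>, which tends to 0.\<close>

lemma block_moment_eq:
  assumes "n > 0" "\<sigma> n > 0" "m n > 0"
  shows "\<bar>u / (\<sigma> n * sqrt n)\<bar> powr r * (m n powr r * (\<integral>x. \<bar>gn n 0 x\<bar> powr r \<partial>expo_seq)) = \<bar>u\<bar> powr r * (m n / n * L n)"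
proof -
  have "\<bar>u / (\<sigma> n * sqrt n)\<bar> powr r = \<bar>u\<bar> powr r / (\<sigma> n powr r * n powr (r / 2))"
    using assms by (simp add: abs_mult powr_divide powr_mult powr_powr flip: powr_half_sqrt)
  moreover have "m n powr r = m n powr (r - 1) * m n" using assms by (simp add: powr_diff)
  moreover have "real n powr (r / 2) = n powr ((r - 2) / 2) * n"
  proof -
    have "real n powr (r / 2) = n powr ((r - 2) / 2 + 1)" by (simp add: diff_divide_distrib)
    also have "\<dots> = n powr ((r - 2) / 2) * n" unfolding powr_add using assms by simp
    finally show ?thesis .
  qed
  ultimately show ?thesis by (simp add: L_def mult_ac)
qed

text \<open>\<open>one_dependent_clt\<close> is applied to the blocks of \<open>\<xi>\<close>. The
  limit has no term mixing \<open>u\<close> and \<open>w\<close>, so the two sums are asymptotically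
  independent. The second sum runs up to \<open>K n + m n\<close> because the \<open>g\<close>-terms
  of the first read that many coordinates.\<close>

lemma joint_char:
  assumes K: "(\<lambda>n. K n / n) \<longlonglongrightarrow> \<alpha>" and \<alpha>: "\<alpha> > 0"
  shows "(\<lambda>n. CLINT x|expo_seq. iexp (u / (\<sigma> n * sqrt n) * (\<Sum>k<K n. gn n k x) + w / sqrt n * (\<Sum>i<K n + m n. dev i x)))
    \<longlonglongrightarrow> complex_of_real (exp (- (\<alpha> * (u\<^sup>2 + w\<^sup>2)) / 2))"
proof -
  define \<alpha>' where "\<alpha>' n = u / (\<sigma> n * sqrt n)" for n
  define \<beta>' where "\<beta>' n = w / sqrt n" for n
  define \<eta> where "\<eta> n = window_statistic.block (m n) (h n) (\<alpha>' n) (\<beta>' n)" for n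
  define N where "N n = K n div m n" for n
  define g0 where "g0 n = (\<integral>x. (\<eta> n 0 x)\<^sup>2 \<partial>expo_seq)" for n
  define g1 where "g1 n = (\<integral>x. \<eta> n 0 x * \<eta> n 1 x \<partial>expo_seq)" for n
  define lam where "lam \<epsilon> n = 4 * (2 / \<epsilon>) powr (r - 2) * (\<bar>u\<bar> powr r * (m n / n * L n)) + 4 * (2 / \<epsilon>)\<^sup>2 * (\<beta>' n ^ 4 * (9 * (real (m n))\<^sup>2))" for \<epsilon> n
  have npos: "\<forall>\<^sub>F n in sequentially. (n::nat) > 0" by (rule eventually_gt_at_top)
  have mpos: "\<forall>\<^sub>F n in sequentially. m n > 0"
    using ws by eventually_elim (auto dest: window_statistic.m_pos)
  have mN_le: "N n * m n \<le> K n" for n unfolding N_def by simp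
  have mN_ge: "\<forall>\<^sub>F n in sequentially. K n \<le> N n * m n + m n"
    using mpos
  proof eventually_elim
    case (elim n)
    have "K n mod m n < m n" using elim by simp
    thus ?case using div_mult_mod_eq[of "K n" "m n"] unfolding N_def by linarith
  qed
  have Nm: "(\<lambda>n. N n * m n / n) \<longlonglongrightarrow> \<alpha>"
  proof (rule tendsto_sandwich[OF _ _ _ K])
    show "\<forall>\<^sub>F n in sequentially. K n / n - m n / n \<le> N n * m n / n"
      using mN_ge
    proof eventually_elim
      case (elim n)
      have "real (K n) - m n \<le> real (N n * m n)" using elim by linarith
      hence "(real (K n) - m n) / n \<le> real (N n * m n) / n" by (rule divide_right_mono) simp
      thus ?case by (simp add: diff_divide_distrib)
    qed
    show "\<forall>\<^sub>F n in sequentially. N n * m n / n \<le> K n / n"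
      using mN_le by (intro always_eventually allI divide_right_mono) (simp_all only: of_nat_le_iff of_nat_0_le_iff)
    show "(\<lambda>n. K n / n - m n / n) \<longlonglongrightarrow> \<alpha>" using tendsto_diff[OF K m_small] by simp
  qed
  have N_top: "filterlim N at_top sequentially"
  proof -
    have "filterlim (\<lambda>n. (N n * m n / n) * inverse (m n / n)) at_top sequentially"
    proof (rule filterlim_tendsto_pos_mult_at_top[OF Nm \<alpha>])
      show "filterlim (\<lambda>n. inverse (m n / real n)) at_top sequentially"
      proof (rule filterlim_inverse_at_top[OF m_small])
        show "\<forall>\<^sub>F n in sequentially. 0 < real (m n) / real n" using npos mpos by eventually_elim simp
      qed
    qed
    moreover have "\<forall>\<^sub>F n in sequentially. (N n * m n / n) * inverse (m n / n) = real (N n)"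
      using npos mpos by eventually_elim simp
    ultimately have "filterlim (\<lambda>n. real (N n)) at_top sequentially"
      by (rule filterlim_cong[OF refl refl, THEN iffD1, rotated])
    thus ?thesis by (simp only: filterlim_at_top eventually_sequentially) (metis of_nat_le_iff)
  qed
  have main: "(\<lambda>n. CLINT x|expo_seq. iexp (\<Sum>i<N n. \<eta> n i x)) \<longlonglongrightarrow> complex_of_real (exp (- (\<alpha> * (u\<^sup>2 + w\<^sup>2)) / 2))"
  proof (rule E.one_dependent_clt)
    show "\<forall>\<^sub>F n in sequentially. one_dependent expo (m n) (\<eta> n)"
      unfolding \<eta>_def using ws by eventually_elim (rule window_statistic.one_dependent_block)
    show "\<forall>\<^sub>F n in sequentially. \<forall>i. (\<integral>x. (\<eta> n i x)\<^sup>2 \<partial>expo_seq) = g0 n"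
      using ws
    proof eventually_elim
      case (elim n)
      interpret window_statistic "m n" "h n" by (rule elim)
      show ?case unfolding g0_def \<eta>_def using block_stationary[of "\<lambda>u v. u\<^sup>2" "\<alpha>' n" "\<beta>' n"] by simp
    qed
    show "\<forall>\<^sub>F n in sequentially. \<forall>i. (\<integral>x. \<eta> n i x * \<eta> n (Suc i) x \<partial>expo_seq) = g1 n"
      using ws
    proof eventually_elim
      case (elim n)
      interpret window_statistic "m n" "h n" by (rule elim)
      show ?case unfolding g1_def \<eta>_def using block_stationary[of "\<lambda>u v. u * v" "\<alpha>' n" "\<beta>' n"] by simp
    qed
    show "\<forall>\<^sub>F n in sequentially. \<forall>i. (\<integral>x. (\<eta> n i x)\<^sup>2 * (if \<bar>\<eta> n i x\<bar> > \<epsilon> then 1 else 0) \<partial>expo_seq) \<le> lam \<epsilon> n"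
      if \<epsilon>: "\<epsilon> > 0" for \<epsilon>
      using ws npos mpos \<sigma>_pos g_moment
    proof eventually_elim
      case (elim n)
      interpret window_statistic "m n" "h n" by (rule elim)
      show ?case
        using block_tail_bound[OF r elim(5) \<epsilon>, of "\<alpha>' n" "\<beta>' n"]
        unfolding lam_def \<eta>_def \<alpha>'_def block_moment_eq[OF elim(2,4,3)] by blast
    qed
    show "(\<lambda>n. N n * lam \<epsilon> n) \<longlonglongrightarrow> 0" if \<epsilon>: "\<epsilon> > 0" for \<epsilon>
    proof -
      \<comment> \<open>As \<open>N n * m n / n\<close> converges, the \<open>g\<close>-part
        vanishes through \<open>L n\<close> and the \<open>dev\<close>-part through
        \<open>m n / n\<close>.\<close>
      have "(\<lambda>n. 4 * (2 / \<epsilon>) powr (r - 2) * (\<bar>u\<bar> powr r * (N n * m n / n * L n)) + 4 * (2 / \<epsilon>)\<^sup>2 * (9 * w ^ 4) * (N n * m n / n * (m n / n)))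
        \<longlonglongrightarrow> 4 * (2 / \<epsilon>) powr (r - 2) * (\<bar>u\<bar> powr r * (\<alpha> * 0)) + 4 * (2 / \<epsilon>)\<^sup>2 * (9 * w ^ 4) * (\<alpha> * 0)"
        by (intro tendsto_add tendsto_mult tendsto_const Nm L_lim m_small)
      moreover have "\<forall>\<^sub>F n in sequentially. 4 * (2 / \<epsilon>) powr (r - 2) * (\<bar>u\<bar> powr r * (N n * m n / n * L n)) + 4 * (2 / \<epsilon>)\<^sup>2 * (9 * w ^ 4) * (N n * m n / n * (m n / n)) = N n * lam \<epsilon> n"
        using npos
      proof eventually_elim
        case (elim n)
        have b4: "\<beta>' n ^ 4 = w ^ 4 / (real n)\<^sup>2"
        proof -
          have "sqrt n ^ 4 = sqrt n ^ (2 * 2)" by simp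
          also have "\<dots> = (sqrt n ^ 2) ^ 2" by (rule power_mult)
          also have "\<dots> = (real n)\<^sup>2" by simp
          finally show ?thesis by (simp add: \<beta>'_def power_divide)
        qed
        show ?case unfolding lam_def b4 using elim by (simp add: field_simps power2_eq_square)
      qed
      ultimately show ?thesis by (simp add: tendsto_cong)
    qed
    show "filterlim N at_top sequentially" by (rule N_top)
    have "(\<lambda>n. (N n * m n / n) * (u\<^sup>2 + w\<^sup>2)) \<longlonglongrightarrow> \<alpha> * (u\<^sup>2 + w\<^sup>2)"
      by (intro tendsto_mult Nm tendsto_const)
    moreover have "\<forall>\<^sub>F n in sequentially. (N n * m n / n) * (u\<^sup>2 + w\<^sup>2) = N n * (g0 n + 2 * g1 n)"
      using ws npos \<sigma>_pos \<sigma>_eq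
    proof eventually_elim
      case (elim n)
      interpret window_statistic "m n" "h n" by (rule elim)
      have "g0 n + 2 * g1 n = m n * ((\<alpha>' n)\<^sup>2 * s2 + (\<beta>' n)\<^sup>2)"
        unfolding g0_def g1_def \<eta>_def using block_covariance[of "\<alpha>' n" "\<beta>' n" 0] by simp
      also have "(\<alpha>' n)\<^sup>2 * s2 + (\<beta>' n)\<^sup>2 = (u\<^sup>2 + w\<^sup>2) / n"
        unfolding elim(4)[symmetric] \<alpha>'_def \<beta>'_def using elim(2,3) by (simp add: power_divide power_mult_distrib add_divide_distrib)
      finally show ?case by simp
    qed
    ultimately show "(\<lambda>n. N n * (g0 n + 2 * g1 n)) \<longlonglongrightarrow> \<alpha> * (u\<^sup>2 + w\<^sup>2)"
      by (rule Lim_transform_eventually)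
  qed
  let ?T = "\<lambda>n x. u / (\<sigma> n * sqrt n) * (\<Sum>k<K n. gn n k x) + w / sqrt n * (\<Sum>i<K n + m n. dev i x)"
  \<comment> \<open>The blocks miss at most \<open>m n\<close> of the \<open>g\<close>-terms and at
    most \<open>2 * m n\<close> of the \<open>dev\<close>-terms; the former are bounded by the r-th
    moment, the latter by their variance.\<close>
  have diff: "\<forall>\<^sub>F n in sequentially. cmod ((CLINT x|expo_seq. iexp (?T n x)) - (CLINT x|expo_seq. iexp (\<Sum>i<N n. \<eta> n i x)))
      \<le> \<epsilon> + \<epsilon> powr (1 - r) * (\<bar>u\<bar> powr r * (m n / n * L n)) + sqrt (2 * w\<^sup>2 * (m n / n))" if \<epsilon>: "\<epsilon> > 0" for \<epsilon>
    using ws npos mpos \<sigma>_pos g_moment mN_ge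
  proof eventually_elim
    case (elim n)
    interpret window_statistic "m n" "h n" by (rule elim)
    let ?J = "{N n * m n..<K n}" and ?I = "{N n * m n..<K n + m n}"
    let ?A = "\<lambda>x. \<alpha>' n * (\<Sum>k\<in>?J. g k x)" and ?B = "\<lambda>x. \<beta>' n * (\<Sum>i\<in>?I. dev i x)"
    have blocks: "(\<Sum>i<q. \<eta> n i x) = (\<Sum>k<q * m n. \<xi> (\<alpha>' n) (\<beta>' n) k x)" for q x
    proof (induction q)
      case (Suc q)
      have "(\<Sum>k<Suc q * m n. \<xi> (\<alpha>' n) (\<beta>' n) k x) = (\<Sum>k<q * m n. \<xi> (\<alpha>' n) (\<beta>' n) k x) + (\<Sum>k=q * m n..<Suc q * m n. \<xi> (\<alpha>' n) (\<beta>' n) k x)"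
        unfolding lessThan_atLeast0 by (rule sum.atLeastLessThan_concat[symmetric]) auto
      thus ?case using Suc by (simp add: \<eta>_def block_def)
    qed simp
    have eq: "?T n x - (\<Sum>i<N n. \<eta> n i x) = ?A x + ?B x" for x
    proof -
      have "(\<Sum>k<K n. g k x) = (\<Sum>k<N n * m n. g k x) + (\<Sum>k\<in>?J. g k x)"
        unfolding lessThan_atLeast0 using mN_le by (intro sum.atLeastLessThan_concat[symmetric]) auto
      moreover have "(\<Sum>i<K n + m n. dev i x) = (\<Sum>i<N n * m n. dev i x) + (\<Sum>i\<in>?I. dev i x)"
        unfolding lessThan_atLeast0 using mN_le[of n] by (intro sum.atLeastLessThan_concat[symmetric]) auto
      ultimately show ?thesis
        unfolding blocks \<xi>_def by (simp add: \<alpha>'_def \<beta>'_def sum.distrib sum_distrib_left algebra_simps)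
    qed
    have iA: "integrable expo_seq ?A"
      unfolding g_eq_\<xi> by (intro integrable_mult_right Bochner_Integration.integrable_sum \<xi>_integrable)
    have iB: "integrable expo_seq ?B"
      by (intro integrable_mult_right Bochner_Integration.integrable_sum dev_moments)
    have [measurable]: "\<eta> n i \<in> borel_measurable seqs" for i unfolding \<eta>_def by measurable
    have "cmod ((CLINT x|expo_seq. iexp (?T n x)) - (CLINT x|expo_seq. iexp (\<Sum>i<N n. \<eta> n i x))) \<le> (\<integral>x. \<bar>?A x + ?B x\<bar> \<partial>expo_seq)"
      unfolding eq[symmetric]
    proof (rule E.char_diff_le)
      show "integrable expo_seq (\<lambda>x. ?T n x - (\<Sum>i<N n. \<eta> n i x))"
        unfolding eq by (intro Bochner_Integration.integrable_add iA iB)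
    qed measurable
    also have "\<dots> \<le> (\<integral>x. \<bar>?A x\<bar> + \<bar>?B x\<bar> \<partial>expo_seq)"
      using iA iB by (intro integral_mono) auto
    also have "\<dots> = (\<integral>x. \<bar>?A x\<bar> \<partial>expo_seq) + (\<integral>x. \<bar>?B x\<bar> \<partial>expo_seq)"
      using iA iB by simp
    also have "(\<integral>x. \<bar>?A x\<bar> \<partial>expo_seq) \<le> \<epsilon> + \<epsilon> powr (1 - r) * (\<bar>u\<bar> powr r * (m n / n * L n))"
      using g_sum_abs_bound[OF r elim(5) \<epsilon>, of ?J "\<alpha>' n"] elim(6)
      unfolding \<alpha>'_def block_moment_eq[OF elim(2,4,3)] by simp
    also have "(\<integral>x. \<bar>?B x\<bar> \<partial>expo_seq) \<le> sqrt (2 * w\<^sup>2 * (m n / n))"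
    proof -
      define q where "q = K n + m n - N n * m n"
      have q: "?I = {N n * m n..<N n * m n + q}" "q \<le> 2 * m n" using elim(6) mN_le[of n] by (auto simp: q_def)
      have sq: "integrable expo_seq (\<lambda>x. (?B x)\<^sup>2)" "(\<integral>x. (?B x)\<^sup>2 \<partial>expo_seq) = (\<beta>' n)\<^sup>2 * q"
        unfolding power_mult_distrib q using dev_sum_fourth[of "N n * m n" q] by auto
      have "(\<integral>x. \<bar>?B x\<bar> \<partial>expo_seq) \<le> sqrt (\<integral>x. (?B x)\<^sup>2 \<partial>expo_seq)"
        by (rule set_integral_abs_le_square[OF E.P.prob_space_axioms _ sq(1)]) measurable
      also have "\<dots> \<le> sqrt (2 * w\<^sup>2 * (m n / n))"
      proof (rule real_sqrt_le_mono)
        have "(\<beta>' n)\<^sup>2 * q = w\<^sup>2 / n * q" using elim by (simp add: \<beta>'_def power_divide)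
        also have "\<dots> \<le> w\<^sup>2 / n * (2 * m n)" using q(2) by (intro mult_left_mono) auto
        finally show "(\<integral>x. (?B x)\<^sup>2 \<partial>expo_seq) \<le> 2 * w\<^sup>2 * (m n / n)" unfolding sq by (simp add: mult_ac)
      qed
      finally show ?thesis .
    qed
    finally show ?case by simp
  qed
  have "(\<lambda>n. (CLINT x|expo_seq. iexp (?T n x)) - (CLINT x|expo_seq. iexp (\<Sum>i<N n. \<eta> n i x))) \<longlonglongrightarrow> 0"
  proof (rule tendstoI)
    fix e :: real assume e: "e > 0"
    have "(\<lambda>n. e / 2 + (e / 2) powr (1 - r) * (\<bar>u\<bar> powr r * (m n / n * L n)) + sqrt (2 * w\<^sup>2 * (m n / n)))
      \<longlonglongrightarrow> e / 2 + (e / 2) powr (1 - r) * (\<bar>u\<bar> powr r * (0 * 0)) + sqrt (2 * w\<^sup>2 * 0)"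
      by (intro tendsto_add tendsto_mult tendsto_const tendsto_real_sqrt m_small L_lim)
    note lim = this
    have "\<forall>\<^sub>F n in sequentially. e / 2 + (e / 2) powr (1 - r) * (\<bar>u\<bar> powr r * (m n / n * L n)) + sqrt (2 * w\<^sup>2 * (m n / n)) < e"
      using order_tendstoD(2)[OF lim, of e] e by simp
    moreover have "e / 2 > 0" using e by simp
    note diff[OF this]
    ultimately show "\<forall>\<^sub>F n in sequentially. dist ((CLINT x|expo_seq. iexp (?T n x)) - (CLINT x|expo_seq. iexp (\<Sum>i<N n. \<eta> n i x))) 0 < e"
      by eventually_elim (simp only: dist_norm diff_zero order_le_less_trans)
  qed
  from tendsto_add[OF this main] show ?thesis by simp
qed

end

section \<open>Limit of the density of the initial gaps\<close>

text \<open>Up to a constant, the density in \<open>spacing_law_initial\<close> for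
  \<open>c = n\<close>: \<open>l = n - k\<close> is the number of gaps left, and \<open>y\<close> is
  the excess of the sum of the first \<open>k\<close> gaps over \<open>k\<close>.\<close>

definition gamma_ratio :: "nat \<Rightarrow> real \<Rightarrow> real" where
  "gamma_ratio l y = exp y * (max 0 (1 - y / l)) ^ (l - 1)"

lemma gamma_ratio_measurable [measurable]: "gamma_ratio l \<in> borel_measurable borel"
  unfolding gamma_ratio_def by measurable

lemma gamma_ratio_nonneg: "0 \<le> gamma_ratio l y"
  by (simp add: gamma_ratio_def)

text \<open>From 1 - x <= exp(-x) the ratio is at most exp(y / l), and \<open>y < l\<close> where it
  is positive. This uniform bound handles the region outside the range of locally uniform
  convergence.\<close>

lemma gamma_ratio_le:
  assumes "l \<ge> 2"
  shows "gamma_ratio l y \<le> 3"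
proof (cases "1 - y / l > 0")
  case False
  hence "max 0 (1 - y / l) = 0" by simp
  moreover have "l - 1 \<noteq> 0" using assms by simp
  ultimately show ?thesis by (simp only: gamma_ratio_def power_0_left if_False)
next
  case True
  have "(1 - y / l) ^ (l - 1) \<le> exp (- y / l) ^ (l - 1)"
    using True exp_ge_add_one_self[of "- y / l"] by (intro power_mono) auto
  also have "\<dots> = exp (- y + y / l)"
    using assms by (simp flip: exp_of_nat_mult) (simp add: of_nat_diff field_simps)
  finally have "gamma_ratio l y \<le> exp y * exp (- y + y / l)"
    using True by (simp add: gamma_ratio_def max_def)
  also have "\<dots> = exp (y / l)" by (simp flip: exp_add)
  also have "\<dots> \<le> exp 1" using True by simp
  also have "\<dots> \<le> 3" by (rule exp_le)
  finally show ?thesis .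
qed

lemma ln_third_order:
  fixes x :: real
  assumes "\<bar>x\<bar> \<le> 1 / 2"
  shows "\<bar>ln (1 - x) + x + x\<^sup>2 / 2\<bar> \<le> 2 * \<bar>x\<bar> ^ 3"
proof -
  let ?f = "\<lambda>x::real. ln (1 - x) + x + x\<^sup>2 / 2" and ?f' = "\<lambda>x::real. - x\<^sup>2 / (1 - x)"
  have "norm (?f x - ?f 0) \<le> 2 * x\<^sup>2 * norm (x - 0)"
  proof (rule field_differentiable_bound[of "{- \<bar>x\<bar>..\<bar>x\<bar>}" ?f ?f'])
    fix y assume y: "y \<in> {- \<bar>x\<bar>..\<bar>x\<bar>}"
    hence y1: "1 - y \<ge> 1 / 2" using assms by auto
    show "(?f has_field_derivative ?f' y) (at y within {- \<bar>x\<bar>..\<bar>x\<bar>})"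
      using y1 by (auto intro!: derivative_eq_intros simp: field_simps power2_eq_square)
    have "y\<^sup>2 \<le> x\<^sup>2" using y by (intro abs_le_square_iff[THEN iffD1]) auto
    have "norm (?f' y) = y\<^sup>2 / (1 - y)" using y1 by (simp add: abs_divide)
    also have "\<dots> \<le> x\<^sup>2 / (1 / 2)" using y1 \<open>y\<^sup>2 \<le> x\<^sup>2\<close> by (intro frac_le) auto
    finally show "norm (?f' y) \<le> 2 * x\<^sup>2" by simp
  qed auto
  thus ?thesis by (simp add: power2_eq_square power3_eq_cube abs_mult mult_ac)
qed

lemma exp_diff_le:
  assumes "a \<le> 1" "b \<le> 1"
  shows "\<bar>exp a - exp b\<bar> \<le> 3 * \<bar>a - b :: real\<bar>"
proof -
  have "norm (exp a - exp b) \<le> 3 * norm (a - b)"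
  proof (rule field_differentiable_bound[of "{..1::real}" exp exp])
    show "norm (exp z) \<le> 3" if "z \<in> {..1}" for z :: real
      using that exp_le by (simp add: order_trans[OF _ exp_le])
  qed (use assms in \<open>auto intro: DERIV_subset[OF DERIV_exp]\<close>)
  thus ?thesis by simp
qed

text \<open>
  The density of the first spacings relative to independent exponentials converges locally
  uniformly, on the scale of the central limit theorem, to a Gaussian kernel.
\<close>

lemma gamma_ratio_limit:
  assumes l: "(\<lambda>n. l n / n) \<longlonglongrightarrow> \<beta>" and \<beta>: "\<beta> > 0" and e: "e > 0" and A: "A > 0"
  shows "\<forall>\<^sub>F n in sequentially. \<forall>s. \<bar>s\<bar> \<le> A \<longrightarrow> \<bar>gamma_ratio (l n) (sqrt n * s) - exp (- s\<^sup>2 / (2 * \<beta>))\<bar> \<le> e"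
proof -
  define X where "X n = A * sqrt n / l n" for n
  define B where "B n = X n + (X n)\<^sup>2 + \<bar>n / l n - 1 / \<beta>\<bar> * A\<^sup>2 + 2 * (n / l n) * A\<^sup>2 * X n" for n
  have nl: "(\<lambda>n. n / l n) \<longlonglongrightarrow> 1 / \<beta>"
    using tendsto_inverse[OF l] \<beta> by (simp add: inverse_eq_divide)
  have npos: "\<forall>\<^sub>F n in sequentially. (n::nat) > 0" by (rule eventually_gt_at_top)
  have isq: "(\<lambda>n. 1 / sqrt (real n)) \<longlonglongrightarrow> 0"
    using tendsto_inverse_0_at_top[OF filterlim_compose[OF sqrt_at_top filterlim_real_sequentially]]
    by (simp add: inverse_eq_divide)
  have "(\<lambda>n. A * (n / l n) * (1 / sqrt n)) \<longlonglongrightarrow> A * (1 / \<beta>) * 0"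
    by (intro tendsto_mult nl isq tendsto_const)
  moreover have "\<forall>\<^sub>F n in sequentially. A * (n / l n) * (1 / sqrt n) = X n"
    using npos
  proof eventually_elim
    case (elim n)
    have "real n / sqrt n = sqrt n" by (rule real_div_sqrt) simp
    moreover have "A * (n / l n) * (1 / sqrt n) = A * (real n / sqrt n) / l n" by simp
    ultimately show ?case by (simp only: X_def)
  qed
  ultimately have X: "X \<longlonglongrightarrow> 0" by (simp add: tendsto_cong)
  have "B \<longlonglongrightarrow> 0 + 0\<^sup>2 + \<bar>1 / \<beta> - 1 / \<beta>\<bar> * A\<^sup>2 + 2 * (1 / \<beta>) * A\<^sup>2 * 0"
    unfolding B_def by (intro tendsto_add tendsto_mult tendsto_power tendsto_rabs tendsto_diff X nl tendsto_const)
  hence B: "B \<longlonglongrightarrow> 0" by simp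
  have "min (e / 3) 1 > 0" using e by simp
  hence evB: "\<forall>\<^sub>F n in sequentially. B n < min (e / 3) 1" by (rule order_tendstoD(2)[OF B])
  have evX: "\<forall>\<^sub>F n in sequentially. X n < 1 / 2" using order_tendstoD(2)[OF X, of "1 / 2"] by simp
  have evl: "\<forall>\<^sub>F n in sequentially. l n / real n > 0" using order_tendstoD(1)[OF l \<beta>] .
  show ?thesis using evB evX evl npos
  proof eventually_elim
    case (elim n)
    have lpos: "l n \<ge> 1" using elim(3) by (auto simp: Suc_le_eq zero_less_divide_iff)
    show ?case
    proof (intro allI impI)
      fix s assume s: "\<bar>s\<bar> \<le> A"
      define x where "x = sqrt n * s / l n"
      have xX: "\<bar>x\<bar> \<le> X n"
        using s lpos unfolding x_def X_def by (simp add: abs_mult mult.commute[of A] divide_right_mono mult_left_mono)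
      have x12: "\<bar>x\<bar> \<le> 1 / 2" using xX elim by linarith
      hence x1: "1 - x > 0" by linarith
      define R where "R = ln (1 - x) + x + x\<^sup>2 / 2"
      have R: "\<bar>R\<bar> \<le> 2 * \<bar>x\<bar> ^ 3" unfolding R_def by (rule ln_third_order[OF x12])
      \<comment> \<open>\<open>y\<close> is the logarithm of the ratio. Expanding
        \<open>ln (1 - x)\<close>, the leading terms \<open>l n * x\<close> cancel, and
        \<open>l n * x\<^sup>2 / 2 = (n / l n) * s\<^sup>2 / 2\<close> gives the Gaussian exponent;
        all other contributions are collected in \<open>B n\<close>.\<close>
      define y where "y = l n * x + (real (l n) - 1) * ln (1 - x)"
      have "gamma_ratio (l n) (sqrt n * s) = exp (l n * x) * (1 - x) ^ (l n - 1)"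
        using x1 lpos by (simp add: gamma_ratio_def x_def max_def)
      also have "(1 - x) ^ (l n - 1) = exp ((real (l n) - 1) * ln (1 - x))"
      proof -
        have e: "real (l n) - 1 = real (l n - 1)" using lpos by (simp add: of_nat_diff)
        show ?thesis unfolding e exp_of_nat_mult using x1 by simp
      qed
      finally have q: "gamma_ratio (l n) (sqrt n * s) = exp y" by (simp add: y_def exp_add)
      have lx2: "l n * x\<^sup>2 = (n / l n) * s\<^sup>2"
        using lpos by (simp add: x_def power_divide power_mult_distrib power2_eq_square[of "real (l n)"])
      have s2: "s\<^sup>2 \<le> A\<^sup>2" using s by (metis abs_ge_zero power2_abs power_mono)
      have "y - (- s\<^sup>2 / (2 * \<beta>)) = x + x\<^sup>2 / 2 - (l n * x\<^sup>2) / 2 + s\<^sup>2 / (2 * \<beta>) + (real (l n) - 1) * R"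
        unfolding y_def R_def by (simp add: field_simps)
      also have "\<dots> = x + x\<^sup>2 / 2 - (n / l n - 1 / \<beta>) * s\<^sup>2 / 2 + (real (l n) - 1) * R"
        unfolding lx2 by (simp add: algebra_simps diff_divide_distrib)
      also have "\<bar>\<dots>\<bar> \<le> \<bar>x\<bar> + x\<^sup>2 / 2 + \<bar>n / l n - 1 / \<beta>\<bar> * s\<^sup>2 / 2 + l n * (2 * \<bar>x\<bar> ^ 3)"
      proof -
        have "\<bar>(real (l n) - 1) * R\<bar> \<le> l n * (2 * \<bar>x\<bar> ^ 3)"
          unfolding abs_mult using R lpos by (intro mult_mono) auto
        moreover have "\<bar>(n / l n - 1 / \<beta>) * s\<^sup>2 / 2\<bar> = \<bar>n / l n - 1 / \<beta>\<bar> * s\<^sup>2 / 2"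
          by (simp add: abs_mult)
        moreover have "\<bar>x\<^sup>2 / 2\<bar> = x\<^sup>2 / 2" by simp
        ultimately show ?thesis by linarith
      qed
      also have "l n * (2 * \<bar>x\<bar> ^ 3) = 2 * (n / l n) * s\<^sup>2 * \<bar>x\<bar>"
      proof -
        have "l n * (2 * \<bar>x\<bar> ^ 3) = 2 * (l n * x\<^sup>2) * \<bar>x\<bar>" by (simp add: power3_eq_cube power2_eq_square)
        thus ?thesis unfolding lx2 by simp
      qed
      also have "\<bar>x\<bar> + x\<^sup>2 / 2 + \<bar>n / l n - 1 / \<beta>\<bar> * s\<^sup>2 / 2 + 2 * (n / l n) * s\<^sup>2 * \<bar>x\<bar> \<le> B n"
      proof -
        have "x\<^sup>2 / 2 \<le> (X n)\<^sup>2"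
          using power_mono[OF xX, of 2] by (simp add: power2_abs) (smt (verit) zero_le_power2)
        moreover have "\<bar>n / l n - 1 / \<beta>\<bar> * s\<^sup>2 / 2 \<le> \<bar>n / l n - 1 / \<beta>\<bar> * A\<^sup>2"
        proof -
          have "\<bar>n / l n - 1 / \<beta>\<bar> * s\<^sup>2 \<le> \<bar>n / l n - 1 / \<beta>\<bar> * A\<^sup>2" using s2 by (intro mult_left_mono) auto
          moreover have "0 \<le> \<bar>n / l n - 1 / \<beta>\<bar> * s\<^sup>2" by simp
          moreover have "z / 2 \<le> z'" if "z \<le> z'" "0 \<le> z" for z z' :: real using that by simp
          ultimately show ?thesis by blast
        qed
        moreover have "2 * (n / l n) * s\<^sup>2 * \<bar>x\<bar> \<le> 2 * (n / l n) * A\<^sup>2 * X n"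
          using s2 xX by (intro mult_mono mult_left_mono) auto
        ultimately show ?thesis using xX unfolding B_def by linarith
      qed
      finally have diff: "\<bar>y - (- s\<^sup>2 / (2 * \<beta>))\<bar> \<le> B n" .
      have neg: "- s\<^sup>2 / (2 * \<beta>) \<le> 0" using \<beta> by simp
      have "y \<le> 1" using diff neg elim(1) by linarith
      hence "\<bar>exp y - exp (- s\<^sup>2 / (2 * \<beta>))\<bar> \<le> 3 * \<bar>y - (- s\<^sup>2 / (2 * \<beta>))\<bar>"
        using neg by (intro exp_diff_le) auto
      also have "\<dots> \<le> 3 * B n" using diff by simp
      also have "\<dots> \<le> e" using elim(1) by (simp add: field_simps)
      finally show "\<bar>gamma_ratio (l n) (sqrt n * s) - exp (- s\<^sup>2 / (2 * \<beta>))\<bar> \<le> e" unfolding q .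
    qed
  qed
qed

text \<open>Locally uniform convergence covers centred sums of order sqrt n. Elsewhere the integrand
  is at most 4 and Chebyshev's inequality makes the probability small.\<close>

lemma gamma_ratio_expectation:
  assumes l: "(\<lambda>n. l n / n) \<longlonglongrightarrow> \<beta>" and \<beta>: "\<beta> > 0" and k: "\<forall>\<^sub>F n in sequentially. k n \<le> n"
  shows "(\<lambda>n. \<integral>x. \<bar>gamma_ratio (l n) (\<Sum>i<k n. dev i x) - exp (- ((\<Sum>i<k n. dev i x) / sqrt n)\<^sup>2 / (2 * \<beta>))\<bar> \<partial>expo_seq) \<longlonglongrightarrow> 0"
proof (rule tendstoI)
  fix e :: real assume e: "e > 0"
  \<comment> \<open>Makes the Chebyshev part \<open>4 / A\<^sup>2\<close> equal to
    \<open>e / 2\<close>; together with the uniform error \<open>e / 4\<close> this stays below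
    \<open>e\<close>.\<close>
  define A where "A = sqrt (8 / e)"
  have A: "A > 0" "A\<^sup>2 = 8 / e" using e by (auto simp: A_def)
  have l_top: "\<forall>\<^sub>F n in sequentially. l n \<ge> 2"
  proof -
    have "\<forall>\<^sub>F n in sequentially. l n / real n > \<beta> / 2" using order_tendstoD(1)[OF l, of "\<beta> / 2"] \<beta> by simp
    moreover have "\<forall>\<^sub>F n in sequentially. n \<ge> nat \<lceil>4 / \<beta>\<rceil> + 1" by (rule eventually_ge_at_top)
    ultimately show ?thesis
    proof eventually_elim
      case (elim n)
      have "4 / \<beta> \<le> n" using elim(2) by linarith
      hence "4 \<le> n * \<beta>" using \<beta> by (simp add: field_simps)
      moreover have "real n > 0" using elim(2) by linarith
      hence "n * \<beta> < 2 * l n" using elim(1) by (simp add: field_simps)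
      ultimately have "4 < 2 * real (l n)" by linarith
      thus ?case by linarith
    qed
  qed
  have e4: "e / 4 > 0" using e by simp
  show "\<forall>\<^sub>F n in sequentially. dist (\<integral>x. \<bar>gamma_ratio (l n) (\<Sum>i<k n. dev i x) - exp (- ((\<Sum>i<k n. dev i x) / sqrt n)\<^sup>2 / (2 * \<beta>))\<bar> \<partial>expo_seq) 0 < e"
    using gamma_ratio_limit[OF l \<beta> e4 A(1)] l_top k eventually_gt_at_top[of 0]
  proof eventually_elim
    case (elim n)
    let ?D = "\<lambda>x. \<Sum>i<k n. dev i x"
    let ?F = "\<lambda>x. \<bar>gamma_ratio (l n) (?D x) - exp (- (?D x / sqrt n)\<^sup>2 / (2 * \<beta>))\<bar>"
    have D: "integrable expo_seq (\<lambda>x. (?D x)\<^sup>2)" "(\<integral>x. (?D x)\<^sup>2 \<partial>expo_seq) = k n"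
      using dev_sum_fourth[of 0 "k n"] by (auto simp: lessThan_atLeast0)
    have F3: "?F x \<le> 4" for x
    proof -
      have "exp (- (?D x / sqrt n)\<^sup>2 / (2 * \<beta>)) \<le> 1" using \<beta> by simp
      moreover have "0 \<le> exp (- (?D x / sqrt n)\<^sup>2 / (2 * \<beta>))" by simp
      ultimately show ?thesis using gamma_ratio_le[OF elim(2), of "?D x"] gamma_ratio_nonneg[of "l n" "?D x"] by linarith
    qed
    have point: "?F x \<le> e / 4 + 4 / (A\<^sup>2 * n) * (?D x)\<^sup>2" for x
    proof (cases "\<bar>?D x / sqrt n\<bar> \<le> A")
      case True
      have "\<bar>gamma_ratio (l n) (sqrt n * (?D x / sqrt n)) - exp (- (?D x / sqrt n)\<^sup>2 / (2 * \<beta>))\<bar> \<le> e / 4"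
        using elim(1) True by blast
      moreover have "sqrt n * (?D x / sqrt n) = ?D x" using elim(4) by simp
      moreover have "0 \<le> 4 / (A\<^sup>2 * n) * (?D x)\<^sup>2" by simp
      ultimately show ?thesis by (simp only:)
    next
      case False
      hence "A\<^sup>2 \<le> \<bar>?D x / sqrt n\<bar>\<^sup>2" using A by (intro power_mono) auto
      hence "A\<^sup>2 \<le> (?D x)\<^sup>2 / n" by (simp add: power_divide)
      hence "1 \<le> (?D x)\<^sup>2 / (A\<^sup>2 * n)" using A(1) elim(4) by (simp add: field_simps)
      hence "4 \<le> 4 / (A\<^sup>2 * n) * (?D x)\<^sup>2" by simp
      thus ?thesis using F3[of x] e by linarith
    qed
    have "(\<integral>x. ?F x \<partial>expo_seq) \<le> (\<integral>x. e / 4 + 4 / (A\<^sup>2 * n) * (?D x)\<^sup>2 \<partial>expo_seq)"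
    proof (rule integral_mono[OF _ _ point])
      show "integrable expo_seq ?F"
        by (rule E.P.integrable_const_bound[of _ 4]) (use F3 in auto)
      show "integrable expo_seq (\<lambda>x. e / 4 + 4 / (A\<^sup>2 * n) * (?D x)\<^sup>2)" using D by simp
    qed
    also have "\<dots> = e / 4 + 4 / (A\<^sup>2 * n) * k n" using D by simp
    also have "\<dots> \<le> e / 4 + 4 / A\<^sup>2"
    proof -
      have "real (k n) / n \<le> 1" using elim(3,4) by simp
      hence "4 / A\<^sup>2 * (real (k n) / n) \<le> 4 / A\<^sup>2 * 1" by (intro mult_left_mono) auto
      thus ?thesis by simp
    qed
    also have "\<dots> = 3 / 4 * e" unfolding A(2) using e by simp
    also have "\<dots> < e" using e by simp
    finally have "(\<integral>x. ?F x \<partial>expo_seq) < e" .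
    moreover have "0 \<le> (\<integral>x. ?F x \<partial>expo_seq)" by simp
    ultimately show ?case by (simp only: dist_real_def)
  qed
qed

text \<open>The normalising constant is not computed: the formula for the constant function 1 shows
  it to be the reciprocal of the expected ratio.\<close>

lemma spacing_law_initial_complex:
  fixes F :: "(nat \<Rightarrow> real) \<Rightarrow> complex"
  assumes F [measurable]: "F \<in> borel_measurable seqs" and dep: "depends_on {..<k} F" and k: "k + 2 \<le> n"
  shows "(CLINT d|spacing_law (n - 1) n. F d) =
    (CLINT x|expo_seq. F x * gamma_ratio (n - k) (\<Sum>i<k. dev i x)) /
    (\<integral>x. gamma_ratio (n - k) (\<Sum>i<k. dev i x) \<partial>expo_seq)"
proof -
  define N where "N = n - 1"
  have kN: "k < N" and Nk: "n - Suc k = N - k" using k by (auto simp: N_def)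
  define \<rho> where "\<rho> x = fact N / real n ^ N * (exp (psum k x) * (max 0 (n - psum k x)) ^ (N - k) / fact (N - k))" for x :: "nat \<Rightarrow> real"
  define q where "q x = gamma_ratio (n - k) (\<Sum>i<k. dev i x)" for x
  define Cc where "Cc = fact N / real n ^ N * (exp k * (real (n - k)) ^ (N - k) / fact (N - k))"
  have \<rho>_meas [measurable]: "\<rho> \<in> borel_measurable seqs" unfolding \<rho>_def by measurable
  have q_meas [measurable]: "q \<in> borel_measurable seqs" unfolding q_def by measurable
  have \<rho>0: "0 \<le> \<rho> x" for x by (simp add: \<rho>_def)
  have dev_psum: "(\<Sum>i<k. dev i x) = psum k x - k" for x by (simp add: dev_def psum_def sum_subtractf)
  have \<rho>q: "\<rho> x = Cc * q x" for x
  proof -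
    have l: "real (n - k) > 0" "real (n - k) = n - k" using k by auto
    have "real (n - k) * (1 - (psum k x - k) / real (n - k)) = n - psum k x"
    proof -
      have "L * (1 - z / L) = L - z" if "L \<noteq> 0" for L z :: real using that by (simp add: right_diff_distrib)
      from this[of "real (n - k)" "psum k x - k"]
      have "real (n - k) * (1 - (psum k x - k) / real (n - k)) = real (n - k) - (psum k x - k)"
        using l(1) by linarith
      thus ?thesis using k by (simp add: of_nat_diff)
    qed
    moreover have "real (n - k) * max 0 (1 - (psum k x - k) / real (n - k)) = max 0 (real (n - k) * (1 - (psum k x - k) / real (n - k)))"
      using l by (simp add: max_def zero_le_mult_iff)
    ultimately have "(max 0 (n - psum k x)) ^ (N - k) = real (n - k) ^ (N - k) * (max 0 (1 - (psum k x - k) / real (n - k))) ^ (N - k)"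
      by (simp flip: power_mult_distrib)
    moreover have "exp (psum k x) = exp k * exp (psum k x - k)" by (simp flip: exp_add)
    ultimately show ?thesis
      by (simp add: \<rho>_def q_def Cc_def gamma_ratio_def dev_psum Nk)
  qed
  have distr_eq: "distr (spacing_law N n) seqs (trunc k) = distr (density expo_seq (\<lambda>x. ennreal (\<rho> x))) seqs (trunc k)"
  proof (rule measure_eqI)
    fix A assume "A \<in> sets (distr (spacing_law N n) seqs (trunc k))"
    hence A [measurable]: "A \<in> sets seqs" by simp
    have dA: "depends_on {..<k} (\<lambda>x. indicator A (trunc k x) :: ennreal)"
    proof (rule depends_onI)
      fix x y :: "nat \<Rightarrow> real" assume "\<And>i. i \<in> {..<k} \<Longrightarrow> x i = y i"
      hence "trunc k x = trunc k y" by (auto simp: trunc_def)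
      thus "indicator A (trunc k x) = (indicator A (trunc k y) :: ennreal)" by simp
    qed
    have "emeasure (distr (spacing_law N n) seqs (trunc k)) A = (\<integral>\<^sup>+d. indicator A (trunc k d) \<partial>spacing_law N n)"
      by (subst nn_integral_indicator[symmetric], simp, rule nn_integral_distr) measurable
    also have "\<dots> = ennreal (fact N / real n ^ N) * (\<integral>\<^sup>+x. indicator A (trunc k x) * ennreal (exp (psum k x) * (max 0 (n - psum k x)) ^ (N - k) / fact (N - k)) \<partial>expo_seq)"
      by (rule spacing_law_initial[OF _ dA kN]) measurable
    also have "\<dots> = (\<integral>\<^sup>+x. ennreal (fact N / real n ^ N) * (indicator A (trunc k x) * ennreal (exp (psum k x) * (max 0 (n - psum k x)) ^ (N - k) / fact (N - k))) \<partial>expo_seq)"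
      by (rule nn_integral_cmult[symmetric]) measurable
    also have "\<dots> = (\<integral>\<^sup>+x. ennreal (\<rho> x) * indicator A (trunc k x) \<partial>expo_seq)"
      unfolding \<rho>_def by (intro nn_integral_cong, subst ennreal_mult') (auto simp: mult_ac)
    also have "\<dots> = (\<integral>\<^sup>+x. indicator A (trunc k x) \<partial>density expo_seq (\<lambda>x. ennreal (\<rho> x)))"
      by (rule nn_integral_density[symmetric]) measurable
    also have "\<dots> = emeasure (distr (density expo_seq (\<lambda>x. ennreal (\<rho> x))) seqs (trunc k)) A"
    proof (rule sym)
      show "emeasure (distr (density expo_seq (\<lambda>x. ennreal (\<rho> x))) seqs (trunc k)) A = (\<integral>\<^sup>+x. indicator A (trunc k x) \<partial>density expo_seq (\<lambda>x. ennreal (\<rho> x)))"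
        by (subst nn_integral_indicator[symmetric], simp, rule nn_integral_distr) measurable
    qed
    finally show "emeasure (distr (spacing_law N n) seqs (trunc k)) A = emeasure (distr (density expo_seq (\<lambda>x. ennreal (\<rho> x))) seqs (trunc k)) A" .
  qed simp
  have transfer: "(CLINT d|spacing_law N n. G d) = Cc * (CLINT x|expo_seq. G x * q x)"
    if [measurable]: "G \<in> borel_measurable seqs" and dG: "depends_on {..<k} G" for G :: "(nat \<Rightarrow> real) \<Rightarrow> complex"
  proof -
    have tr: "G (trunc k x) = G x" for x using depends_on_trunc[OF dG] by simp
    have "(CLINT d|spacing_law N n. G d) = (CLINT d|distr (spacing_law N n) seqs (trunc k). G d)"
      by (subst integral_distr) (simp_all add: tr)
    also have "\<dots> = (CLINT x|density expo_seq (\<lambda>x. ennreal (\<rho> x)). G x)"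
      unfolding distr_eq by (subst integral_distr) (simp_all add: tr)
    also have "\<dots> = (CLINT x|expo_seq. \<rho> x *\<^sub>R G x)"
      by (rule integral_density) (use \<rho>0 in auto)
    also have "\<dots> = (CLINT x|expo_seq. Cc * (G x * q x))"
      by (simp add: \<rho>q scaleR_conv_of_real mult_ac)
    finally show ?thesis by simp
  qed
  have n0: "real n > 0" using k by simp
  interpret SL: prob_space "spacing_law N n" by (rule prob_space_spacing_law[OF n0])
  have "(CLINT d|spacing_law N n. 1) = complex_of_real Cc * (CLINT x|expo_seq. complex_of_real (q x))"
    using transfer[of "\<lambda>_. 1"] by (simp add: depends_on_def)
  hence "complex_of_real 1 = complex_of_real (Cc * (\<integral>x. q x \<partial>expo_seq))"
    using SL.prob_space by (simp add: integral_complex_of_real)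
  hence "Cc * (\<integral>x. q x \<partial>expo_seq) = 1" by (simp only: of_real_eq_iff)
  hence "Cc = 1 / (\<integral>x. q x \<partial>expo_seq)" by (metis mult_zero_right nonzero_eq_divide_eq zero_neq_one)
  thus ?thesis using transfer[OF F dep] by (simp add: q_def N_def)
qed

section \<open>Central limit theorem for partial sums over spacings\<close>

context spacing_array
begin

text \<open>In L1 the weight may be replaced by a Gaussian kernel in the scaled sum
  \<open>S\<close>. Writing the kernel as a normal mixture of exponentials reduces the claim to
  \<open>joint_char\<close> and dominated convergence. By asymptotic independence the mixture
  variable contributes the factor \<kappa>, which does not involve \<open>u\<close>.\<close>

lemma weighted_char:
  fixes \<alpha> :: real
  assumes K: "(\<lambda>n. K n / n) \<longlonglongrightarrow> \<alpha>" and \<alpha>: "0 < \<alpha>" "\<alpha> < 1"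
  defines "\<kappa> \<equiv> \<integral>z. exp (- (\<alpha> * (z / sqrt (1 - \<alpha>))\<^sup>2) / 2) \<partial>std_normal_distribution"
  shows "(\<lambda>n. CLINT x|expo_seq. iexp (u / (\<sigma> n * sqrt n) * (\<Sum>k<K n. gn n k x))
      * gamma_ratio (n - (K n + m n)) (\<Sum>i<K n + m n. dev i x)) \<longlonglongrightarrow> complex_of_real (exp (- (\<alpha> * u\<^sup>2) / 2) * \<kappa>)"
proof -
  interpret Z: real_distribution std_normal_distribution by (rule real_dist_normal_dist)
  interpret EZ: pair_sigma_finite expo_seq std_normal_distribution
    by (intro pair_sigma_finite.intro E.P.sigma_finite_measure_axioms Z.sigma_finite_measure_axioms)
  define \<beta> where "\<beta> = 1 - \<alpha>"
  have \<beta>: "\<beta> > 0" using \<alpha> by (simp add: \<beta>_def)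
  define k where "k n = K n + m n" for n
  define l where "l n = n - k n" for n
  define G where "G n x = u / (\<sigma> n * sqrt n) * (\<Sum>k<K n. gn n k x)" for n x
  define S where "S n x = (\<Sum>i<k n. dev i x) / sqrt n" for n x
  have npos: "\<forall>\<^sub>F n in sequentially. (n::nat) > 0" by (rule eventually_gt_at_top)
  have kn: "(\<lambda>n. k n / n) \<longlonglongrightarrow> \<alpha>"
    using tendsto_add[OF K m_small] by (simp add: k_def[abs_def] add_divide_distrib)
  have k_le: "\<forall>\<^sub>F n in sequentially. k n \<le> n"
    using order_tendstoD(2)[OF kn \<alpha>(2)] npos by eventually_elim simp
  have ln: "(\<lambda>n. l n / n) \<longlonglongrightarrow> \<beta>"
  proof (rule Lim_transform_eventually)
    show "(\<lambda>n. 1 - k n / n) \<longlonglongrightarrow> \<beta>" unfolding \<beta>_def by (intro tendsto_diff tendsto_const kn)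
    show "\<forall>\<^sub>F n in sequentially. 1 - k n / n = l n / n"
      using k_le npos by eventually_elim (simp add: l_def of_nat_diff diff_divide_distrib)
  qed
  have G_meas: "\<forall>\<^sub>F n in sequentially. G n \<in> borel_measurable seqs"
    using ws
  proof eventually_elim
    case (elim n)
    interpret window_statistic "m n" "h n" by (rule elim)
    show ?case unfolding G_def by measurable
  qed
  have S_meas [measurable]: "S n \<in> borel_measurable seqs" for n unfolding S_def by measurable
  let ?s = "\<lambda>n z. CLINT x|expo_seq. iexp (G n x + z / sqrt \<beta> * S n x)"
  have jc: "(\<lambda>n. ?s n z) \<longlonglongrightarrow> complex_of_real (exp (- (\<alpha> * (u\<^sup>2 + (z / sqrt \<beta>)\<^sup>2)) / 2))" for z
    using joint_char[OF K \<alpha>(1), of u "z / sqrt \<beta>"] by (simp add: G_def S_def k_def)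
  \<comment> \<open>\<open>G n\<close> is known to be measurable only for large \<open>n\<close>;
    the value 0 in the remaining rows makes dominated convergence applicable to the whole
    sequence.\<close>
  have "(\<lambda>n. CLINT z|std_normal_distribution. (if G n \<in> borel_measurable seqs then ?s n z else 0)) \<longlonglongrightarrow>
      (CLINT z|std_normal_distribution. complex_of_real (exp (- (\<alpha> * (u\<^sup>2 + (z / sqrt \<beta>)\<^sup>2)) / 2)))"
  proof (rule integral_dominated_convergence[where w = "\<lambda>_. 1"])
    show "(\<lambda>z. if G n \<in> borel_measurable seqs then ?s n z else 0) \<in> borel_measurable std_normal_distribution" for n
    proof (cases "G n \<in> borel_measurable seqs")
      case True
      note [measurable] = True
      have "(\<lambda>z. ?s n z) \<in> borel_measurable borel"
        by (rule E.P.borel_measurable_lebesgue_integral) measurable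
      thus ?thesis using True by simp
    qed simp
    show "AE z in std_normal_distribution. (\<lambda>n. if G n \<in> borel_measurable seqs then ?s n z else 0) \<longlonglongrightarrow> complex_of_real (exp (- (\<alpha> * (u\<^sup>2 + (z / sqrt \<beta>)\<^sup>2)) / 2))"
    proof (rule AE_I2)
      fix z
      show "(\<lambda>n. if G n \<in> borel_measurable seqs then ?s n z else 0) \<longlonglongrightarrow> complex_of_real (exp (- (\<alpha> * (u\<^sup>2 + (z / sqrt \<beta>)\<^sup>2)) / 2))"
        by (rule Lim_transform_eventually[OF jc]) (use G_meas in \<open>eventually_elim, simp\<close>)
    qed
    show "AE z in std_normal_distribution. norm (if G n \<in> borel_measurable seqs then ?s n z else 0) \<le> 1" for n
    proof (rule AE_I2)
      fix z
      have "norm (?s n z) \<le> 1" if "G n \<in> borel_measurable seqs"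
      proof -
        note [measurable] = that
        have "norm (?s n z) \<le> (\<integral>x. 1 \<partial>expo_seq)"
          by (rule norm_integral_le) (auto intro!: E.P.integrable_const_bound[of _ 1])
        thus ?thesis by simp
      qed
      thus "norm (if G n \<in> borel_measurable seqs then ?s n z else 0) \<le> 1" by simp
    qed
  qed simp_all
  also have "(CLINT z|std_normal_distribution. complex_of_real (exp (- (\<alpha> * (u\<^sup>2 + (z / sqrt \<beta>)\<^sup>2)) / 2))) = complex_of_real (exp (- (\<alpha> * u\<^sup>2) / 2) * \<kappa>)"
  proof -
    have "exp (- (\<alpha> * (u\<^sup>2 + (z / sqrt \<beta>)\<^sup>2)) / 2) = exp (- (\<alpha> * u\<^sup>2) / 2) * exp (- (\<alpha> * (z / sqrt \<beta>)\<^sup>2) / 2)" for z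
    proof -
      have "- (\<alpha> * (u\<^sup>2 + (z / sqrt \<beta>)\<^sup>2)) / 2 = - (\<alpha> * u\<^sup>2) / 2 + - (\<alpha> * (z / sqrt \<beta>)\<^sup>2) / 2"
        by (simp only: distrib_left add_divide_distrib minus_add_distrib)
      thus ?thesis by (simp only: exp_add)
    qed
    thus ?thesis by (simp only: integral_complex_of_real integral_mult_right_zero \<kappa>_def \<beta>_def)
  qed
  finally have lim1: "(\<lambda>n. CLINT z|std_normal_distribution. (if G n \<in> borel_measurable seqs then ?s n z else 0)) \<longlonglongrightarrow> complex_of_real (exp (- (\<alpha> * u\<^sup>2) / 2) * \<kappa>)" .
  \<comment> \<open>After Fubini the inner integral over \<open>z\<close> is the standard normal
    characteristic function at \<open>S n x / sqrt \<beta>\<close>, that is, the Gaussian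
    kernel.\<close>
  have swap: "\<forall>\<^sub>F n in sequentially. (CLINT z|std_normal_distribution. (if G n \<in> borel_measurable seqs then ?s n z else 0))
      = (CLINT x|expo_seq. iexp (G n x) * complex_of_real (exp (- (S n x)\<^sup>2 / (2 * \<beta>))))"
    using G_meas
  proof eventually_elim
    case (elim n)
    note [measurable] = elim
    have "(CLINT z|std_normal_distribution. ?s n z) = (CLINT x|expo_seq. (CLINT z|std_normal_distribution. iexp (G n x + z / sqrt \<beta> * S n x)))"
    proof (rule EZ.Fubini_integral)
      interpret EZP: pair_prob_space expo_seq std_normal_distribution ..
      show "integrable (expo_seq \<Otimes>\<^sub>M std_normal_distribution) (\<lambda>(x, z). iexp (G n x + z / sqrt \<beta> * S n x))"
        by (rule EZP.P.integrable_const_bound[of _ 1]) (auto simp: split_beta')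
    qed
    also have "\<dots> = (CLINT x|expo_seq. iexp (G n x) * complex_of_real (exp (- (S n x)\<^sup>2 / (2 * \<beta>))))"
    proof (rule Bochner_Integration.integral_cong[OF refl])
      fix x
      have "(CLINT z|std_normal_distribution. iexp (G n x + z / sqrt \<beta> * S n x)) = (CLINT z|std_normal_distribution. iexp (G n x) * iexp (S n x / sqrt \<beta> * z))"
        by (simp add: distrib_left exp_add mult_ac)
      also have "\<dots> = iexp (G n x) * char std_normal_distribution (S n x / sqrt \<beta>)"
        unfolding char_def by simp
      also have "char std_normal_distribution (S n x / sqrt \<beta>) = complex_of_real (exp (- (S n x)\<^sup>2 / (2 * \<beta>)))"
        unfolding char_std_normal_distribution using \<beta> by (simp add: power_divide mult.commute)
      finally show "(CLINT z|std_normal_distribution. iexp (G n x + z / sqrt \<beta> * S n x)) = iexp (G n x) * complex_of_real (exp (- (S n x)\<^sup>2 / (2 * \<beta>)))" .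
    qed
    finally show ?case using elim by simp
  qed
  have lim2: "(\<lambda>n. CLINT x|expo_seq. iexp (G n x) * complex_of_real (exp (- (S n x)\<^sup>2 / (2 * \<beta>)))) \<longlonglongrightarrow> complex_of_real (exp (- (\<alpha> * u\<^sup>2) / 2) * \<kappa>)"
    by (rule Lim_transform_eventually[OF lim1 swap])
  let ?q = "\<lambda>n x. gamma_ratio (l n) (\<Sum>i<k n. dev i x)"
  have l2: "\<forall>\<^sub>F n in sequentially. l n \<ge> 2"
  proof -
    have "\<forall>\<^sub>F n in sequentially. l n / real n > \<beta> / 2" using order_tendstoD(1)[OF ln, of "\<beta> / 2"] \<beta> by simp
    moreover have "\<forall>\<^sub>F n in sequentially. n \<ge> nat \<lceil>4 / \<beta>\<rceil> + 1" by (rule eventually_ge_at_top)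
    ultimately show ?thesis
    proof eventually_elim
      case (elim n)
      have "4 / \<beta> \<le> n" using elim(2) by linarith
      hence "4 \<le> n * \<beta>" using \<beta> by (simp add: field_simps)
      moreover have "real n > 0" using elim(2) by linarith
      hence "n * \<beta> < 2 * l n" using elim(1) by (simp add: field_simps)
      ultimately have "4 < 2 * real (l n)" by linarith
      thus ?case by linarith
    qed
  qed
  have "(\<lambda>n. (CLINT x|expo_seq. iexp (G n x) * complex_of_real (?q n x)) - (CLINT x|expo_seq. iexp (G n x) * complex_of_real (exp (- (S n x)\<^sup>2 / (2 * \<beta>))))) \<longlonglongrightarrow> 0"
  proof (rule Lim_null_comparison[OF _ gamma_ratio_expectation[OF ln \<beta> k_le]])
    show "\<forall>\<^sub>F n in sequentially. norm ((CLINT x|expo_seq. iexp (G n x) * complex_of_real (?q n x)) - (CLINT x|expo_seq. iexp (G n x) * complex_of_real (exp (- (S n x)\<^sup>2 / (2 * \<beta>)))))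
      \<le> (\<integral>x. \<bar>?q n x - exp (- ((\<Sum>i<k n. dev i x) / sqrt n)\<^sup>2 / (2 * \<beta>))\<bar> \<partial>expo_seq)"
      using G_meas l2
    proof eventually_elim
      case (elim n)
      note [measurable] = elim(1)
      have q3: "\<bar>?q n x\<bar> \<le> 3" for x
        using gamma_ratio_le[OF elim(2)] gamma_ratio_nonneg by (simp add: abs_of_nonneg)
      have e1: "\<bar>exp (- (S n x)\<^sup>2 / (2 * \<beta>))\<bar> \<le> 1" for x using \<beta> by simp
      have i1: "integrable expo_seq (\<lambda>x. iexp (G n x) * complex_of_real (?q n x))"
        by (rule E.P.integrable_const_bound[of _ 3]) (use q3 in \<open>auto simp: norm_mult\<close>)
      have i2: "integrable expo_seq (\<lambda>x. iexp (G n x) * complex_of_real (exp (- (S n x)\<^sup>2 / (2 * \<beta>))))"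
        by (rule E.P.integrable_const_bound[of _ 1]) (use e1 in \<open>auto simp: norm_mult\<close>)
      have i3: "integrable expo_seq (\<lambda>x. \<bar>?q n x - exp (- (S n x)\<^sup>2 / (2 * \<beta>))\<bar>)"
      proof (rule E.P.integrable_const_bound[of _ 4])
        have "\<bar>?q n x - exp (- (S n x)\<^sup>2 / (2 * \<beta>))\<bar> \<le> 4" for x using q3[of x] e1[of x] by linarith
        thus "AE x in expo_seq. norm \<bar>?q n x - exp (- (S n x)\<^sup>2 / (2 * \<beta>))\<bar> \<le> 4" by simp
      qed measurable
      have "norm ((CLINT x|expo_seq. iexp (G n x) * complex_of_real (?q n x)) - (CLINT x|expo_seq. iexp (G n x) * complex_of_real (exp (- (S n x)\<^sup>2 / (2 * \<beta>)))))
        = norm (CLINT x|expo_seq. iexp (G n x) * complex_of_real (?q n x) - iexp (G n x) * complex_of_real (exp (- (S n x)\<^sup>2 / (2 * \<beta>))))"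
        using i1 i2 by (simp only: Bochner_Integration.integral_diff)
      also have "\<dots> \<le> (\<integral>x. \<bar>?q n x - exp (- (S n x)\<^sup>2 / (2 * \<beta>))\<bar> \<partial>expo_seq)"
      proof (rule norm_integral_le[OF Bochner_Integration.integrable_diff[OF i1 i2] i3])
        fix x
        have "norm (iexp (G n x) * complex_of_real (?q n x) - iexp (G n x) * complex_of_real (exp (- (S n x)\<^sup>2 / (2 * \<beta>))))
          = norm (iexp (G n x) * complex_of_real (?q n x - exp (- (S n x)\<^sup>2 / (2 * \<beta>))))"
          by (simp only: of_real_diff right_diff_distrib)
        thus "norm (iexp (G n x) * complex_of_real (?q n x) - iexp (G n x) * complex_of_real (exp (- (S n x)\<^sup>2 / (2 * \<beta>)))) \<le> \<bar>?q n x - exp (- (S n x)\<^sup>2 / (2 * \<beta>))\<bar>"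
          by (simp only: norm_mult norm_exp_i_times norm_of_real mult_1 order_refl)
      qed
      finally show ?case by (simp only: S_def)
    qed
  qed
  from tendsto_add[OF this lim2] show ?thesis by (simp add: G_def l_def k_def)
qed

text \<open>The quotient of \<open>weighted_char\<close> at \<open>u\<close> by its value at 0: the
  factor \<kappa> cancels and leaves a normal law of variance \<alpha>.\<close>

lemma partial_sum_char:
  assumes K: "(\<lambda>n. K n / n) \<longlonglongrightarrow> \<alpha>" and \<alpha>: "0 < \<alpha>" "\<alpha> < 1"
  shows "(\<lambda>n. CLINT d|spacing_law (n - 1) n. iexp (u / (\<sigma> n * sqrt n) * (\<Sum>k<K n. gn n k d))) \<longlonglongrightarrow> complex_of_real (exp (- (\<alpha> * u\<^sup>2) / 2))"
proof -
  define \<kappa> where "\<kappa> = (\<integral>z. exp (- (\<alpha> * (z / sqrt (1 - \<alpha>))\<^sup>2) / 2) \<partial>std_normal_distribution)"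
  interpret Z: real_distribution std_normal_distribution by (rule real_dist_normal_dist)
  have \<kappa>: "\<kappa> > 0"
  proof -
    have i: "integrable std_normal_distribution (\<lambda>z. exp (- (\<alpha> * (z / sqrt (1 - \<alpha>))\<^sup>2) / 2))"
      by (rule Z.integrable_const_bound[of _ 1]) (use \<alpha> in auto)
    have "\<kappa> \<noteq> 0"
    proof
      assume "\<kappa> = 0"
      hence "AE z in std_normal_distribution. exp (- (\<alpha> * (z / sqrt (1 - \<alpha>))\<^sup>2) / 2) = 0"
        unfolding \<kappa>_def using integral_nonneg_eq_0_iff_AE[OF i] by simp
      thus False by simp
    qed
    moreover have "\<kappa> \<ge> 0" unfolding \<kappa>_def by simp
    ultimately show ?thesis by simp
  qed
  note lim = weighted_char[OF K \<alpha>, folded \<kappa>_def]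
  have den: "(\<lambda>n. complex_of_real (\<integral>x. gamma_ratio (n - (K n + m n)) (\<Sum>i<K n + m n. dev i x) \<partial>expo_seq)) \<longlonglongrightarrow> complex_of_real \<kappa>"
    using lim[of 0] by (simp only: integral_complex_of_real[symmetric]) simp
  have quot: "(\<lambda>n. (CLINT x|expo_seq. iexp (u / (\<sigma> n * sqrt n) * (\<Sum>k<K n. gn n k x)) * gamma_ratio (n - (K n + m n)) (\<Sum>i<K n + m n. dev i x))
      / complex_of_real (\<integral>x. gamma_ratio (n - (K n + m n)) (\<Sum>i<K n + m n. dev i x) \<partial>expo_seq))
    \<longlonglongrightarrow> complex_of_real (exp (- (\<alpha> * u\<^sup>2) / 2) * \<kappa>) / complex_of_real \<kappa>"
    by (intro tendsto_divide lim den) (use \<kappa> in simp)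
  have kn: "(\<lambda>n. (K n + m n) / n + 2 * (1 / n)) \<longlonglongrightarrow> \<alpha>"
    using tendsto_add[OF tendsto_add[OF K m_small] tendsto_mult[OF tendsto_const[of 2] lim_1_over_n]]
    by (simp add: add_divide_distrib)
  have k_le: "\<forall>\<^sub>F n in sequentially. K n + m n + 2 \<le> n"
    using order_tendstoD(2)[OF kn \<alpha>(2)] eventually_gt_at_top[of 0]
  proof eventually_elim
    case (elim n)
    have "(real (K n) + real (m n) + 2) / n < 1" using elim(1) by (simp add: add_divide_distrib)
    hence "real (K n) + real (m n) + 2 < n" using elim(2) by simp
    thus ?case by linarith
  qed
  have "\<forall>\<^sub>F n in sequentially. (CLINT x|expo_seq. iexp (u / (\<sigma> n * sqrt n) * (\<Sum>k<K n. gn n k x)) * gamma_ratio (n - (K n + m n)) (\<Sum>i<K n + m n. dev i x))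
      / complex_of_real (\<integral>x. gamma_ratio (n - (K n + m n)) (\<Sum>i<K n + m n. dev i x) \<partial>expo_seq)
    = (CLINT d|spacing_law (n - 1) n. iexp (u / (\<sigma> n * sqrt n) * (\<Sum>k<K n. gn n k d)))"
    using k_le ws
  proof eventually_elim
    case (elim n)
    interpret window_statistic "m n" "h n" by (rule elim)
    show ?case
    proof (rule spacing_law_initial_complex[symmetric, OF _ _ elim(1)])
      show "(\<lambda>x. iexp (u / (\<sigma> n * sqrt n) * (\<Sum>k<K n. g k x))) \<in> borel_measurable seqs" by measurable
      have "depends_on {..<K n + m n} (\<lambda>x. \<Sum>k<K n. g k x)"
        by (rule depends_on_sum, rule depends_on_mono[OF g_depends]) auto
      thus "depends_on {..<K n + m n} (\<lambda>x. iexp (u / (\<sigma> n * sqrt n) * (\<Sum>k<K n. g k x)))"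
        by (rule depends_on_comp)
    qed
  qed
  from Lim_transform_eventually[OF quot this] show ?thesis using \<kappa> by simp
qed

end

section \<open>From partial sums to the full circle\<close>

definition periodic :: "nat \<Rightarrow> (nat \<Rightarrow> real) \<Rightarrow> nat \<Rightarrow> real" where
  "periodic n d = (\<lambda>i. d (i mod n))"

lemma measurable_periodic [measurable]: "periodic n \<in> measurable seqs seqs"
  by (rule measurable_seqsI) (simp add: periodic_def)

lemma periodic_rotate:
  assumes "n \<ge> 1"
  shows "periodic n ((rotate_seq (n - 1) ^^ K) d) = (\<lambda>i. periodic n d (K + i))"
proof
  fix i
  have n: "Suc (n - 1) = n" using assms by simp
  have "i mod n < Suc (n - 1)" using assms by simp
  from rotate_seq_iterate[OF this, of K d]
  show "periodic n ((rotate_seq (n - 1) ^^ K) d) i = periodic n d (K + i)"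
    unfolding n by (cases "K = 0") (simp_all add: periodic_def mod_simps add.commute)
qed

lemma depends_on_periodic:
  assumes "depends_on {..<n} F"
  shows "F (periodic n d) = F d"
  by (rule depends_onD[OF assms]) (simp add: periodic_def)

lemma floor_fraction_limit:
  assumes "0 < \<alpha>" "\<alpha> < (1::real)"
  shows "(\<lambda>n. nat \<lfloor>\<alpha> * real n\<rfloor> / n) \<longlonglongrightarrow> \<alpha>"
proof (rule tendsto_sandwich[OF _ _ _ tendsto_const])
  show "\<forall>\<^sub>F n in sequentially. \<alpha> - 1 / n \<le> nat \<lfloor>\<alpha> * real n\<rfloor> / n"
    using eventually_gt_at_top[of 0]
  proof eventually_elim
    case (elim n)
    have "\<alpha> * n - 1 \<le> real (nat \<lfloor>\<alpha> * real n\<rfloor>)" using assms by linarith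
    hence "(\<alpha> * n - 1) / n \<le> real (nat \<lfloor>\<alpha> * real n\<rfloor>) / n" by (rule divide_right_mono) simp
    thus ?case using elim by (simp add: diff_divide_distrib)
  qed
  show "\<forall>\<^sub>F n in sequentially. nat \<lfloor>\<alpha> * real n\<rfloor> / n \<le> \<alpha>"
    using eventually_gt_at_top[of 0]
  proof eventually_elim
    case (elim n)
    have "real (nat \<lfloor>\<alpha> * real n\<rfloor>) \<le> \<alpha> * n" using assms by (simp add: of_nat_nat)
    thus ?case using elim by (simp add: field_simps)
  qed
  show "(\<lambda>n. \<alpha> - 1 / n) \<longlonglongrightarrow> \<alpha>" using tendsto_diff[OF tendsto_const[of \<alpha>] lim_1_over_n] by simp
qed

text \<open>Since |exp(iR) - 1|^2 = 2 - 2 cos R, the second-moment bound for the modulus controls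
  the difference by the law of \<open>R\<close> alone; nothing about its joint law with
  \<open>A\<close> is needed.\<close>

lemma (in prob_space) char_perturbation:
  fixes A R :: "'a \<Rightarrow> real"
  assumes [measurable]: "A \<in> borel_measurable M" "R \<in> borel_measurable M"
  shows "cmod ((CLINT x|M. iexp (A x + R x)) - (CLINT x|M. iexp (A x))) \<le> sqrt (2 - 2 * Re (CLINT x|M. iexp (R x)))"
proof -
  have i: "integrable M (\<lambda>x. iexp (f x))" if "f \<in> borel_measurable M" for f :: "'a \<Rightarrow> real"
    using that by (intro integrable_const_bound[of _ 1]) auto
  let ?f = "\<lambda>x. cmod (iexp (R x) - 1)"
  have sq: "(?f x)\<^sup>2 = 2 - 2 * cos (R x)" for x
  proof -
    have "(?f x)\<^sup>2 = (cos (R x) - 1)\<^sup>2 + (sin (R x))\<^sup>2"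
      by (simp add: cmod_power2 Re_exp Im_exp)
    also have "\<dots> = 2 - 2 * cos (R x)"
      using sin_cos_squared_add[of "R x"] by (simp add: power2_diff)
    finally show ?thesis .
  qed
  have icos: "integrable M (\<lambda>x. cos (R x))" by (rule integrable_const_bound[of _ 1]) auto
  have isq: "integrable M (\<lambda>x. (?f x)\<^sup>2)" unfolding sq using icos by simp
  have ire: "Re (CLINT x|M. iexp (R x)) = (\<integral>x. cos (R x) \<partial>M)"
    using integral_Re[OF i[of R]] by (simp add: Re_exp)
  have "(CLINT x|M. iexp (A x + R x)) - (CLINT x|M. iexp (A x)) = (CLINT x|M. iexp (A x + R x) - iexp (A x))"
    using i[of "\<lambda>x. A x + R x"] i[of A] by simp
  also have "cmod \<dots> \<le> (\<integral>x. \<bar>?f x\<bar> \<partial>M)"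
  proof (rule norm_integral_le)
    show "integrable M (\<lambda>x. iexp (A x + R x) - iexp (A x))" using i[of "\<lambda>x. A x + R x"] i[of A] by simp
    show "integrable M (\<lambda>x. \<bar>?f x\<bar>)" using i[of R] by simp
    fix x
    have "iexp (A x + R x) - iexp (A x) = iexp (A x) * (iexp (R x) - 1)"
      by (simp add: exp_add distrib_left right_diff_distrib)
    thus "cmod (iexp (A x + R x) - iexp (A x)) \<le> \<bar>?f x\<bar>"
      by (simp only: norm_mult norm_exp_i_times mult_1)
  qed
  also have "\<dots> \<le> sqrt (\<integral>x. (?f x)\<^sup>2 \<partial>M)"
    by (rule set_integral_abs_le_square[OF prob_space_axioms _ isq]) measurable
  also have "(\<integral>x. (?f x)\<^sup>2 \<partial>M) = 2 - 2 * Re (CLINT x|M. iexp (R x))"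
    unfolding sq ire using icos by (simp add: prob_space)
  finally show ?thesis .
qed

context spacing_array
begin

text \<open>\<open>partial_sum_char\<close> requires \<alpha> < 1, so the circle is cut at a
  fraction \<alpha>. After rotation, the remaining arc is again a partial sum, with fraction 1 -
  \<alpha>, and is a small perturbation when \<alpha> is near 1.\<close>

lemma total_char:
  "(\<lambda>n. CLINT d|spacing_law (n - 1) n. iexp (u / (\<sigma> n * sqrt n) * (\<Sum>k<n. gn n k (periodic n d)))) \<longlonglongrightarrow> complex_of_real (exp (- u\<^sup>2 / 2))"
proof (rule tendstoI)
  fix e :: real assume e: "e > 0"
  let ?\<phi> = "\<lambda>n. CLINT d|spacing_law (n - 1) n. iexp (u / (\<sigma> n * sqrt n) * (\<Sum>k<n. gn n k (periodic n d)))"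
  let ?b = "\<lambda>\<alpha>. \<bar>exp (- (\<alpha> * u\<^sup>2) / 2) - exp (- u\<^sup>2 / 2)\<bar> + sqrt (2 - 2 * exp (- ((1 - \<alpha>) * u\<^sup>2) / 2))"
  have "(?b \<longlongrightarrow> \<bar>exp (- (1 * u\<^sup>2) / 2) - exp (- u\<^sup>2 / 2)\<bar> + sqrt (2 - 2 * exp (- ((1 - 1) * u\<^sup>2) / 2))) (at_left 1)"
    by (intro tendsto_intros) auto
  hence "(?b \<longlongrightarrow> 0) (at_left 1)" by simp
  hence "\<forall>\<^sub>F \<alpha> in at_left 1. ?b \<alpha> < e / 2" by (rule order_tendstoD(2)) (use e in simp)
  moreover have "\<forall>\<^sub>F \<alpha> in at_left (1::real). \<alpha> \<in> {0<..<1}" by (rule eventually_at_left_real) simp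
  ultimately have "\<forall>\<^sub>F \<alpha> in at_left 1. ?b \<alpha> < e / 2 \<and> \<alpha> \<in> {0<..<1}" by (rule eventually_conj)
  \<comment> \<open>One \<alpha> is fixed for which the variance still missing and the perturbation
    bound cost less than \<open>e / 2\<close> in the limit; only then does \<open>n\<close>
    grow.\<close>
  then obtain \<alpha> where \<alpha>: "?b \<alpha> < e / 2" "0 < \<alpha>" "\<alpha> < 1"
    using eventually_happens'[OF trivial_limit_at_left_real] by force
  define K where "K n = nat \<lfloor>\<alpha> * real n\<rfloor>" for n
  define K' where "K' n = n - K n" for n
  have K: "(\<lambda>n. K n / n) \<longlonglongrightarrow> \<alpha>" unfolding K_def by (rule floor_fraction_limit[OF \<alpha>(2,3)])
  have npos: "\<forall>\<^sub>F n in sequentially. (n::nat) > 0" by (rule eventually_gt_at_top)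
  have K_le: "\<forall>\<^sub>F n in sequentially. K n \<le> n"
    using order_tendstoD(2)[OF K \<alpha>(3)] npos by eventually_elim simp
  have K': "(\<lambda>n. K' n / n) \<longlonglongrightarrow> 1 - \<alpha>"
  proof (rule Lim_transform_eventually)
    show "(\<lambda>n. 1 - K n / n) \<longlonglongrightarrow> 1 - \<alpha>" by (intro tendsto_diff tendsto_const K)
    show "\<forall>\<^sub>F n in sequentially. 1 - K n / n = K' n / n"
      using K_le npos by eventually_elim (simp add: K'_def of_nat_diff diff_divide_distrib)
  qed
  have fits: "\<forall>\<^sub>F n in sequentially. J n + m n \<le> n" if "(\<lambda>n. J n / n) \<longlonglongrightarrow> \<gamma>" "\<gamma> < 1" for J :: "nat \<Rightarrow> nat" and \<gamma> :: real
  proof -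
    have "(\<lambda>n. J n / n + m n / n) \<longlonglongrightarrow> \<gamma> + 0" by (intro tendsto_add that m_small)
    hence "\<forall>\<^sub>F n in sequentially. J n / n + m n / n < 1" using that(2) by (intro order_tendstoD(2)) auto
    thus ?thesis using npos
    proof eventually_elim
      case (elim n)
      have "(real (J n) + real (m n)) / n < 1" using elim(1) by (simp add: add_divide_distrib)
      hence "real (J n) + real (m n) < n" using elim(2) by simp
      thus ?case by linarith
    qed
  qed
  let ?\<phi>K = "\<lambda>n. CLINT d|spacing_law (n - 1) n. iexp (u / (\<sigma> n * sqrt n) * (\<Sum>k<K n. gn n k d))"
  let ?\<phi>R = "\<lambda>n. CLINT d|spacing_law (n - 1) n. iexp (u / (\<sigma> n * sqrt n) * (\<Sum>k<K' n. gn n k d))"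
  have limK: "?\<phi>K \<longlonglongrightarrow> complex_of_real (exp (- (\<alpha> * u\<^sup>2) / 2))" by (rule partial_sum_char[OF K \<alpha>(2,3)])
  have limR: "?\<phi>R \<longlonglongrightarrow> complex_of_real (exp (- ((1 - \<alpha>) * u\<^sup>2) / 2))"
    by (rule partial_sum_char[OF K']) (use \<alpha> in auto)
  have fits': "\<forall>\<^sub>F n in sequentially. K' n + m n \<le> n" by (rule fits[OF K']) (use \<alpha> in simp)
  have close: "\<forall>\<^sub>F n in sequentially. cmod (?\<phi> n - ?\<phi>K n) \<le> sqrt (2 - 2 * Re (?\<phi>R n))"
    using ws npos K_le fits[OF K \<alpha>(3)] fits'
  proof eventually_elim
    case (elim n)
    interpret window_statistic "m n" "h n" by (rule elim)
    have n1: "n \<ge> 1" using elim by simp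
    interpret SL: prob_space "spacing_law (n - 1) n" by (rule prob_space_spacing_law) (use elim in simp)
    let ?c = "u / (\<sigma> n * sqrt n)"
    let ?A = "\<lambda>d. ?c * (\<Sum>k<K n. g k (periodic n d))" and ?R = "\<lambda>d. ?c * (\<Sum>k=K n..<n. g k (periodic n d))"
    have per: "g k (periodic n d) = g k d" if "k + m n \<le> n" for k d
      by (rule depends_on_periodic, rule depends_on_mono[OF g_depends]) (use that in auto)
    have A: "?A d = ?c * (\<Sum>k<K n. g k d)" for d
    proof -
      have "(\<Sum>k<K n. g k (periodic n d)) = (\<Sum>k<K n. g k d)"
        by (intro sum.cong refl per) (use elim in auto)
      thus ?thesis by simp
    qed
    \<comment> \<open>Windows near the end wrap around. Restarting the circle at index
      \<open>K n\<close> moves all windows of the remainder into the first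
      \<open>K' n + m n <= n\<close> gaps, where none wraps.\<close>
    have R: "?R d = ?c * (\<Sum>k<K' n. g k ((rotate_seq (n - 1) ^^ K n) d))" for d
    proof -
      have "(\<Sum>k=K n..<n. g k (periodic n d)) = (\<Sum>k=0+K n..<K' n+K n. g k (periodic n d))"
        using elim by (simp add: K'_def)
      also have "\<dots> = (\<Sum>k<K' n. g (K n + k) (periodic n d))"
        unfolding sum.shift_bounds_nat_ivl by (simp add: lessThan_atLeast0 add.commute)
      also have "\<dots> = (\<Sum>k<K' n. g k (periodic n ((rotate_seq (n - 1) ^^ K n) d)))"
        unfolding periodic_rotate[OF n1] g_shift ..
      also have "\<dots> = (\<Sum>k<K' n. g k ((rotate_seq (n - 1) ^^ K n) d))"
        by (intro sum.cong refl per) (use elim in auto)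
      finally show ?thesis by simp
    qed
    have [measurable]: "(\<lambda>d. g k (periodic n d)) \<in> borel_measurable seqs" for k by measurable
    have "?\<phi> n = (CLINT d|spacing_law (n - 1) n. iexp (?A d + ?R d))"
    proof -
      have "(\<Sum>k<n. g k (periodic n d)) = (\<Sum>k<K n. g k (periodic n d)) + (\<Sum>k=K n..<n. g k (periodic n d))" for d
        unfolding lessThan_atLeast0 using elim by (intro sum.atLeastLessThan_concat[symmetric]) auto
      thus ?thesis by (simp only: distrib_left)
    qed
    moreover have "?\<phi>K n = (CLINT d|spacing_law (n - 1) n. iexp (?A d))" by (simp only: A)
    moreover have "?\<phi>R n = (CLINT d|spacing_law (n - 1) n. iexp (?R d))"
    proof -
      have [measurable]: "(\<lambda>d. iexp (?c * (\<Sum>k<K' n. g k d))) \<in> borel_measurable seqs" by measurable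
      have "?\<phi>R n = (CLINT d|distr (spacing_law (n - 1) n) seqs (rotate_seq (n - 1) ^^ K n). iexp (?c * (\<Sum>k<K' n. g k d)))"
        by (simp only: distr_rotate_iterate_spacing_law)
      also have "\<dots> = (CLINT d|spacing_law (n - 1) n. iexp (?c * (\<Sum>k<K' n. g k ((rotate_seq (n - 1) ^^ K n) d))))"
        by (rule integral_distr) measurable
      finally show ?thesis by (simp only: R)
    qed
    moreover have "cmod ((CLINT d|spacing_law (n - 1) n. iexp (?A d + ?R d)) - (CLINT d|spacing_law (n - 1) n. iexp (?A d)))
      \<le> sqrt (2 - 2 * Re (CLINT d|spacing_law (n - 1) n. iexp (?R d)))"
      by (rule SL.char_perturbation) measurable
    ultimately show ?case by (simp only:)
  qed
  have "(\<lambda>n. cmod (?\<phi>K n - complex_of_real (exp (- u\<^sup>2 / 2))) + sqrt (2 - 2 * Re (?\<phi>R n)))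
    \<longlonglongrightarrow> cmod (complex_of_real (exp (- (\<alpha> * u\<^sup>2) / 2)) - complex_of_real (exp (- u\<^sup>2 / 2))) + sqrt (2 - 2 * Re (complex_of_real (exp (- ((1 - \<alpha>) * u\<^sup>2) / 2))))"
    by (intro tendsto_add tendsto_norm tendsto_diff tendsto_const tendsto_real_sqrt tendsto_mult tendsto_Re limK limR)
  also have "cmod (complex_of_real (exp (- (\<alpha> * u\<^sup>2) / 2)) - complex_of_real (exp (- u\<^sup>2 / 2))) + sqrt (2 - 2 * Re (complex_of_real (exp (- ((1 - \<alpha>) * u\<^sup>2) / 2)))) = ?b \<alpha>"
    by (simp only: of_real_diff[symmetric] norm_of_real Re_complex_of_real)
  finally have "\<forall>\<^sub>F n in sequentially. cmod (?\<phi>K n - complex_of_real (exp (- u\<^sup>2 / 2))) + sqrt (2 - 2 * Re (?\<phi>R n)) < e"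
    by (rule order_tendstoD(2)) (use \<alpha>(1) e in linarith)
  with close show "\<forall>\<^sub>F n in sequentially. dist (?\<phi> n) (complex_of_real (exp (- u\<^sup>2 / 2))) < e"
  proof eventually_elim
    case (elim n)
    have "cmod (?\<phi> n - complex_of_real (exp (- u\<^sup>2 / 2))) \<le> cmod (?\<phi> n - ?\<phi>K n) + cmod (?\<phi>K n - complex_of_real (exp (- u\<^sup>2 / 2)))"
      using norm_triangle_ineq[of "?\<phi> n - ?\<phi>K n" "?\<phi>K n - complex_of_real (exp (- u\<^sup>2 / 2))"] by (simp only: diff_add_cancel add_diff_eq diff_add_eq)
    thus ?case using elim unfolding dist_norm by linarith
  qed
qed

end

section \<open>Overlapping spacings as windows of periodic gaps\<close>

lemma sort_map_mult:
  fixes c :: real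
  assumes "c \<ge> 0"
  shows "sort (map (\<lambda>x. c * x) xs) = map (\<lambda>x. c * x) (sort xs)"
proof (rule properties_for_sort)
  show "mset (map (\<lambda>x. c * x) (sort xs)) = mset (map (\<lambda>x. c * x) xs)" by simp
  show "sorted (map (\<lambda>x. c * x) (sort xs))"
    unfolding sorted_map
    by (rule sorted_wrt_mono_rel[of _ "(\<le>)"]) (simp_all add: mult_left_mono assms)
qed

text \<open>The jump of \<open>k div n\<close> when \<open>k\<close> passes a multiple of
  \<open>n\<close> matches the last gap, from the largest order statistic to the right end point.
  Scaling by \<open>n\<close> commutes with sorting.\<close>

lemma ordered_point_increment:
  assumes "n \<ge> 1"
  shows "real n * (ordered_point n y (Suc k) - ordered_point n y k) =
    periodic n (gaps (n - 1) n (svec (n - 1) (\<lambda>i. real n * y i))) k"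
proof -
  let ?s = "svec (n - 1) (\<lambda>i. real n * y i)"
  define j where "j = k mod n"
  have j: "j < n" using assms by (simp add: j_def)
  have srt: "sort (map (\<lambda>i. real n * y i) [0..<n - 1]) = map (\<lambda>x. real n * x) (sort (map y [0..<n - 1]))"
    using sort_map_mult[of "real n" "map y [0..<n - 1]"] by (simp add: o_def)
  have s: "?s i = real n * sort (map y [0..<n - 1]) ! i" if "i < n - 1" for i
  proof -
    have "?s i = sort (map (\<lambda>i. real n * y i) [0..<n - 1]) ! i"
      using that by (simp add: svec_def trunc_def)
    also have "\<dots> = map (\<lambda>x. real n * x) (sort (map y [0..<n - 1])) ! i" by (simp only: srt)
    also have "\<dots> = real n * sort (map y [0..<n - 1]) ! i" using that by (subst nth_map) simp_all
    finally show ?thesis .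
  qed
  have cn: "case_nat 0 ?s j = real n * (if j = 0 then 0 else sort (map y [0..<n - 1]) ! (j - 1))"
    using j s by (cases j) auto
  have pk: "real n * ordered_point n y k = real n * (k div n) + case_nat 0 ?s j"
    unfolding cn by (simp add: ordered_point_def j_def distrib_left)
  show ?thesis
  proof (cases "j < n - 1")
    case True
    hence ne: "Suc (k mod n) \<noteq> n" by (simp add: j_def)
    hence "Suc k mod n = Suc j" "Suc k div n = k div n"
      by (simp_all add: j_def mod_Suc div_Suc)
    hence "real n * ordered_point n y (Suc k) = real n * (k div n) + ?s j"
      using s[OF True] by (simp add: ordered_point_def distrib_left)
    moreover have "periodic n (gaps (n - 1) n ?s) k = ?s j - case_nat 0 ?s j"
      using True by (simp add: periodic_def gaps_def j_def del: One_nat_def)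
    ultimately show ?thesis using pk by (simp add: right_diff_distrib del: One_nat_def)
  next
    case False
    hence jn: "j = n - 1" using j by simp
    hence "Suc (k mod n) = n" using assms by (simp add: j_def)
    hence "Suc k mod n = 0" "Suc k div n = Suc (k div n)"
      by (simp_all add: mod_Suc div_Suc)
    hence "real n * ordered_point n y (Suc k) = real n * (k div n) + real n"
      by (simp add: ordered_point_def distrib_left)
    moreover have "periodic n (gaps (n - 1) n ?s) k = real n - case_nat 0 ?s (n - 1)"
      using jn by (simp add: periodic_def gaps_def j_def del: One_nat_def)
    ultimately show ?thesis using pk jn by (simp add: right_diff_distrib del: One_nat_def)
  qed
qed

lemma overlapping_spacing_window:
  assumes "n \<ge> 1"
  shows "real n * overlapping_spacing n m y k =
    window m k (periodic n (gaps (n - 1) n (svec (n - 1) (\<lambda>i. real n * y i))))"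
proof (induction m)
  case 0
  show ?case by (simp add: overlapping_spacing_def window_def)
next
  case (Suc m)
  have "real n * overlapping_spacing n (Suc m) y k = real n * overlapping_spacing n m y k + real n * (ordered_point n y (Suc (k + m)) - ordered_point n y (k + m))"
    by (simp add: overlapping_spacing_def right_diff_distrib)
  thus ?case by (simp only: Suc ordered_point_increment[OF assms]) (simp add: window_def)
qed

lemma sum_gaps: "(\<Sum>j<Suc N. gaps N c s j) = c"
proof -
  have "(\<Sum>j<M. s j - case_nat 0 s j) = case_nat 0 s M" for M
    by (induction M) auto
  thus ?thesis by (simp add: gaps_def)
qed

lemma scaled_uniform_law:
  assumes "prob_space M" and c: "c > 0"
    and Y: "distributed M lborel Y (\<lambda>x. indicator {0..1::real} x / measure lborel {0..1::real})"
  shows "distr M borel (\<lambda>\<omega>. c * Y \<omega>) = unif c"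
proof (rule measure_eqI)
  interpret prob_space M by fact
  have [measurable]: "Y \<in> borel_measurable M" using distributed_measurable[OF Y] by simp
  show "sets (distr M borel (\<lambda>\<omega>. c * Y \<omega>)) = sets (unif c)" by (simp add: unif_def)
  fix A assume "A \<in> sets (distr M borel (\<lambda>\<omega>. c * Y \<omega>))"
  hence A [measurable]: "A \<in> sets borel" by simp
  have "emeasure (distr M borel (\<lambda>\<omega>. c * Y \<omega>)) A = (\<integral>\<^sup>+x. indicator A x \<partial>distr M borel (\<lambda>\<omega>. c * Y \<omega>))"
    by simp
  also have "\<dots> = (\<integral>\<^sup>+\<omega>. indicator A (c * Y \<omega>) \<partial>M)"
    by (rule nn_integral_distr) simp_all
  also have "\<dots> = (\<integral>\<^sup>+x. ennreal (indicator {0..1} x / measure lborel {0..1::real}) * indicator A (c * x) \<partial>lborel)"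
    by (rule distributed_nn_integral[OF Y, symmetric]) measurable
  also have "\<dots> = ennreal \<bar>1 / c\<bar> * (\<integral>\<^sup>+x. ennreal (indicator {0..1} (0 + 1 / c * x) / measure lborel {0..1::real}) * indicator A (c * (0 + 1 / c * x)) \<partial>lborel)"
    by (rule nn_integral_real_affine) (use c in auto)
  also have "\<dots> = (\<integral>\<^sup>+x. ennreal \<bar>1 / c\<bar> * (ennreal (indicator {0..1} (0 + 1 / c * x) / measure lborel {0..1::real}) * indicator A (c * (0 + 1 / c * x))) \<partial>lborel)"
    by (rule nn_integral_cmult[symmetric]) measurable
  also have "\<dots> = (\<integral>\<^sup>+x. ennreal (indicator {0..c} x / c) * indicator A x \<partial>lborel)"
    using c by (intro nn_integral_cong) (auto simp: indicator_def field_simps)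
  also have "\<dots> = (\<integral>\<^sup>+x. indicator A x \<partial>unif c)"
    unfolding unif_def by (rule nn_integral_density[symmetric]) measurable
  also have "\<dots> = emeasure (unif c) A"
    by (rule nn_integral_indicator) (simp add: unif_def)
  finally show "emeasure (distr M borel (\<lambda>\<omega>. c * Y \<omega>)) A = emeasure (unif c) A" .
qed

lemma svec_trunc: "svec n (trunc n y) = svec n y"
proof -
  have eq: "map (trunc n y) [0..<n] = map y [0..<n]" by (simp add: trunc_def)
  show ?thesis unfolding svec_def eq ..
qed

lemma uniform_spacings_law:
  assumes "prob_space M" and n: "n \<ge> 1"
    and indep: "prob_space.indep_vars M (\<lambda>_. borel) Y {..<n - 1}"
    and Y: "\<And>i. i < n - 1 \<Longrightarrow> distributed M lborel (Y i) (\<lambda>x. indicator {0..1::real} x / measure lborel {0..1::real})"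
  defines "D \<equiv> \<lambda>\<omega>. gaps (n - 1) n (svec (n - 1) (\<lambda>i. real n * Y i \<omega>))"
  shows "D \<in> measurable M seqs" and "distr M seqs D = spacing_law (n - 1) n"
proof -
  interpret prob_space M by fact
  have n0: "real n > 0" using n by simp
  interpret U: real_sequence_space "unif (real n)" by (rule unif_sequence_space[OF n0])
  have rv: "Y i \<in> borel_measurable M" if "i < n - 1" for i using distributed_measurable[OF Y[OF that]] by simp
  have T [measurable]: "(\<lambda>\<omega>. trunc (n - 1) (\<lambda>i. real n * Y i \<omega>)) \<in> measurable M seqs"
  proof (rule measurable_seqsI)
    fix i
    show "(\<lambda>\<omega>. trunc (n - 1) (\<lambda>i. real n * Y i \<omega>) i) \<in> borel_measurable M"
    proof (cases "i < n - 1")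
      case True
      note [measurable] = rv[OF True]
      show ?thesis using True unfolding trunc_def by simp
    qed (simp add: trunc_def)
  qed
  have D: "D = (\<lambda>\<omega>. gaps (n - 1) n (svec (n - 1) (trunc (n - 1) (\<lambda>i. real n * Y i \<omega>))))"
    by (simp add: D_def svec_trunc)
  show "D \<in> measurable M seqs" unfolding D by measurable
  have "distr M seqs (\<lambda>\<omega>. trunc (n - 1) (\<lambda>i. real n * Y i \<omega>)) = distr U.S seqs (trunc (n - 1))"
  proof (rule distr_indep_trunc[OF prob_space_axioms U.real_sequence_space_axioms])
    show "indep_vars (\<lambda>_. borel) (\<lambda>i \<omega>. real n * Y i \<omega>) {..<n - 1}"
      by (rule indep_vars_compose2[OF indep]) simp
    show "distr M borel (\<lambda>\<omega>. real n * Y i \<omega>) = unif (real n)" if "i < n - 1" for i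
      by (rule scaled_uniform_law[OF prob_space_axioms n0 Y[OF that]])
  qed
  hence "distr (distr M seqs (\<lambda>\<omega>. trunc (n - 1) (\<lambda>i. real n * Y i \<omega>))) seqs (\<lambda>y. gaps (n - 1) n (svec (n - 1) y))
      = distr (distr U.S seqs (trunc (n - 1))) seqs (\<lambda>y. gaps (n - 1) n (svec (n - 1) y))" by simp
  also have "\<dots> = distr U.S seqs (\<lambda>y. gaps (n - 1) n (svec (n - 1) y))"
    by (subst distr_distr) (simp_all add: o_def svec_trunc)
  also have "\<dots> = spacing_law (n - 1) n" by (rule distr_sample_gaps[OF n0])
  finally show "distr M seqs D = spacing_law (n - 1) n"
    unfolding D by (subst (asm) distr_distr) (use T in \<open>simp_all add: o_def del: One_nat_def\<close>)
qed

section \<open>Identification of the moments of the exponential sample\<close>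

lemma exponential_transfer:
  fixes F :: "(nat \<Rightarrow> real) \<Rightarrow> real"
  assumes "prob_space M" and indep: "prob_space.indep_vars M (\<lambda>_. borel) X {..<n}"
    and X: "\<And>i. i < n \<Longrightarrow> distributed M lborel (X i) (exponential_density 1)"
    and F [measurable]: "F \<in> borel_measurable seqs" and dep: "depends_on {..<n} F"
  shows "(\<integral>\<omega>. F (\<lambda>i. X i \<omega>) \<partial>M) = (\<integral>x. F x \<partial>expo_seq)"
    and "integrable M (\<lambda>\<omega>. F (\<lambda>i. X i \<omega>)) \<longleftrightarrow> integrable expo_seq F"
proof -
  interpret prob_space M by fact
  have rv: "X i \<in> borel_measurable M" if "i < n" for i using distributed_measurable[OF X[OF that]] by simp
  have T [measurable]: "(\<lambda>\<omega>. trunc n (\<lambda>i. X i \<omega>)) \<in> measurable M seqs"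
  proof (rule measurable_seqsI)
    show "(\<lambda>\<omega>. trunc n (\<lambda>i. X i \<omega>) i) \<in> borel_measurable M" for i
      by (cases "i < n") (simp_all add: trunc_def rv)
  qed
  have tr: "F (trunc n x) = F x" for x using depends_on_trunc[OF dep] by simp
  have eq: "distr M seqs (\<lambda>\<omega>. trunc n (\<lambda>i. X i \<omega>)) = distr expo_seq seqs (trunc n)"
  proof (rule distr_indep_trunc[OF prob_space_axioms E.real_sequence_space_axioms indep])
    show "distr M borel (X i) = expo" if "i < n" for i
      using distributed_distr_eq_density[OF X[OF that]] by (metis distr_cong sets_lborel)
  qed
  have "(\<integral>\<omega>. F (\<lambda>i. X i \<omega>) \<partial>M) = (\<integral>x. F x \<partial>distr M seqs (\<lambda>\<omega>. trunc n (\<lambda>i. X i \<omega>)))"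
    by (subst integral_distr) (simp_all add: tr)
  also have "\<dots> = (\<integral>x. F x \<partial>expo_seq)" unfolding eq by (subst integral_distr) (simp_all add: tr)
  finally show "(\<integral>\<omega>. F (\<lambda>i. X i \<omega>) \<partial>M) = (\<integral>x. F x \<partial>expo_seq)" .
  have "integrable M (\<lambda>\<omega>. F (\<lambda>i. X i \<omega>)) \<longleftrightarrow> integrable (distr M seqs (\<lambda>\<omega>. trunc n (\<lambda>i. X i \<omega>))) F"
    by (subst integrable_distr_eq) (simp_all add: tr)
  also have "\<dots> \<longleftrightarrow> integrable expo_seq F" unfolding eq by (subst integrable_distr_eq) (simp_all add: tr)
  finally show "integrable M (\<lambda>\<omega>. F (\<lambda>i. X i \<omega>)) \<longleftrightarrow> integrable expo_seq F" .
qed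

lemma cyclic_sum_window:
  "cyclic_sum n m X (int j) \<omega> = window m j (periodic n (\<lambda>i. X i \<omega>))"
  by (simp add: cyclic_sum_def window_def periodic_def zmod_int[symmetric] flip: of_nat_add)

lemma cyclic_sum_mod:
  assumes "n \<ge> 1"
  shows "cyclic_sum n m X j \<omega> = cyclic_sum n m X (int (nat (j mod int n))) \<omega>"
  using assms by (simp add: cyclic_sum_def mod_simps)

text \<open>Under \<open>2 * m <= n\<close>, windows at lags between -m and m either fit below
  \<open>n\<close> or can be rotated until they do, so cyclic covariances agree with those of the
  infinite sequence.\<close>

locale exponential_sample = window_statistic m h for m :: nat and h +
  fixes M :: "'b measure" and n :: nat and X :: "nat \<Rightarrow> 'b \<Rightarrow> real"
  assumes M_prob: "prob_space M"
    and X_indep: "prob_space.indep_vars M (\<lambda>_. borel) X {..<n}"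
    and X_law: "\<And>i. i < n \<Longrightarrow> distributed M lborel (X i) (exponential_density 1)"
    and m_le: "2 * m \<le> n"
begin

lemmas transfer = exponential_transfer[OF M_prob X_indep X_law]

lemma n_pos: "n \<ge> 1" using m_pos m_le by simp

lemma periodic_depends: "depends_on {..<n} (\<lambda>x. F (periodic n x))"
proof (rule depends_onI)
  fix x y :: "nat \<Rightarrow> real"
  assume "\<And>i. i \<in> {..<n} \<Longrightarrow> x i = y i"
  hence "periodic n x = periodic n y" using n_pos by (simp add: periodic_def fun_eq_iff)
  thus "F (periodic n x) = F (periodic n y)" by simp
qed

lemma window_periodic: "j + m \<le> n \<Longrightarrow> window m j (periodic n x) = window m j x"
  by (rule depends_on_periodic, rule depends_on_mono[OF window_depends]) auto

lemma expectation_periodic_shift: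
  fixes F :: "(nat \<Rightarrow> real) \<Rightarrow> real"
  assumes "j < n" and [measurable]: "F \<in> borel_measurable seqs"
  shows "(\<integral>x. F (periodic n (\<lambda>i. periodic n x (i + j))) \<partial>expo_seq) = (\<integral>x. F (periodic n x) \<partial>expo_seq)"
proof -
  \<comment> \<open>The cyclic shift by \<open>j\<close> of the first \<open>n\<close> coordinates,
    extended by the identity so that it reindexes the infinite sequence.\<close>
  define p where "p i = (if i < n then (if i + j < n then i + j else i + j - n) else i)" for i
  have injp: "inj p"
  proof (rule injI)
    fix i k assume "p i = p k"
    thus "i = k" using assms(1) unfolding p_def by (simp split: if_splits)
  qed
  have p: "p (i mod n) = (i mod n + j) mod n" for i
  proof -
    have "i mod n < n" using n_pos by simp
    moreover have "i mod n + j - n < n" using \<open>i mod n < n\<close> assms(1) by linarith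
    ultimately show ?thesis by (cases "i mod n + j < n") (simp_all add: p_def le_mod_geq)
  qed
  have "(\<integral>x. F (periodic n (\<lambda>i. x (p i))) \<partial>expo_seq) = (\<integral>x. F (periodic n x) \<partial>expo_seq)"
    by (rule E.integral_permute[OF _ injp, of "\<lambda>x. F (periodic n x)"]) measurable
  moreover have "periodic n (\<lambda>i. x (p i)) = periodic n (\<lambda>i. periodic n x (i + j))" for x :: "nat \<Rightarrow> real"
    by (simp add: periodic_def p)
  ultimately show ?thesis by simp
qed

lemma window_periodic_shift:
  "window m k (periodic n (\<lambda>i. periodic n x (i + j))) = window m (k + j) (periodic n x)"
  unfolding window_def periodic_def by (intro sum.cong refl) (simp add: mod_simps ac_simps)

lemma H_periodic_shift:
  "H k (periodic n (\<lambda>i. periodic n x (i + j))) = H (k + j) (periodic n x)"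
  by (simp add: H_def window_periodic_shift)

lemma H_periodic: "j + m \<le> n \<Longrightarrow> H j (periodic n x) = H j x"
  by (simp add: H_def window_periodic)

lemma H_periodic_wrap: "H (n + j) (periodic n x) = H j (periodic n x)"
  by (simp add: H_def window_def periodic_def add.assoc)

lemma transfer_periodic:
  fixes F :: "(nat \<Rightarrow> real) \<Rightarrow> real"
  assumes [measurable]: "F \<in> borel_measurable seqs"
  shows "(\<integral>\<omega>. F (periodic n (\<lambda>i. X i \<omega>)) \<partial>M) = (\<integral>x. F (periodic n x) \<partial>expo_seq)"
  by (rule transfer(1)[OF _ _ periodic_depends, of F]) auto

lemma expectation_h_cyclic: "(\<integral>\<omega>. h (cyclic_sum n m X j \<omega>) \<partial>M) = a"
proof -
  define j' where "j' = nat (j mod int n)"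
  have j': "j' < n" using n_pos by (simp add: j'_def nat_less_iff)
  have "(\<integral>\<omega>. h (cyclic_sum n m X j \<omega>) \<partial>M) = (\<integral>\<omega>. h (window m j' (periodic n (\<lambda>i. X i \<omega>))) \<partial>M)"
    by (simp only: cyclic_sum_mod[OF n_pos, of m X j] cyclic_sum_window j'_def)
  also have "\<dots> = (\<integral>x. h (window m j' (periodic n x)) \<partial>expo_seq)"
    by (rule transfer_periodic) measurable
  also have "\<dots> = (\<integral>x. h (window m 0 (periodic n (\<lambda>i. periodic n x (i + j')))) \<partial>expo_seq)"
    by (simp add: window_periodic_shift)
  also have "\<dots> = (\<integral>x. h (window m 0 (periodic n x)) \<partial>expo_seq)"
    by (rule expectation_periodic_shift[OF j']) measurable
  also have "\<dots> = a" using window_periodic[of 0] m_le by (simp add: a_def)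
  finally show ?thesis .
qed

lemma cov_h:
  "cov M (\<lambda>\<omega>. h (cyclic_sum n m X 0 \<omega>)) (\<lambda>\<omega>. h (cyclic_sum n m X j \<omega>))
    = (\<integral>x. H 0 (periodic n x) * H (nat (j mod int n)) (periodic n x) \<partial>expo_seq)"
proof -
  have 0: "cyclic_sum n m X 0 \<omega> = window m 0 (periodic n (\<lambda>i. X i \<omega>))" for \<omega>
    using cyclic_sum_window[of n m X 0 \<omega>] by simp
  have j: "cyclic_sum n m X j \<omega> = window m (nat (j mod int n)) (periodic n (\<lambda>i. X i \<omega>))" for \<omega>
    by (simp only: cyclic_sum_mod[OF n_pos, of m X j] cyclic_sum_window)
  have "cov M (\<lambda>\<omega>. h (cyclic_sum n m X 0 \<omega>)) (\<lambda>\<omega>. h (cyclic_sum n m X j \<omega>))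
    = (\<integral>\<omega>. H 0 (periodic n (\<lambda>i. X i \<omega>)) * H (nat (j mod int n)) (periodic n (\<lambda>i. X i \<omega>)) \<partial>M)"
    unfolding cov_def expectation_h_cyclic by (simp only: 0 j H_def)
  also have "\<dots> = (\<integral>x. H 0 (periodic n x) * H (nat (j mod int n)) (periodic n x) \<partial>expo_seq)"
    by (rule transfer_periodic) measurable
  finally show ?thesis .
qed

text \<open>A lag -d wraps to the window starting at n - d. Rotation by d then exchanges the two
  windows, so the covariance is that of lag d.\<close>

lemma cov_h_eq:
  assumes "\<bar>j\<bar> < int m"
  shows "cov M (\<lambda>\<omega>. h (cyclic_sum n m X 0 \<omega>)) (\<lambda>\<omega>. h (cyclic_sum n m X j \<omega>))
    = (\<integral>x. H 0 x * H (nat \<bar>j\<bar>) x \<partial>expo_seq)"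
proof -
  define d where "d = nat \<bar>j\<bar>"
  have d: "d < m" using assms m_pos by (simp add: d_def nat_less_iff)
  have dn: "d + m \<le> n" using d m_le by simp
  have eq: "H 0 (periodic n x) * H d (periodic n x) = H 0 x * H d x" for x
    using H_periodic[of 0] H_periodic[OF dn] dn by simp
  show ?thesis
  proof (cases "j \<ge> 0")
    case True
    hence "nat (j mod int n) = d" using d dn by (simp add: d_def)
    thus ?thesis unfolding cov_h d_def[symmetric] by (simp only: eq)
  next
    case False
    hence j: "j = - int d" and d0: "d > 0" by (auto simp: d_def)
    have "j mod int n = (int n - int d) mod int n" by (simp add: j mod_simps)
    also have "\<dots> = int n - int d" using d0 dn by (intro mod_pos_pos_trivial) auto
    finally have jm: "nat (j mod int n) = n - d" using dn by (simp add: nat_diff_distrib)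
    have "(\<integral>x. H 0 (periodic n x) * H (n - d) (periodic n x) \<partial>expo_seq)
      = (\<integral>x. H 0 (periodic n (\<lambda>i. periodic n x (i + d))) * H (n - d) (periodic n (\<lambda>i. periodic n x (i + d))) \<partial>expo_seq)"
      by (rule expectation_periodic_shift[symmetric, of d "\<lambda>y. H 0 y * H (n - d) y"]) (use d dn in auto)
    also have "\<dots> = (\<integral>x. H d (periodic n x) * H 0 (periodic n x) \<partial>expo_seq)"
      using H_periodic_wrap[of 0] dn by (simp add: H_periodic_shift)
    also have "\<dots> = (\<integral>x. H 0 x * H d x \<partial>expo_seq)" by (simp only: mult.commute[of "H d _"] eq)
    finally show ?thesis unfolding cov_h jm d_def[symmetric] .
  qed
qed

lemma window_dev: "window m 0 x = (\<Sum>i<m. dev i x) + m"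
  by (simp add: window_def dev_def sum_subtractf)

lemma cov_window: "cov M (\<lambda>\<omega>. h (cyclic_sum n m X 0 \<omega>)) (cyclic_sum n m X 0) = c"
proof -
  have 0: "cyclic_sum n m X 0 \<omega> = window m 0 (periodic n (\<lambda>i. X i \<omega>))" for \<omega>
    using cyclic_sum_window[of n m X 0 \<omega>] by simp
  have per: "window m 0 (periodic n x) = window m 0 x" for x using window_periodic[of 0] m_le by simp
  have "(\<integral>\<omega>. cyclic_sum n m X 0 \<omega> \<partial>M) = (\<integral>x. window m 0 (periodic n x) \<partial>expo_seq)"
    unfolding 0 by (rule transfer_periodic) measurable
  also have "\<dots> = (\<integral>x. (\<Sum>i<m. dev i x) + m \<partial>expo_seq)" unfolding per unfolding window_dev ..
  also have "\<dots> = m"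
    using dev_moments(1) by (simp add: Bochner_Integration.integral_sum dev_moments(2))
  finally have mean: "(\<integral>\<omega>. cyclic_sum n m X 0 \<omega> \<partial>M) = m" .
  have "cov M (\<lambda>\<omega>. h (cyclic_sum n m X 0 \<omega>)) (cyclic_sum n m X 0)
    = (\<integral>\<omega>. H 0 (periodic n (\<lambda>i. X i \<omega>)) * (window m 0 (periodic n (\<lambda>i. X i \<omega>)) - m) \<partial>M)"
    unfolding cov_def expectation_h_cyclic mean by (simp only: 0 H_def)
  also have "\<dots> = (\<integral>x. H 0 (periodic n x) * (window m 0 (periodic n x) - m) \<partial>expo_seq)"
    by (rule transfer_periodic) measurable
  also have "\<dots> = (\<integral>x. H 0 x * (window m 0 x - m) \<partial>expo_seq)"
    using H_periodic[of 0] m_le by (simp add: per)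
  also have "\<dots> = c" unfolding c_def window_dev by simp
  finally show ?thesis .
qed

end

context exponential_sample
begin

lemma sum_symmetric_interval:
  fixes f :: "nat \<Rightarrow> real"
  assumes "1 \<le> q"
  shows "(\<Sum>j=- int q + 1..int q - 1. f (nat \<bar>j\<bar>)) = f 0 + 2 * (\<Sum>d=1..<q. f d)"
  using assms
proof (induction q rule: dec_induct)
  case base
  show ?case by simp
next
  case (step q)
  let ?I = "{- int q + 1..int q - 1}"
  have "{- int (Suc q) + 1..int (Suc q) - 1} = insert (int q) (insert (- int q) ?I)"
    using step.hyps(1) by (auto simp del: One_nat_def)
  moreover have "- int q \<notin> ?I" "int q \<notin> insert (- int q) ?I" using step.hyps(1) by auto
  ultimately have "(\<Sum>j=- int (Suc q) + 1..int (Suc q) - 1. f (nat \<bar>j\<bar>)) = f q + (f q + (\<Sum>j\<in>?I. f (nat \<bar>j\<bar>)))"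
    by (simp only: sum.insert finite_insert finite_atLeastAtMost_int) simp
  moreover have "(\<Sum>d=1..<Suc q. f d) = (\<Sum>d=1..<q. f d) + f q" using step.hyps(1) by simp
  ultimately show ?case using step.IH by linarith
qed

lemma sigma_sq_eq: "sigma_sq M n m h X = s2"
proof -
  let ?f = "\<lambda>d. \<integral>x. H 0 x * H d x \<partial>expo_seq"
  have "(\<Sum>j=- int m + 1..int m - 1. cov M (\<lambda>\<omega>. h (cyclic_sum n m X 0 \<omega>)) (\<lambda>\<omega>. h (cyclic_sum n m X j \<omega>)))
    = (\<Sum>j=- int m + 1..int m - 1. ?f (nat \<bar>j\<bar>))"
    by (intro sum.cong refl cov_h_eq) auto
  also have "\<dots> = ?f 0 + 2 * (\<Sum>d=1..<m. ?f d)" by (rule sum_symmetric_interval[OF m_pos])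
  finally show ?thesis unfolding sigma_sq_def cov_window s2_def by (simp add: power2_eq_square)
qed


lemma centered_g_eq: "centered_g M n m h X \<omega> = g 0 (\<lambda>i. X i \<omega>)"
proof -
  have "cyclic_sum n m X 0 \<omega> = window m 0 (periodic n (\<lambda>i. X i \<omega>))"
    using cyclic_sum_window[of n m X 0 \<omega>] by simp
  also have "\<dots> = window m 0 (\<lambda>i. X i \<omega>)" by (rule window_periodic) (use m_le in simp)
  finally have "cyclic_sum n m X 0 \<omega> = window m 0 (\<lambda>i. X i \<omega>)" .
  thus ?thesis
    unfolding centered_g_def cov_window expectation_h_cyclic g_def H_def dev_def by (simp only:)
qed

lemma g_depends_n: "depends_on {..<n} (g 0)"
  by (rule depends_on_mono[OF g_depends]) (use m_le in auto)

lemma g_moment_transfer: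
  "(\<integral>\<omega>. \<bar>centered_g M n m h X \<omega>\<bar> powr r \<partial>M) = (\<integral>x. \<bar>g 0 x\<bar> powr r \<partial>expo_seq)"
  "integrable M (\<lambda>\<omega>. \<bar>centered_g M n m h X \<omega>\<bar> powr r) \<longleftrightarrow> integrable expo_seq (\<lambda>x. \<bar>g 0 x\<bar> powr r)"
proof -
  have d: "depends_on {..<n} (\<lambda>x. \<bar>g 0 x\<bar> powr r)"
    by (rule depends_on_comp[OF g_depends_n])
  show "(\<integral>\<omega>. \<bar>centered_g M n m h X \<omega>\<bar> powr r \<partial>M) = (\<integral>x. \<bar>g 0 x\<bar> powr r \<partial>expo_seq)"
    unfolding centered_g_eq by (rule transfer(1)[OF _ _ d]) auto
  show "integrable M (\<lambda>\<omega>. \<bar>centered_g M n m h X \<omega>\<bar> powr r) \<longleftrightarrow> integrable expo_seq (\<lambda>x. \<bar>g 0 x\<bar> powr r)"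
    unfolding centered_g_eq by (rule transfer(2)[OF _ _ d]) auto
qed

end

lemma window_statistic_transfer:
  assumes "m \<ge> 1" "m \<le> n" and h: "h \<in> borel_measurable borel"
    and "prob_space M" "prob_space.indep_vars M (\<lambda>_. borel) X {..<n}"
    and "\<And>i. i < n \<Longrightarrow> distributed M lborel (X i) (exponential_density 1)"
    and sq: "integrable M (\<lambda>\<omega>. (h (cyclic_sum n m X 0 \<omega>))\<^sup>2)"
  shows "window_statistic m h"
proof (rule window_statistic.intro)
  note [measurable] = h
  have "cyclic_sum n m X 0 \<omega> = window m 0 (\<lambda>i. X i \<omega>)" for \<omega>
    unfolding cyclic_sum_def window_def
    by (intro sum.cong) (use assms(2) in simp_all)
  hence "integrable M (\<lambda>\<omega>. (h (window m 0 (\<lambda>i. X i \<omega>)))\<^sup>2)" using sq by (simp only:)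
  moreover have "depends_on {..<n} (\<lambda>x. window m 0 x)"
    by (rule depends_on_mono[OF window_depends]) (use assms(2) in auto)
  hence "depends_on {..<n} (\<lambda>x. (h (window m 0 x))\<^sup>2)"
    by (rule depends_on_comp)
  moreover have "(\<lambda>x. (h (window m 0 x))\<^sup>2) \<in> borel_measurable seqs" by measurable
  ultimately show "integrable expo_seq (\<lambda>x. (h (window m 0 x))\<^sup>2)"
    using exponential_transfer(2)[OF assms(4-6)] by blast
qed (fact assms)+

text \<open>The reason for working with \<open>g\<close>: on spacings the correction by
  \<open>c\<close> sums to zero exactly, whereas for independent exponentials it is what removes the
  covariance with the total.\<close>

lemma (in window_statistic) spacing_sum_centered:
  assumes "n \<ge> 1"
  shows "spacing_sum n m h Y \<omega> - n * a =
    (\<Sum>k<n. g k (periodic n (gaps (n - 1) n (svec (n - 1) (\<lambda>i. real n * Y i \<omega>)))))"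
proof -
  let ?D = "gaps (n - 1) n (svec (n - 1) (\<lambda>i. real n * Y i \<omega>))"
  \<comment> \<open>The scaled gaps fill the interval of length \<open>n\<close>, so their
    deviations from 1 cancel.\<close>
  have "(\<Sum>k<n. dev k (periodic n ?D)) = (\<Sum>k<Suc (n - 1). ?D k) - n"
    using assms by (simp add: dev_def periodic_def sum_subtractf)
  also have "\<dots> = 0" unfolding sum_gaps by simp
  finally have dev: "(\<Sum>k<n. dev k (periodic n ?D)) = 0" .
  have "spacing_sum n m h Y \<omega> = (\<Sum>k<n. h (window m k (periodic n ?D)))"
    unfolding spacing_sum_def overlapping_spacing_window[OF assms] ..
  also have "\<dots> = (\<Sum>k<n. H k (periodic n ?D)) + n * a"
    by (simp add: H_def sum_subtractf)
  also have "(\<Sum>k<n. H k (periodic n ?D)) = (\<Sum>k<n. g k (periodic n ?D)) + (\<Sum>k<n. dev k (periodic n ?D)) * c"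
    by (simp add: g_def sum_subtractf sum_distrib_right)
  finally show ?thesis using dev by simp
qed

lemma measurable_spacing_sum:
  assumes "prob_space M" and h [measurable]: "h \<in> borel_measurable borel"
    and "prob_space.indep_vars M (\<lambda>_. borel) Y {..<n - 1}"
    and "\<And>i. i < n - 1 \<Longrightarrow> distributed M lborel (Y i) (\<lambda>x. indicator {0..1::real} x / measure lborel {0..1::real})"
  shows "spacing_sum n m h Y \<in> borel_measurable M"
proof (cases "n \<ge> 1")
  case True
  note [measurable] = uniform_spacings_law(1)[OF assms(1) True assms(3,4)]
  show ?thesis
    unfolding spacing_sum_def[abs_def] overlapping_spacing_window[OF True] by measurable
next
  case False
  hence "n = 0" by simp
  thus ?thesis by (simp add: spacing_sum_def[abs_def])
qed

theorem corollary2p4: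
  fixes m :: "nat \<Rightarrow> nat"
    and h :: "nat \<Rightarrow> real \<Rightarrow> real"
    and M :: "nat \<Rightarrow> 'a measure"
    and Y :: "nat \<Rightarrow> nat \<Rightarrow> 'a \<Rightarrow> real"
    and N :: "nat \<Rightarrow> 'b measure"
    and X :: "nat \<Rightarrow> nat \<Rightarrow> 'b \<Rightarrow> real"
    and \<sigma> :: "nat \<Rightarrow> real"
    and r :: real
  assumes m_pos: "\<And>n. m n \<ge> 1"
    and m_small: "(\<lambda>n. real (m n)) \<in> o(\<lambda>n. real n)"
    and h_measurable: "\<And>n. h n \<in> borel_measurable borel"
    and M_prob: "\<And>n. prob_space (M n)"
    and Y_indep: "\<And>n. prob_space.indep_vars (M n) (\<lambda>_. borel) (Y n) {..<n - 1}"
    and Y_uniform: "\<And>n i. i < n - 1 \<Longrightarrow>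
          distributed (M n) lborel (Y n i) (\<lambda>x. indicator {0..1::real} x / measure lborel {0..1::real})"
    and N_prob: "\<And>n. prob_space (N n)"
    and X_indep: "\<And>n. prob_space.indep_vars (N n) (\<lambda>_. borel) (X n) {..<n}"
    and X_exponential: "\<And>n i. i < n \<Longrightarrow> distributed (N n) lborel (X n i) (exponential_density 1)"
    and \<sigma>_eq: "\<And>n. \<sigma> n = sqrt (sigma_sq (N n) n (m n) (h n) (X n))"
    and \<sigma>_pos: "\<forall>\<^sub>F n in sequentially. \<sigma> n > 0"
    and r_gt_2: "r > 2"
    and h_square_integrable: "\<forall>\<^sub>F n in sequentially.
          integrable (N n) (\<lambda>\<omega>. (h n (cyclic_sum n (m n) (X n) 0 \<omega>))\<^sup>2)"
    and g_moment_finite: "\<forall>\<^sub>F n in sequentially.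
          integrable (N n) (\<lambda>\<omega>. \<bar>centered_g (N n) n (m n) (h n) (X n) \<omega>\<bar> powr r)"
    and moment_condition:
      "(\<lambda>n. real (m n) powr (r - 1) / (real n powr ((r - 2) / 2) * \<sigma> n powr r)
          * prob_space.expectation (N n)
              (\<lambda>\<omega>. \<bar>centered_g (N n) n (m n) (h n) (X n) \<omega>\<bar> powr r)) \<longlonglongrightarrow> 0"
  shows "weak_conv_m
     (\<lambda>n. distr (M n) borel (\<lambda>\<omega>.
        (spacing_sum n (m n) (h n) (Y n) \<omega>
           - real n * prob_space.expectation (N n) (\<lambda>\<omega>'. h n (cyclic_sum n (m n) (X n) 0 \<omega>')))
        / (\<sigma> n * sqrt (real n))))
     std_normal_distribution"
proof -
  have m_frac: "(\<lambda>n. m n / n) \<longlonglongrightarrow> 0" by (rule smalloD_tendsto[OF m_small])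
  have "\<forall>\<^sub>F n in sequentially. m n / n < 1 / 2"
    by (rule order_tendstoD(2)[OF m_frac]) simp
  moreover have n_pos: "\<forall>\<^sub>F n in sequentially. n > (0::nat)" by (rule eventually_gt_at_top)
  ultimately have "\<forall>\<^sub>F n in sequentially. 2 * m n \<le> n"
    by eventually_elim (simp add: field_simps)
  hence sample: "\<forall>\<^sub>F n in sequentially. exponential_sample (m n) (h n) (N n) n (X n)"
    using h_square_integrable
  proof eventually_elim
    case (elim n)
    have "window_statistic (m n) (h n)"
      by (rule window_statistic_transfer[OF m_pos _ h_measurable N_prob X_indep X_exponential elim(2)])
        (use elim(1) in auto)
    thus ?case
      by (intro exponential_sample.intro exponential_sample_axioms.intro N_prob X_indep X_exponential elim(1))
  qed
  have "spacing_array m h \<sigma> r"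
  proof
    show "\<forall>\<^sub>F n in sequentially. window_statistic (m n) (h n)"
      using sample by eventually_elim (rule exponential_sample.axioms(1))
    show "\<forall>\<^sub>F n in sequentially. (\<sigma> n)\<^sup>2 = window_statistic.s2 (m n) (h n)"
      using sample \<sigma>_pos
    proof eventually_elim
      case (elim n)
      have "sigma_sq (N n) n (m n) (h n) (X n) > 0" using elim(2) by (simp add: \<sigma>_eq)
      thus ?case by (simp add: \<sigma>_eq exponential_sample.sigma_sq_eq[OF elim(1)])
    qed
    show "\<forall>\<^sub>F n in sequentially. integrable expo_seq (\<lambda>x. \<bar>window_statistic.g (m n) (h n) 0 x\<bar> powr r)"
      using sample g_moment_finite
      by eventually_elim (simp only: exponential_sample.g_moment_transfer(2))
    show "(\<lambda>n. m n powr (r - 1) / (n powr ((r - 2) / 2) * \<sigma> n powr r)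
        * (\<integral>x. \<bar>window_statistic.g (m n) (h n) 0 x\<bar> powr r \<partial>expo_seq)) \<longlonglongrightarrow> 0"
    proof (rule Lim_transform_eventually[OF moment_condition])
      show "\<forall>\<^sub>F n in sequentially. m n powr (r - 1) / (n powr ((r - 2) / 2) * \<sigma> n powr r)
          * (\<integral>\<omega>. \<bar>centered_g (N n) n (m n) (h n) (X n) \<omega>\<bar> powr r \<partial>N n)
        = m n powr (r - 1) / (n powr ((r - 2) / 2) * \<sigma> n powr r)
          * (\<integral>x. \<bar>window_statistic.g (m n) (h n) 0 x\<bar> powr r \<partial>expo_seq)"
        using sample by eventually_elim (simp only: exponential_sample.g_moment_transfer(1))
    qed
  qed (fact \<sigma>_pos m_frac r_gt_2)+
  then interpret spacing_array m h \<sigma> r .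
  define V where "V n \<omega> = (spacing_sum n (m n) (h n) (Y n) \<omega>
      - n * (\<integral>\<omega>'. h n (cyclic_sum n (m n) (X n) 0 \<omega>') \<partial>N n)) / (\<sigma> n * sqrt n)" for n \<omega>
  have V_measurable [measurable]: "V n \<in> borel_measurable (M n)" for n
  proof -
    note [measurable] = measurable_spacing_sum[OF M_prob h_measurable Y_indep Y_uniform]
    show ?thesis unfolding V_def by measurable
  qed
  have char_V: "(\<lambda>n. char (distr (M n) borel (V n)) t) \<longlonglongrightarrow> char std_normal_distribution t" for t
    unfolding char_std_normal_distribution
  \<comment> \<open>For large \<open>n\<close> the normalised statistic is exactly the scaled sum of
    \<open>g\<close> over the gaps of the scaled sample, and the law of these gaps is
    \<open>spacing_law (n - 1) n\<close>.\<close>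
  proof (rule Lim_transform_eventually[OF total_char])
    show "\<forall>\<^sub>F n in sequentially.
      (CLINT d|spacing_law (n - 1) n. iexp (t / (\<sigma> n * sqrt n) * (\<Sum>k<n. gn n k (periodic n d))))
        = char (distr (M n) borel (V n)) t"
      using sample n_pos
    proof eventually_elim
      case (elim n)
      interpret W: exponential_sample "m n" "h n" "N n" n "X n" by (rule elim(1))
      define D where "D \<omega> = gaps (n - 1) n (svec (n - 1) (\<lambda>i. real n * Y n i \<omega>))" for \<omega>
      note D = uniform_spacings_law[OF M_prob W.n_pos Y_indep Y_uniform, folded D_def[abs_def]]
      note [measurable] = D(1)
      have V: "V n \<omega> = (\<Sum>k<n. gn n k (periodic n (D \<omega>))) / (\<sigma> n * sqrt n)" for \<omega>
        unfolding V_def W.expectation_h_cyclic W.spacing_sum_centered[OF W.n_pos] D_def ..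
      have "(CLINT d|spacing_law (n - 1) n. iexp (t / (\<sigma> n * sqrt n) * (\<Sum>k<n. gn n k (periodic n d))))
        = (CLINT d|distr (M n) seqs D. iexp (t / (\<sigma> n * sqrt n) * (\<Sum>k<n. gn n k (periodic n d))))"
        by (simp only: D(2))
      also have "\<dots> = (CLINT \<omega>|M n. iexp (t / (\<sigma> n * sqrt n) * (\<Sum>k<n. gn n k (periodic n (D \<omega>)))))"
        by (rule integral_distr) measurable
      also have "\<dots> = (CLINT \<omega>|M n. iexp (t * V n \<omega>))" by (simp add: V)
      also have "\<dots> = char (distr (M n) borel (V n)) t"
        unfolding char_def by (rule integral_distr[symmetric]) measurable
      finally show ?case .
    qed
  qed
  have "weak_conv_m (\<lambda>n. distr (M n) borel (V n)) std_normal_distribution"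
    by (rule levy_continuity[OF prob_space.real_distribution_distr[OF M_prob V_measurable] real_dist_normal_dist char_V])
  thus ?thesis unfolding V_def .
qed

end
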